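(* Suppose $E_0\in\mathbb{R}$ is such that there exist $C>0$ and $\alpha>0$ with $E_0\in P(\alpha,C,N)$ for all sufficiently large $N$. For each such $N$ let $A(N)$ be a subset of $P(\alpha,C,N)$ containing $E_0$, such that $\operatorname{diam}(A(N))\to 0$ as $N\to\infty$. Let $p>0$. Then, for every compactly supported $f\in L^2(0,\infty)$ with $\langle u_{0,E_0},f\rangle\neq 0$, there exists $\widetilde C>0$ such that for all $T$ large enough, $$M_{f,D}(T,p)\ \ge\ \widetilde C\,|B(T)|\,T^{\frac{p-3\alpha}{1+\alpha}},$$ where $B(T)$ is the $1/T$-neighborhood of $A\big(T^{\frac1{1+\alpha}}\big)$.
   Context: $V:\mathbb{R}\to\mathbb{R}$ is measurable with $\sup_{x\in\mathbb{R}}\int_x^{x+1}|V(t)|\,dt<\infty$. $H_D$ denotes the selfadjoint operator on $L^2(0,\infty)$ associated to $\varphi\mapsto-\varphi''+V\varphi$ with Dirichlet boundary condition at $0$. For $f\in L^2(0,\infty)$, $T>0$, $p>0$, $$M_{f,D}(T,p)=\frac2T\int_0^\infty e^{-2t/T}\,\big\||X|^{p/2}e^{-itH_D}f\big\|^2\,dt,$$ where $(X\varphi)(x)=x\varphi(x)$ (the norm is $+\infty$ if the vector is not in the domain of $|X|^{p/2}$). For $z\in\mathbb{C}$ consider solutions of $-u''+(V-z)u=0$. The transfer matrix $M(x,y,z)$ is the unique $2\times2$ matrix with $M(x,y,z)(u(y),u'(y))^t=(u(x),u'(x))^t$ for every solution $u$. $u_{0,z}$ is the solution with $u_{0,z}(0)=0$,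 $u_{0,z}'(0)=1$. For $\alpha>0$, $C>0$ and (real) $N>1$, $$P(\alpha,C,N)=\{E\in\mathbb{R}:\ \|M(x,y,E)\|\le CN^\alpha\ \text{for all }0\le x,y\le N\}.$$ For locally bounded measurable $g$ and compactly supported $f\in L^2$, $\langle g,f\rangle=\int g(t)\overline{f(t)}\,dt$. $|\cdot|$ of a set is Lebesgue measure; the $1/T$-neighborhood of $A\subset\mathbb{R}$ is the set of real numbers at distance less than $1/T$ from $A$. *)

theory Defs
  imports "HOL-Analysis.Analysis"
begin

definition unif_loc_L1 :: "(real \<Rightarrow> real) \<Rightarrow> bool" where
  "unif_loc_L1 V \<longleftrightarrow>
     V \<in> borel_measurable lebesgue \<and>
     (SUP x. \<integral>\<^sup>+t\<in>{x..x+1}. ennreal \<bar>V t\<bar> \<partial>lebesgue) < \<infinity>"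

text \<open>
  On an interval \<open>I\<close>, \<open>f\<close> is locally absolutely continuous with almost everywhere derivative \<open>g\<close>,
  that is, \<open>f\<close> is an indefinite integral of the locally integrable function \<open>g\<close>.
\<close>

definition has_ac_derivative_on ::
    "(real \<Rightarrow> complex) \<Rightarrow> (real \<Rightarrow> complex) \<Rightarrow> real set \<Rightarrow> bool" where
  "has_ac_derivative_on f g I \<longleftrightarrow>
     (\<forall>a\<in>I. \<forall>b\<in>I. a \<le> b \<longrightarrow>
        g absolutely_integrable_on {a..b} \<and> f b - f a = integral {a..b} g)"

text \<open>
  \<open>-u'' + (V - z) u = h\<close> on \<open>I\<close>, with \<open>u\<close> and its derivative \<open>u'\<close> locally absolutely continuous
  and the equation holding almost everywhere. Being continuous, \<open>u'\<close> is the classical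
  derivative of \<open>u\<close>.
\<close>

definition schroedinger_eq ::
    "(real \<Rightarrow> real) \<Rightarrow> complex \<Rightarrow> (real \<Rightarrow> complex) \<Rightarrow> real set \<Rightarrow>
     (real \<Rightarrow> complex) \<Rightarrow> (real \<Rightarrow> complex) \<Rightarrow> bool" where
  "schroedinger_eq V z h I u u' \<longleftrightarrow>
     has_ac_derivative_on u u' I \<and>
     has_ac_derivative_on u' (\<lambda>x. (complex_of_real (V x) - z) * u x - h x) I"

abbreviation solution ::
    "(real \<Rightarrow> real) \<Rightarrow> complex \<Rightarrow> (real \<Rightarrow> complex) \<Rightarrow> (real \<Rightarrow> complex) \<Rightarrow> bool" where
  "solution V z \<equiv> schroedinger_eq V z (\<lambda>_. 0) UNIV"

definition transfer_matrix :: "(real \<Rightarrow> real) \<Rightarrow> real \<Rightarrow> real \<Rightarrow> complex \<Rightarrow> complex^2^2" where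
  "transfer_matrix V x y z =
     (THE M. \<forall>u u'. solution V z u u' \<longrightarrow> M *v vector [u y, u' y] = vector [u x, u' x])"

definition dirichlet_solution :: "(real \<Rightarrow> real) \<Rightarrow> complex \<Rightarrow> real \<Rightarrow> complex" where
  "dirichlet_solution V z = (THE u. \<exists>u'. solution V z u u' \<and> u 0 = 0 \<and> u' 0 = 1)"

definition power_bounded_energies :: "(real \<Rightarrow> real) \<Rightarrow> real \<Rightarrow> real \<Rightarrow> real \<Rightarrow> real set" where
  "power_bounded_energies V \<alpha> C N =
     {E. \<forall>x\<in>{0..N}. \<forall>y\<in>{0..N}.
           onorm ((*v) (transfer_matrix V x y (complex_of_real E))) \<le> C * N powr \<alpha>}"

text \<open>
  Elements of \<open>L\<^sup>2(0,\<infinity>)\<close> are represented by functions; equality of elements is equality almost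
  everywhere on the half-line. Values outside the half-line are irrelevant.
\<close>

abbreviation half_line :: "real measure" where
  "half_line \<equiv> lebesgue_on {0<..}"

definition L2 :: "(real \<Rightarrow> complex) set" where
  "L2 = {f \<in> borel_measurable half_line. integrable half_line (\<lambda>x. (cmod (f x))\<^sup>2)}"

definition L2_norm :: "(real \<Rightarrow> complex) \<Rightarrow> real" where
  "L2_norm f = sqrt (\<integral>x. (cmod (f x))\<^sup>2 \<partial>half_line)"

definition compactly_supported :: "(real \<Rightarrow> complex) \<Rightarrow> bool" where
  "compactly_supported f \<longleftrightarrow> (\<exists>R. AE x in half_line. R < x \<longrightarrow> f x = 0)"

definition pairing :: "(real \<Rightarrow> complex) \<Rightarrow> (real \<Rightarrow> complex) \<Rightarrow> complex" where
  "pairing g f = (\<integral>x. g x * cnj (f x) \<partial>half_line)"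

text \<open>
  The graph of \<open>H\<^sub>D\<close>: \<open>\<phi>\<close> lies in the domain and \<open>H\<^sub>D \<phi> = \<psi>\<close>. The domain consists of all
  \<open>\<phi> \<in> L\<^sup>2\<close> with a representative \<open>u\<close> such that \<open>u\<close> and \<open>u'\<close> are locally absolutely continuous
  up to the boundary point, \<open>u 0 = 0\<close>, and \<open>-u'' + V u \<in> L\<^sup>2\<close>. Since \<open>V\<close> is uniformly locally
  integrable, \<open>0\<close> is a regular endpoint and infinity is in the limit point case, so that no
  further boundary condition is needed for selfadjointness.
\<close>

definition dirichlet_operator ::
    "(real \<Rightarrow> real) \<Rightarrow> (real \<Rightarrow> complex) \<Rightarrow> (real \<Rightarrow> complex) \<Rightarrow> bool" where
  "dirichlet_operator V \<phi> \<psi> \<longleftrightarrow>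
     \<phi> \<in> L2 \<and> \<psi> \<in> L2 \<and>
     (\<exists>u u'. (AE x in half_line. \<phi> x = u x) \<and> schroedinger_eq V 0 \<psi> {0..} u u' \<and> u 0 = 0)"

text \<open>Strong continuity is demanded at \<open>0\<close> only. Strong continuity elsewhere, invertibility of the
  isometries \<open>U t\<close>, and their compatibility with equality almost everywhere, follow.\<close>

definition unitary_group :: "(real \<Rightarrow> (real \<Rightarrow> complex) \<Rightarrow> (real \<Rightarrow> complex)) \<Rightarrow> bool" where
  "unitary_group U \<longleftrightarrow>
     (\<forall>t. \<forall>f\<in>L2. U t f \<in> L2 \<and> L2_norm (U t f) = L2_norm f) \<and>
     (\<forall>t a b. \<forall>f\<in>L2. \<forall>g\<in>L2.
        AE x in half_line. U t (\<lambda>y. a * f y + b * g y) x = a * U t f x + b * U t g x) \<and>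
     (\<forall>f\<in>L2. AE x in half_line. U 0 f x = f x) \<and>
     (\<forall>s t. \<forall>f\<in>L2. AE x in half_line. U (s + t) f x = U s (U t f) x) \<and>
     (\<forall>f\<in>L2. ((\<lambda>t. L2_norm (\<lambda>x. U t f x - f x)) \<longlongrightarrow> 0) (at 0))"

text \<open>
  \<open>U t = exp (- \<i> t H)\<close> for a selfadjoint operator \<open>H\<close>, given by its graph: by Stone's theorem
  \<open>t \<mapsto> exp (- \<i> t H)\<close> is the unique strongly continuous unitary group with infinitesimal
  generator \<open>- \<i> H\<close>. The equivalence includes the equality of the domains.
\<close>

definition evolution_of ::
    "((real \<Rightarrow> complex) \<Rightarrow> (real \<Rightarrow> complex) \<Rightarrow> bool) \<Rightarrow>
     (real \<Rightarrow> (real \<Rightarrow> complex) \<Rightarrow> (real \<Rightarrow> complex)) \<Rightarrow> bool" where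
  "evolution_of H U \<longleftrightarrow>
     unitary_group U \<and>
     (\<forall>\<phi>\<in>L2. \<forall>\<psi>\<in>L2.
        H \<phi> \<psi> \<longleftrightarrow>
        ((\<lambda>t. L2_norm (\<lambda>x. (U t \<phi> x - \<phi> x) / complex_of_real t - (- \<i> * \<psi> x))) \<longlongrightarrow> 0) (at 0))"

text \<open>\<open>\<parallel>\<bar>X\<bar>\<^sup>q \<phi>\<parallel>\<^sup>2\<close>, which is infinite outside of the domain of \<open>\<bar>X\<bar>\<^sup>q\<close>.\<close>

definition position_norm2 :: "real \<Rightarrow> (real \<Rightarrow> complex) \<Rightarrow> ennreal" where
  "position_norm2 q \<phi> =
     (\<integral>\<^sup>+x. ennreal ((cmod (complex_of_real (\<bar>x\<bar> powr q) * \<phi> x))\<^sup>2) \<partial>half_line)"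

definition averaged_moment ::
    "(real \<Rightarrow> (real \<Rightarrow> complex) \<Rightarrow> (real \<Rightarrow> complex)) \<Rightarrow> (real \<Rightarrow> complex) \<Rightarrow>
     real \<Rightarrow> real \<Rightarrow> ennreal" where
  "averaged_moment U f T p =
     ennreal (2 / T) *
     (\<integral>\<^sup>+t\<in>{0..}. ennreal (exp (- 2 * t / T)) * position_norm2 (p / 2) (U t f) \<partial>lebesgue)"

definition neighborhood :: "real \<Rightarrow> real set \<Rightarrow> real set" where
  "neighborhood r S = {x. \<exists>a\<in>S. dist x a < r}"

end

theory Submission
  imports Defs
begin

text \<open>
  No resolvent is constructed. Put \<open>N = T powr (1 / (1 + \<alpha>))\<close>, and for \<open>E\<close> in \<open>B(T)\<close> let \<open>u\<close> be the
  Dirichlet solution at \<open>z = E + 2 \<i> / T\<close>. If \<open>\<theta>\<close> is a smooth cutoff that decreases from 1 to 0 on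
  \<open>[N/2, N]\<close>, then \<open>\<eta> = \<theta> cnj u\<close> lies in the domain of \<open>H\<close>, and \<open>k = (H - cnj z) \<eta> = - \<theta>'' cnj u - 2 \<theta>' cnj u'\<close>
  is supported in \<open>[N/2, N]\<close>. Integrating the derivative of \<open>exp (\<i> z t) \<langle>exp (- \<i> t H) f, \<eta>\<rangle>\<close> over
  \<open>t > 0\<close> gives \<open>\<integral> exp (\<i> z t) \<langle>exp (- \<i> t H) f, k\<rangle> dt = - \<i> \<langle>f, \<eta>\<rangle>\<close>. The right-hand side tends to a
  multiple of \<open>\<langle>u, f\<rangle>\<close> at energy \<open>E\<^sub>0\<close>, hence stays away from 0. On the left, \<open>k = O(N powr (\<alpha> - 1))\<close> pointwise,
  because the bounds on the transfer matrices persist within distance \<open>3 / T\<close> of \<open>A N\<close>. Integrating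
  over \<open>E\<close> in \<open>B(T)\<close>, duality and a Plancherel inequality turn this into a lower bound
  \<open>const |B(T)| N powr (1 - 2 \<alpha>)\<close> for the time-averaged mass in \<open>[N/2, N]\<close>.
\<close>

section \<open>Absolutely continuous functions\<close>

text \<open>The scale \<open>N\<close> is dictated by the transfer matrices: moving the energy by at
  most 3 / T changes the power bound by a factor depending only on
  \<open>C * N powr \<alpha> * (3 / T) * N\<close>, which is the constant \<open>3 * C\<close> when
  \<open>T = N powr (1 + \<alpha>)\<close>. The moment adds N powr p from the position weight and N
  powr (- 1 - \<alpha>) from the prefactor 2 / T, so the final exponent is p + (1 - 2 \<alpha>) - (1
  + \<alpha>) = p - 3 \<alpha>. The imaginary part is 2 / T and not the 1 / T of the resolvent form
  of Plancherel's identity: the Laplace factor exp (- 2 t / T) serves undivided as the weight of a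
  duality argument, so it has to be the averaging weight itself. The obstacle is measurability.
  \<open>U t\<close> selects a representative for each \<open>t\<close> separately, hence
  \<open>U t f x\<close> is not known to be jointly measurable in \<open>t\<close> and
  \<open>x\<close>, nor its moments to be measurable in \<open>t\<close>. The argument therefore
  relies on scalar products, which are continuous in \<open>t\<close>, and on lower bounds for
  nonnegative integrals that hold for arbitrary integrands.\<close>

text \<open>Bisecting at a point where \<open>H\<close> takes its mean value halves the bound, so it can be iterated.\<close>

lemma constant_if_dist_le_square:
  fixes D :: "real \<Rightarrow> 'a::real_normed_vector" and H :: "real \<Rightarrow> real"
  assumes "a \<le> b" and H: "continuous_on {a..b} H"
    and mono: "\<And>c d. a \<le> c \<Longrightarrow> c \<le> d \<Longrightarrow> d \<le> b \<Longrightarrow> H c \<le> H d"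
    and bound: "\<And>c d. a \<le> c \<Longrightarrow> c \<le> d \<Longrightarrow> d \<le> b \<Longrightarrow> norm (D d - D c) \<le> (H d - H c)\<^sup>2"
  shows "D b = D a"
proof -
  have halve: "norm (D d - D c) \<le> (H d - H c)\<^sup>2 / 2 ^ k" if "a \<le> c" "c \<le> d" "d \<le> b" for c d k
    using that
  proof (induction k arbitrary: c d)
    case 0
    then show ?case using bound by simp
  next
    case (Suc k)
    have "continuous_on {c..d} H"
      using H Suc.prems by (auto intro: continuous_on_subset)
    moreover have "H c \<le> (H c + H d) / 2" "(H c + H d) / 2 \<le> H d"
      using mono[OF Suc.prems] by auto
    ultimately obtain m where m: "c \<le> m" "m \<le> d" "H m = (H c + H d) / 2"
      using IVT'[of H c "(H c + H d) / 2" d] Suc.prems by auto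
    have "norm (D d - D c) \<le> norm (D d - D m) + norm (D m - D c)"
      by (metis diff_add_cancel add_diff_eq norm_triangle_ineq)
    also have "\<dots> \<le> (H d - H m)\<^sup>2 / 2 ^ k + (H m - H c)\<^sup>2 / 2 ^ k"
      using Suc m by (intro add_mono Suc.IH) auto
    also have "\<dots> = (H d - H c)\<^sup>2 / 2 ^ Suc k"
      unfolding m(3) by (simp add: field_simps power2_eq_square)
    finally show ?case .
  qed
  have "(\<lambda>k. (H b - H a)\<^sup>2 / 2 ^ k) \<longlonglongrightarrow> 0"
    by (rule LIMSEQ_divide_realpow_zero) simp
  then have "norm (D b - D a) \<le> 0"
    by (rule LIMSEQ_le_const) (use halve assms(1) in blast)
  then show ?thesis by simp
qed

section \<open>Calculus of indefinite integrals and Gronwall's inequality\<close>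

lemma continuous_on_indefinite_integral:
  fixes f g :: "real \<Rightarrow> 'a::euclidean_space"
  assumes "g absolutely_integrable_on {a..b}"
    and "\<And>x. x \<in> {a..b} \<Longrightarrow> f x = f a + integral {a..x} g"
  shows "continuous_on {a..b} f"
proof -
  have "continuous_on {a..b} (\<lambda>x. f a + integral {a..x} g)"
    using assms(1) by (intro continuous_intros indefinite_integral_continuous_1)
      (simp add: absolutely_integrable_on_def)
  then show ?thesis
    by (subst continuous_on_cong[OF refl assms(2)]) auto
qed

lemma absolutely_integrable_mult_continuous:
  fixes f g :: "real \<Rightarrow> 'a::{euclidean_space, real_normed_algebra}"
  assumes f: "f absolutely_integrable_on {a..b}" and g: "continuous_on {a..b} g"
  shows "(\<lambda>x. g x * f x) absolutely_integrable_on {a..b}"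
    and "(\<lambda>x. f x * g x) absolutely_integrable_on {a..b}"
proof -
  have *: "g \<in> borel_measurable (lebesgue_on {a..b})"
    by (rule continuous_imp_measurable_on_sets_lebesgue[OF g]) auto
  have **: "bounded (g ` {a..b})"
    by (intro compact_imp_bounded compact_continuous_image g) auto
  show "(\<lambda>x. g x * f x) absolutely_integrable_on {a..b}"
    by (rule absolutely_integrable_bounded_measurable_product[OF bilinear_times * _ ** f]) auto
  have "bilinear (\<lambda>x y :: 'a. y * x)"
    by (auto simp: bilinear_def linear_iff algebra_simps)
  from absolutely_integrable_bounded_measurable_product[OF this * _ ** f]
  show "(\<lambda>x. f x * g x) absolutely_integrable_on {a..b}" by auto
qed

lemma integral_diff_eq:
  fixes f :: "real \<Rightarrow> 'a::banach"
  assumes "f integrable_on {a..b}" "a \<le> c" "c \<le> d" "d \<le> b"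
  shows "integral {a..d} f - integral {a..c} f = integral {c..d} f"
proof -
  have "f integrable_on {a..d}"
    using assms by (auto intro: integrable_on_subinterval)
  then have "integral {a..c} f + integral {c..d} f = integral {a..d} f"
    by (rule Henstock_Kurzweil_Integration.integral_combine[OF assms(2,3)])
  then show ?thesis by (metis add_diff_cancel_left')
qed

text \<open>Differentiation almost everywhere is avoided. Over [c, d] the difference of
  \<open>f * g\<close> and the integral of the expected derivative changes by the integral of
  \<open>f' t * (g d - g t) - (f t - f c) * g' t\<close>. With \<open>F\<close> and \<open>G\<close>
  the integrals of the norms of \<open>f'\<close> and \<open>g'\<close>, this is at most twice the
  product of the increments of \<open>F\<close> and \<open>G\<close>, hence at most the square of
  the increment of \<open>F + G\<close>, so that \<open>constant_if_dist_le_square\<close>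
  applies.\<close>

lemma integral_product_rule:
  fixes f g f' g' :: "real \<Rightarrow> 'a::{euclidean_space, real_normed_algebra}"
  assumes "a \<le> b"
    and f': "f' absolutely_integrable_on {a..b}"
    and f: "\<And>x. x \<in> {a..b} \<Longrightarrow> f x = f a + integral {a..x} f'"
    and g': "g' absolutely_integrable_on {a..b}"
    and g: "\<And>x. x \<in> {a..b} \<Longrightarrow> g x = g a + integral {a..x} g'"
  shows "(\<lambda>x. f' x * g x + f x * g' x) absolutely_integrable_on {a..b}"
    and "integral {a..b} (\<lambda>x. f' x * g x + f x * g' x) = f b * g b - f a * g a"
proof -
  let ?p = "\<lambda>x. f' x * g x + f x * g' x"
  have cont: "continuous_on {a..b} f" "continuous_on {a..b} g"
    by (rule continuous_on_indefinite_integral[OF f' f], assumption)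
      (rule continuous_on_indefinite_integral[OF g' g], assumption)
  show p: "?p absolutely_integrable_on {a..b}"
    by (intro set_integral_add absolutely_integrable_mult_continuous cont f' g')
  define F where "F x = integral {a..x} (\<lambda>t. norm (f' t))" for x
  define G where "G x = integral {a..x} (\<lambda>t. norm (g' t))" for x
  have nf': "(\<lambda>t. norm (f' t)) integrable_on {a..b}" "f' integrable_on {a..b}"
    and ng': "(\<lambda>t. norm (g' t)) integrable_on {a..b}" "g' integrable_on {a..b}"
    using f' g' by (auto simp: absolutely_integrable_on_def)
  have sub: "h integrable_on {c..d}" if "h integrable_on {a..b}" "a \<le> c" "c \<le> d" "d \<le> b"
    for h :: "real \<Rightarrow> 'b::banach" and c d
    using that by (auto intro: integrable_on_subinterval)
  have FG: "F d - F c = integral {c..d} (\<lambda>t. norm (f' t))"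
    "G d - G c = integral {c..d} (\<lambda>t. norm (g' t))" if "a \<le> c" "c \<le> d" "d \<le> b" for c d
    unfolding F_def G_def using nf' ng' that by (auto intro: integral_diff_eq)
  have fg: "f d - f c = integral {c..d} f'" "g d - g c = integral {c..d} g'"
    if "a \<le> c" "c \<le> d" "d \<le> b" for c d
  proof -
    have "d \<in> {a..b}" "c \<in> {a..b}" using that by auto
    note this[THEN f] this[THEN g]
    then have "f d - f c = integral {a..d} f' - integral {a..c} f'"
      "g d - g c = integral {a..d} g' - integral {a..c} g'"
      by (metis add_diff_cancel_left)+
    then show "f d - f c = integral {c..d} f'" "g d - g c = integral {c..d} g'"
      by (simp_all only: integral_diff_eq[OF nf'(2) that] integral_diff_eq[OF ng'(2) that])
  qed
  have FGpos: "F c \<le> F d" "G c \<le> G d" if "a \<le> c" "c \<le> d" "d \<le> b" for c d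
  proof -
    have "0 \<le> integral {c..d} (\<lambda>t. norm (f' t))" "0 \<le> integral {c..d} (\<lambda>t. norm (g' t))"
      by (auto intro!: Henstock_Kurzweil_Integration.integral_nonneg sub nf' ng' that)
    then show "F c \<le> F d" "G c \<le> G d" using FG[OF that] by auto
  qed
  have fgbd: "norm (f d - f c) \<le> F d - F c" "norm (g d - g c) \<le> G d - G c"
    if "a \<le> c" "c \<le> d" "d \<le> b" for c d
    unfolding fg[OF that] FG[OF that]
    by (auto intro!: Henstock_Kurzweil_Integration.integral_norm_bound_integral sub nf' ng' that)
  define D where "D x = f x * g x - integral {a..x} ?p" for x
  have "D b = D a"
  proof (rule constant_if_dist_le_square[where H = "\<lambda>x. F x + G x"])
    show "continuous_on {a..b} (\<lambda>x. F x + G x)"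
      unfolding F_def G_def by (intro continuous_intros indefinite_integral_continuous_1 nf' ng')
    fix c d assume cd: "a \<le> c" "c \<le> d" "d \<le> b"
    have pi: "?p integrable_on {a..b}" using p by (simp add: absolutely_integrable_on_def)
    have i1: "(\<lambda>t. f' t * g d) integrable_on {c..d}" "(\<lambda>t. f c * g' t) integrable_on {c..d}"
      by (auto intro!: integrable_on_mult_left integrable_on_mult_right sub nf' ng' cd)
    have i2: "(\<lambda>t. norm (f' t) * (G d - G c)) integrable_on {c..d}"
      "(\<lambda>t. (F d - F c) * norm (g' t)) integrable_on {c..d}"
      "(\<lambda>t. norm (f' t) * (G d - G c) + (F d - F c) * norm (g' t)) integrable_on {c..d}"
      using sub[OF nf'(1) cd] sub[OF ng'(1) cd]
      by (auto intro!: Henstock_Kurzweil_Integration.integrable_add integrable_on_mult_left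
          integrable_on_mult_right)
    have "D d - D c = (f d - f c) * g d + f c * (g d - g c) - integral {c..d} ?p"
      unfolding D_def using integral_diff_eq[OF pi cd] by (simp add: algebra_simps)
    also have "(f d - f c) * g d = integral {c..d} (\<lambda>t. f' t * g d)"
      unfolding fg[OF cd] by (rule integral_unique[OF has_integral_mult_left[OF integrable_integral[OF sub[OF nf'(2) cd]]], symmetric])
    also have "f c * (g d - g c) = integral {c..d} (\<lambda>t. f c * g' t)"
      unfolding fg[OF cd] by (rule integral_unique[OF has_integral_mult_right[OF integrable_integral[OF sub[OF ng'(2) cd]]], symmetric])
    also have "integral {c..d} (\<lambda>t. f' t * g d) + integral {c..d} (\<lambda>t. f c * g' t) - integral {c..d} ?p
        = integral {c..d} (\<lambda>t. f' t * g d + f c * g' t - ?p t)"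
      by (simp only: Henstock_Kurzweil_Integration.integral_diff[OF
            Henstock_Kurzweil_Integration.integrable_add[OF i1] sub[OF pi cd]]
          Henstock_Kurzweil_Integration.integral_add[OF i1])
    finally have eq: "D d - D c = integral {c..d} (\<lambda>t. f' t * g d + f c * g' t - ?p t)" .
    have "norm (D d - D c) \<le>
        integral {c..d} (\<lambda>t. norm (f' t) * (G d - G c) + (F d - F c) * norm (g' t))"
      unfolding eq
    proof (rule Henstock_Kurzweil_Integration.integral_norm_bound_integral)
      show "(\<lambda>t. f' t * g d + f c * g' t - ?p t) integrable_on {c..d}"
        by (rule Henstock_Kurzweil_Integration.integrable_diff[OF
              Henstock_Kurzweil_Integration.integrable_add[OF i1] sub[OF pi cd]])
      show "(\<lambda>t. norm (f' t) * (G d - G c) + (F d - F c) * norm (g' t)) integrable_on {c..d}"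
        by (rule i2)
      fix t assume t: "t \<in> {c..d}"
      have "f' t * g d + f c * g' t - ?p t = f' t * (g d - g t) - (f t - f c) * g' t"
        by (simp add: algebra_simps)
      also have "norm \<dots> \<le> norm (f' t) * norm (g d - g t) + norm (f t - f c) * norm (g' t)"
        by (rule order_trans[OF norm_triangle_ineq4]) (intro add_mono norm_mult_ineq)
      also have "\<dots> \<le> norm (f' t) * (G d - G c) + (F d - F c) * norm (g' t)"
      proof (intro add_mono mult_left_mono mult_right_mono)
        show "norm (g d - g t) \<le> G d - G c"
          using fgbd(2)[of t d] FGpos(2)[of c t] t cd by auto
        show "norm (f t - f c) \<le> F d - F c"
          using fgbd(1)[of c t] FGpos(1)[of t d] t cd by auto
      qed auto
      finally show "norm (f' t * g d + f c * g' t - ?p t)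
          \<le> norm (f' t) * (G d - G c) + (F d - F c) * norm (g' t)" .
    qed
    also have "\<dots> = (F d - F c) * (G d - G c) + (F d - F c) * (G d - G c)"
      using Henstock_Kurzweil_Integration.integral_add[OF i2(1,2)] by (simp add: FG[OF cd])
    also have "\<dots> \<le> (F d + G d - (F c + G c))\<^sup>2"
    proof -
      have "x * y + x * y \<le> (x + y)\<^sup>2" for x y :: real
        using zero_le_power2[of x] zero_le_power2[of y] by (simp add: power2_eq_square algebra_simps)
      from this[of "F d - F c" "G d - G c"] show ?thesis by (simp add: algebra_simps)
    qed
    finally show "norm (D d - D c) \<le> (F d + G d - (F c + G c))\<^sup>2" .
    show "F c + G c \<le> F d + G d" using FGpos[OF cd] by simp
  qed (fact assms(1))
  then show "integral {a..b} ?p = f b * g b - f a * g a"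
    by (simp add: D_def algebra_simps)
qed

text \<open>These integrals produce the exponential series in \<open>gronwall\<close> and
  \<open>picard_bounds\<close>. The induction writes W ^ (n + 2) as the product of \<open>W\<close>
  and W ^ (n + 1); integrability and value go together because the product rule needs both for the
  second factor.\<close>

lemma integral_mult_power_indefinite:
  fixes w :: "real \<Rightarrow> real"
  assumes w: "w absolutely_integrable_on {a..b}"
  defines "W \<equiv> \<lambda>x. integral {a..x} w"
  assumes "x \<in> {a..b}"
  shows "(\<lambda>t. w t * W t ^ n) absolutely_integrable_on {a..x}
    \<and> integral {a..x} (\<lambda>t. w t * W t ^ n) = W x ^ Suc n / Suc n"
  using assms(3)
proof (induction n arbitrary: x)
  case 0
  then show ?case using w by (auto simp: W_def intro: absolutely_integrable_on_subinterval)
next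
  case (Suc n)
  have w': "w absolutely_integrable_on {a..x}" and ax: "a \<le> x"
    using w Suc.prems by (auto intro: absolutely_integrable_on_subinterval)
  let ?g = "\<lambda>t. real (Suc n) * (w t * W t ^ n)"
  have g: "?g absolutely_integrable_on {a..x}" using Suc.IH[OF Suc.prems] by auto
  have W': "W t ^ Suc n = W a ^ Suc n + integral {a..t} ?g" if "t \<in> {a..x}" for t
  proof -
    have "t \<in> {a..b}" using that Suc.prems by auto
    from Suc.IH[OF this] show ?thesis by (simp add: W_def del: of_nat_Suc)
  qed
  have eq: "w t * W t ^ Suc n + W t * ?g t = real (Suc (Suc n)) * (w t * W t ^ Suc n)" for t
    by (simp add: algebra_simps)
  have W0: "W a = 0" by (simp add: W_def)
  have "(\<lambda>t. w t * W t ^ Suc n + W t * ?g t) absolutely_integrable_on {a..x}"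
    "integral {a..x} (\<lambda>t. w t * W t ^ Suc n + W t * ?g t) = W x * W x ^ Suc n - W a * W a ^ Suc n"
    using integral_product_rule[OF ax w' _ g W', of W] by (auto simp: W_def)
  note r = this[unfolded eq W0]
  define c where "c = real (Suc (Suc n))"
  have c: "c \<noteq> 0" by (simp add: c_def)
  have "(\<lambda>t. 1 / c * (c * (w t * W t ^ Suc n))) absolutely_integrable_on {a..x}"
    using r(1)[folded c_def] by (rule set_integrable_mult_right)
  moreover have "(\<lambda>t. 1 / c * (c * (w t * W t ^ Suc n))) = (\<lambda>t. w t * W t ^ Suc n)"
    using c by auto
  moreover have "c * integral {a..x} (\<lambda>t. w t * W t ^ Suc n) = W x ^ Suc (Suc n)"
    using r(2)[folded c_def] by simp
  ultimately show ?case
    unfolding c_def[symmetric] using c by (simp add: nonzero_eq_divide_eq mult.commute del: power_Suc)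
qed

text \<open>The inequality is inserted into itself \<open>n\<close> times. This yields a partial sum
  of the exponential series in the integral \<open>W\<close> of \<open>w\<close>, plus a remainder S
  W ^ n / n! with \<open>S\<close> an upper bound of \<open>\<phi>\<close>, and the remainder tends
  to 0. Only integrals of \<open>w * W ^ n\<close> occur, so no derivative of \<open>W\<close> is
  ever taken.\<close>

lemma gronwall:
  fixes w \<phi> :: "real \<Rightarrow> real"
  assumes w: "w absolutely_integrable_on {a..b}" and w0: "\<And>t. t \<in> {a..b} \<Longrightarrow> 0 \<le> w t"
    and \<phi>: "continuous_on {a..b} \<phi>"
    and ineq: "\<And>x. x \<in> {a..b} \<Longrightarrow> \<phi> x \<le> K + integral {a..x} (\<lambda>t. w t * \<phi> t)"
    and x: "x \<in> {a..b}"
  shows "\<phi> x \<le> K * exp (integral {a..x} w)"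
proof -
  define W where "W x = integral {a..x} w" for x
  obtain S where S: "\<And>t. t \<in> {a..b} \<Longrightarrow> \<phi> t \<le> S"
  proof -
    have "bounded (\<phi> ` {a..b})"
      by (intro compact_imp_bounded compact_continuous_image \<phi>) auto
    then obtain S where "\<forall>y\<in>\<phi> ` {a..b}. norm y \<le> S" by (auto simp: bounded_iff)
    then show ?thesis using that[of S] by force
  qed
  note P = integral_mult_power_indefinite[OF w, folded W_def]
  have iter: "\<phi> x \<le> K * (\<Sum>j<n. W x ^ j / fact j) + S * (W x ^ n / fact n)" if "x \<in> {a..b}" for x n
    using that
  proof (induction n arbitrary: x)
    case 0
    then show ?case using S by simp
  next
    case (Suc n)
    let ?r = "\<lambda>t. \<Sum>j<n. K / fact j * (w t * W t ^ j)"
    have sub: "{a..x} \<subseteq> {a..b}" using Suc.prems by auto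
    have ri: "?r integrable_on {a..x}" "(\<lambda>t. S / fact n * (w t * W t ^ n)) integrable_on {a..x}"
      using P[OF Suc.prems] by (auto intro!: integrable_sum integrable_on_mult_right
          simp: absolutely_integrable_on_def)
    have "\<phi> x \<le> K + integral {a..x} (\<lambda>t. w t * \<phi> t)"
      using ineq Suc.prems by auto
    also have "integral {a..x} (\<lambda>t. w t * \<phi> t) \<le> integral {a..x} (\<lambda>t. ?r t + S / fact n * (w t * W t ^ n))"
    proof (rule integral_le)
      have "(\<lambda>t. w t * \<phi> t) absolutely_integrable_on {a..x}"
        using w \<phi> sub by (intro absolutely_integrable_mult_continuous)
          (auto intro: absolutely_integrable_on_subinterval continuous_on_subset)
      then show "(\<lambda>t. w t * \<phi> t) integrable_on {a..x}" by (simp add: absolutely_integrable_on_def)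
      show "(\<lambda>t. ?r t + S / fact n * (w t * W t ^ n)) integrable_on {a..x}"
        using ri by (rule Henstock_Kurzweil_Integration.integrable_add)
      fix t assume "t \<in> {a..x}"
      then have t: "t \<in> {a..b}" using sub by auto
      show "w t * \<phi> t \<le> ?r t + S / fact n * (w t * W t ^ n)"
        using mult_left_mono[OF Suc.IH[OF t] w0[OF t]]
        by (simp add: algebra_simps sum_distrib_left)
    qed
    also have "\<dots> = (\<Sum>j<n. K / fact j * (W x ^ Suc j / Suc j)) + S / fact n * (W x ^ Suc n / Suc n)"
    proof -
      have "integral {a..x} ?r = (\<Sum>j<n. integral {a..x} (\<lambda>t. K / fact j * (w t * W t ^ j)))"
        using P[OF Suc.prems] by (intro Henstock_Kurzweil_Integration.integral_sum)
          (auto intro!: integrable_on_mult_right simp: absolutely_integrable_on_def)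
      also have "\<dots> = (\<Sum>j<n. K / fact j * (W x ^ Suc j / Suc j))"
        by (simp only: integral_mult_right P[OF Suc.prems])
      finally show ?thesis
        by (simp only: Henstock_Kurzweil_Integration.integral_add[OF ri] integral_mult_right P[OF Suc.prems])
    qed
    also have "K + \<dots> = K * (\<Sum>j<Suc n. W x ^ j / fact j) + S * (W x ^ Suc n / fact (Suc n))"
    proof -
      have f: "c / fact j * (W x ^ Suc j / Suc j) = c * (W x ^ Suc j / fact (Suc j))" for c :: real and j
        by (simp add: fact_Suc del: of_nat_Suc)
      show ?thesis
        unfolding f sum.lessThan_Suc_shift[of _ n] by (simp add: sum_distrib_left distrib_left)
    qed
    finally show ?case by simp
  qed
  have "(\<lambda>j. W x ^ j / fact j) sums exp (W x)"
    using exp_converges[of "W x"] by (simp add: field_simps)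
  moreover from this have "(\<lambda>n. W x ^ n / fact n) \<longlonglongrightarrow> 0"
    by (intro summable_LIMSEQ_zero) (rule sums_summable)
  ultimately have "(\<lambda>n. K * (\<Sum>j<n. W x ^ j / fact j) + S * (W x ^ n / fact n))
      \<longlonglongrightarrow> K * exp (W x) + S * 0"
    unfolding sums_def by (intro tendsto_intros)
  then have "\<phi> x \<le> K * exp (W x) + S * 0"
    by (rule LIMSEQ_le_const) (use iter[OF x] in blast)
  then show ?thesis by (simp add: W_def)
qed

section \<open>Local integrability and the rules for \<open>has_ac_derivative_on\<close>\<close>

definition locally_integrable :: "(real \<Rightarrow> 'a::euclidean_space) \<Rightarrow> bool" where
  "locally_integrable g \<longleftrightarrow> (\<forall>a b. g absolutely_integrable_on {a..b})"

lemma unif_loc_L1_imp_locally_integrable: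
  assumes "unif_loc_L1 V"
  shows "locally_integrable V"
proof -
  have meas: "V \<in> borel_measurable lebesgue"
    and fin: "(SUP x. \<integral>\<^sup>+t\<in>{x..x+1}. ennreal \<bar>V t\<bar> \<partial>lebesgue) < \<infinity>"
    using assms by (auto simp: unif_loc_L1_def)
  have unit: "V absolutely_integrable_on {x..x+1}" for x
  proof -
    have "(\<integral>\<^sup>+t\<in>{x..x+1}. ennreal \<bar>V t\<bar> \<partial>lebesgue)
        \<le> (SUP x. \<integral>\<^sup>+t\<in>{x..x+1}. ennreal \<bar>V t\<bar> \<partial>lebesgue)"
      by (rule SUP_upper) simp
    also have "(\<integral>\<^sup>+t\<in>{x..x+1}. ennreal \<bar>V t\<bar> \<partial>lebesgue)
        = (\<integral>\<^sup>+t. ennreal (norm (indicator {x..x+1} t *\<^sub>R V t)) \<partial>lebesgue)"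
      by (intro nn_integral_cong) (auto simp: indicator_def)
    finally have "(\<integral>\<^sup>+t. ennreal (norm (indicator {x..x+1} t *\<^sub>R V t)) \<partial>lebesgue) < \<infinity>"
      using fin by (rule le_less_trans)
    moreover have "(\<lambda>t. indicator {x..x+1} t *\<^sub>R V t) \<in> borel_measurable lebesgue"
      by (intro borel_measurable_scaleR borel_measurable_indicator meas) auto
    ultimately show ?thesis
      unfolding set_integrable_def integrable_iff_bounded by blast
  qed
  have "V absolutely_integrable_on {a..a + real n}" for a n
  proof (induction n)
    case 0
    then show ?case using absolutely_integrable_on_subinterval[OF unit[of a], of a a] by simp
  next
    case (Suc n)
    show ?case
      using absolutely_integrable_on_combine[OF Suc unit[of "a + real n"]] by (simp add: algebra_simps)
  qed
  moreover have "{a..b} \<subseteq> {a..a + real (nat \<lceil>b - a\<rceil>)}" for a b :: real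
    by (auto; linarith)
  ultimately show ?thesis
    unfolding locally_integrable_def by (blast intro: absolutely_integrable_on_subinterval)
qed

lemma locally_integrable_of_real_diff:
  assumes "locally_integrable V"
  shows "locally_integrable (\<lambda>x. complex_of_real (V x) - z)"
proof -
  have "(\<lambda>x. complex_of_real (V x)) absolutely_integrable_on {a..b}" for a b
    using absolutely_integrable_linear[OF assms[unfolded locally_integrable_def, rule_format]
        bounded_linear_of_real] by (simp add: o_def)
  then show ?thesis
    unfolding locally_integrable_def
    by (intro allI set_integral_diff(1)) (auto intro: absolutely_integrable_continuous_real)
qed

lemma has_ac_derivative_on_atLeast:
  assumes "\<And>x. y \<le> x \<Longrightarrow> g absolutely_integrable_on {y..x}"
    and "\<And>x. y \<le> x \<Longrightarrow> f x = f y + integral {y..x} g"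
  shows "has_ac_derivative_on f g {y..}"
  unfolding has_ac_derivative_on_def
proof (intro ballI impI)
  fix a b assume ab: "a \<in> {y..}" "b \<in> {y..}" "a \<le> b"
  then have g: "g absolutely_integrable_on {y..b}" using assms(1) by auto
  then have "integral {y..b} g - integral {y..a} g = integral {a..b} g"
    using ab by (intro integral_diff_eq) (auto simp: absolutely_integrable_on_def)
  moreover have "g absolutely_integrable_on {a..b}"
    using g by (rule absolutely_integrable_on_subinterval) (use ab in auto)
  moreover have "f b - f a = integral {y..b} g - integral {y..a} g"
    using assms(2)[of b] assms(2)[of a] ab by (metis add_diff_cancel_left atLeast_iff)
  ultimately show "g absolutely_integrable_on {a..b} \<and> f b - f a = integral {a..b} g" by simp
qed

lemma has_ac_derivative_onD:
  assumes "has_ac_derivative_on f g I" "{a..b} \<subseteq> I" "x \<in> {a..b}"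
  shows "g absolutely_integrable_on {a..x}" "f x = f a + integral {a..x} g"
proof -
  have "a \<in> I" "x \<in> I" "a \<le> x" using assms by auto
  then show "g absolutely_integrable_on {a..x}" "f x = f a + integral {a..x} g"
    using assms(1) unfolding has_ac_derivative_on_def by (blast, metis add_diff_cancel_left' diff_add_cancel add.commute)
qed

lemma has_ac_derivative_on_subset:
  "has_ac_derivative_on f g I \<Longrightarrow> J \<subseteq> I \<Longrightarrow> has_ac_derivative_on f g J"
  unfolding has_ac_derivative_on_def by blast

lemma has_ac_derivative_on_continuous:
  assumes "has_ac_derivative_on f g I" "{a..b} \<subseteq> I"
  shows "continuous_on {a..b} f"
proof (cases "a \<le> b")
  case True
  show ?thesis
    using True by (intro continuous_on_indefinite_integral[OF has_ac_derivative_onD(1)[OF assms]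
          has_ac_derivative_onD(2)[OF assms]]) auto
qed auto

lemma has_ac_derivative_on_linear:
  assumes "has_ac_derivative_on f f' I" "has_ac_derivative_on g g' I"
  shows "has_ac_derivative_on (\<lambda>x. r * f x + s * g x) (\<lambda>x. r * f' x + s * g' x) I"
  unfolding has_ac_derivative_on_def
proof (intro ballI impI conjI)
  fix a b assume ab: "a \<in> I" "b \<in> I" "a \<le> b"
  have f: "f' absolutely_integrable_on {a..b}" "f b - f a = integral {a..b} f'"
    and g: "g' absolutely_integrable_on {a..b}" "g b - g a = integral {a..b} g'"
    using assms ab unfolding has_ac_derivative_on_def by auto
  show "(\<lambda>x. r * f' x + s * g' x) absolutely_integrable_on {a..b}"
    by (intro set_integral_add set_integrable_mult_right f g)
  have "integral {a..b} (\<lambda>x. r * f' x + s * g' x) = r * (f b - f a) + s * (g b - g a)"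
    using f g by (subst Henstock_Kurzweil_Integration.integral_add)
      (auto intro: integrable_on_mult_right simp: absolutely_integrable_on_def)
  then show "r * f b + s * g b - (r * f a + s * g a) = integral {a..b} (\<lambda>x. r * f' x + s * g' x)"
    by (simp add: algebra_simps)
qed

lemma has_ac_derivative_on_mult:
  assumes "has_ac_derivative_on f f' I" "has_ac_derivative_on g g' I" "is_interval I"
  shows "has_ac_derivative_on (\<lambda>x. f x * g x) (\<lambda>x. f' x * g x + f x * g' x) I"
  unfolding has_ac_derivative_on_def
proof (intro ballI impI)
  fix a b assume ab: "a \<in> I" "b \<in> I" "a \<le> b"
  then have sub: "{a..b} \<subseteq> I" using assms(3) by (meson atLeastAtMost_iff is_interval_1 subsetI)
  have b: "b \<in> {a..b}" using ab(3) by simp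
  show "(\<lambda>x. f' x * g x + f x * g' x) absolutely_integrable_on {a..b} \<and>
      f b * g b - f a * g a = integral {a..b} (\<lambda>x. f' x * g x + f x * g' x)"
    using integral_product_rule[where f = f and g = g, OF ab(3) has_ac_derivative_onD(1)[OF assms(1) sub b]
        has_ac_derivative_onD(2)[OF assms(1) sub] has_ac_derivative_onD(1)[OF assms(2) sub b]
        has_ac_derivative_onD(2)[OF assms(2) sub]] by simp
qed

lemma has_ac_derivative_on_cong:
  assumes "has_ac_derivative_on f g I" "is_interval I"
    and "\<And>x. x \<in> I \<Longrightarrow> f x = f1 x" "\<And>x. x \<in> I \<Longrightarrow> g x = g1 x"
  shows "has_ac_derivative_on f1 g1 I"
  unfolding has_ac_derivative_on_def
proof (intro ballI impI)
  fix a b assume ab: "a \<in> I" "b \<in> I" "a \<le> b"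
  then have "{a..b} \<subseteq> I" using assms(2) by (meson atLeastAtMost_iff is_interval_1 subsetI)
  then have eq: "\<And>x. x \<in> {a..b} \<Longrightarrow> g x = g1 x" using assms(4) by blast
  have "integral {a..b} g = integral {a..b} g1"
    by (rule Henstock_Kurzweil_Integration.integral_cong) (rule eq)
  moreover have "g1 absolutely_integrable_on {a..b} \<longleftrightarrow> g absolutely_integrable_on {a..b}"
    by (rule set_integrable_cong) (use eq in auto)
  ultimately show "g1 absolutely_integrable_on {a..b} \<and> f1 b - f1 a = integral {a..b} g1"
    using assms(1,3) ab unfolding has_ac_derivative_on_def by auto
qed

lemma has_ac_derivative_on_reflect:
  assumes "has_ac_derivative_on f g I"
  shows "has_ac_derivative_on (\<lambda>x. f (- x)) (\<lambda>x. - g (- x)) (uminus ` I)"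
  unfolding has_ac_derivative_on_def
proof (intro ballI impI conjI)
  fix a b assume ab: "a \<in> uminus ` I" "b \<in> uminus ` I" "a \<le> b"
  then have "- b \<in> I" "- a \<in> I" "- b \<le> - a" by auto
  then have g: "g absolutely_integrable_on {-b..-a}" "f (-a) - f (-b) = integral {-b..-a} g"
    using assms unfolding has_ac_derivative_on_def by auto
  have "(\<lambda>x. g (- x)) absolutely_integrable_on {a..b}"
    using g(1) absolutely_integrable_reflect_real[where f = g and a = "-b" and b = "-a"] by simp
  then have "(\<lambda>x. - 1 * g (- x)) absolutely_integrable_on {a..b}"
    by (rule set_integrable_mult_right)
  then show "(\<lambda>x. - g (- x)) absolutely_integrable_on {a..b}" by simp
  have "integral {a..b} (\<lambda>x. - g (- x)) = - integral {-b..-a} g"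
    using Henstock_Kurzweil_Integration.integral_reflect_real[where f = g and a = "-b" and b = "-a"] by simp
  then show "f (- b) - f (- a) = integral {a..b} (\<lambda>x. - g (- x))"
    using g(2) by (metis minus_diff_eq)
qed

lemma has_ac_derivative_on_union:
  assumes l: "has_ac_derivative_on f g {..y}" and r: "has_ac_derivative_on f g {y..}"
  shows "has_ac_derivative_on f g UNIV"
  unfolding has_ac_derivative_on_def
proof (intro ballI impI)
  fix a b :: real assume ab: "a \<le> b"
  consider "b \<le> y" | "y \<le> a" | "a \<le> y" "y \<le> b" by linarith
  then show "g absolutely_integrable_on {a..b} \<and> f b - f a = integral {a..b} g"
  proof cases
    case 1 then show ?thesis using l ab unfolding has_ac_derivative_on_def by auto
  next
    case 2 then show ?thesis using r ab unfolding has_ac_derivative_on_def by auto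
  next
    case 3
    have 1: "g absolutely_integrable_on {a..y}" "f y - f a = integral {a..y} g"
      using l 3 unfolding has_ac_derivative_on_def by auto
    have 2: "g absolutely_integrable_on {y..b}" "f b - f y = integral {y..b} g"
      using r 3 unfolding has_ac_derivative_on_def by auto
    have g: "g absolutely_integrable_on {a..b}"
      by (rule absolutely_integrable_on_combine[OF 1(1) 2(1) 3])
    have "integral {a..y} g + integral {y..b} g = integral {a..b} g"
      using g 3 by (intro Henstock_Kurzweil_Integration.integral_combine)
        (auto simp: absolutely_integrable_on_def)
    then show ?thesis using g 1(2) 2(2) by (metis add_diff_eq diff_add_cancel add.commute)
  qed
qed

section \<open>Solutions of the differential equation\<close>

text \<open>The pair with index \<open>n\<close> is the n-th term of the Neumann series of the
  system u' = v, v' = q u, not the n-th Picard iterate; the solution is the sum over all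
  \<open>n\<close>.\<close>

fun picard :: "(real \<Rightarrow> complex) \<Rightarrow> real \<Rightarrow> complex \<Rightarrow> complex \<Rightarrow> nat \<Rightarrow>
    (real \<Rightarrow> complex) \<times> (real \<Rightarrow> complex)" where
  "picard q y a b 0 = (\<lambda>_. a, \<lambda>_. b)"
| "picard q y a b (Suc n) = (\<lambda>x. integral {y..x} (snd (picard q y a b n)),
     \<lambda>x. integral {y..x} (\<lambda>t. q t * fst (picard q y a b n) t))"

text \<open>The weight \<open>1 + norm (q t)\<close> dominates both coefficients 1 and
  \<open>q\<close> of the first-order system, so a single function \<open>W\<close> controls both
  components, and each integration raises its power by one. Continuity is carried along to make the
  next integrand integrable.\<close>

lemma picard_bounds:
  fixes q :: "real \<Rightarrow> complex" and y :: real and a b :: complex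
  assumes q: "locally_integrable q"
  defines "W \<equiv> \<lambda>x. integral {y..x} (\<lambda>t. 1 + norm (q t))"
  defines "K \<equiv> norm a + norm b"
  shows "continuous_on {y..X} (fst (picard q y a b n)) \<and> continuous_on {y..X} (snd (picard q y a b n))
    \<and> (\<forall>x\<in>{y..X}. norm (fst (picard q y a b n) x) \<le> K * (W x ^ n / fact n)
        \<and> norm (snd (picard q y a b n) x) \<le> K * (W x ^ n / fact n))"
proof (induction n)
  case 0
  show ?case by (simp add: K_def)
next
  case (Suc n)
  let ?f = "fst (picard q y a b n)" and ?g = "snd (picard q y a b n)"
  have qi: "q absolutely_integrable_on {y..X}" for X using q by (simp add: locally_integrable_def)
  then have wi: "(\<lambda>t. 1 + norm (q t)) absolutely_integrable_on {y..X}" for X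
    by (intro set_integral_add(1) absolutely_integrable_norm[unfolded o_def])
      (auto intro: absolutely_integrable_continuous_real)
  have gi: "?g absolutely_integrable_on {y..X}" and fi: "(\<lambda>t. q t * ?f t) absolutely_integrable_on {y..X}"
    using Suc qi by (auto intro: absolutely_integrable_continuous_real
        absolutely_integrable_mult_continuous)
  have step: "norm (integral {y..x} h) \<le> K * (W x ^ Suc n / fact (Suc n))"
    if x: "x \<in> {y..X}" and h: "h absolutely_integrable_on {y..X}"
      and le: "\<And>t. t \<in> {y..X} \<Longrightarrow> norm (h t) \<le> (1 + norm (q t)) * (K * (W t ^ n / fact n))"
    for x and h :: "real \<Rightarrow> complex"
  proof -
    have Wx: "W x = integral {y..x} (\<lambda>t. 1 + norm (q t))" for x by (simp add: W_def)
    note P = integral_mult_power_indefinite[OF wi x, folded Wx]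
    have "norm (integral {y..x} h)
        \<le> integral {y..x} (\<lambda>t. K / fact n * ((1 + norm (q t)) * W t ^ n))"
    proof (rule Henstock_Kurzweil_Integration.integral_norm_bound_integral)
      have "h absolutely_integrable_on {y..x}"
        by (rule absolutely_integrable_on_subinterval[OF h]) (use x in auto)
      then show "h integrable_on {y..x}" by (simp add: absolutely_integrable_on_def)
      show "(\<lambda>t. K / fact n * ((1 + norm (q t)) * W t ^ n)) integrable_on {y..x}"
        using P by (intro integrable_on_mult_right) (auto simp: absolutely_integrable_on_def)
      show "norm (h t) \<le> K / fact n * ((1 + norm (q t)) * W t ^ n)" if "t \<in> {y..x}" for t
        using le[of t] that x by (simp add: mult_ac)
    qed
    also have "\<dots> = K / fact n * (W x ^ Suc n / Suc n)"
      by (simp only: integral_mult_right P)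
    also have "\<dots> = K * (W x ^ Suc n / fact (Suc n))"
      by (simp add: fact_Suc del: of_nat_Suc)
    finally show ?thesis .
  qed
  have "norm (?g t) \<le> (1 + norm (q t)) * (K * (W t ^ n / fact n))"
    "norm (q t * ?f t) \<le> (1 + norm (q t)) * (K * (W t ^ n / fact n))" if "t \<in> {y..X}" for t
  proof -
    have le: "norm (?f t) \<le> K * (W t ^ n / fact n)" "norm (?g t) \<le> K * (W t ^ n / fact n)"
      using Suc that by auto
    then have 0: "0 \<le> K * (W t ^ n / fact n)" using norm_ge_zero order_trans by blast
    show "norm (?g t) \<le> (1 + norm (q t)) * (K * (W t ^ n / fact n))"
      using le(2) mult_right_mono[OF _ 0, of 1 "1 + norm (q t)"] by simp
    show "norm (q t * ?f t) \<le> (1 + norm (q t)) * (K * (W t ^ n / fact n))"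
      using mult_mono[of "norm (q t)" "1 + norm (q t)", OF _ le(1)] by (simp add: norm_mult)
  qed
  moreover have "continuous_on {y..X} (\<lambda>x. integral {y..x} ?g)"
    "continuous_on {y..X} (\<lambda>x. integral {y..x} (\<lambda>t. q t * ?f t))"
    using gi fi by (auto intro!: indefinite_integral_continuous_1 simp: absolutely_integrable_on_def)
  ultimately show ?case using step[OF _ gi] step[OF _ fi] by simp
qed

text \<open>The terms of \<open>picard\<close> are summed, and dominated convergence, with the
  partial sums bounded by \<open>K * exp (W x)\<close>, moves the sum under the integrals. Only the
  half-line to the right of \<open>y\<close> is treated, because integrals over
  \<open>{y..x}\<close> vanish for \<open>x < y\<close>; the other half is obtained by
  reflection.\<close>

lemma second_order_ode_forward:
  fixes q :: "real \<Rightarrow> complex"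
  assumes q: "locally_integrable q"
  shows "\<exists>u v. has_ac_derivative_on u v {y..} \<and> has_ac_derivative_on v (\<lambda>x. q x * u x) {y..}
    \<and> u y = a \<and> v y = b"
proof -
  define W where "W x = integral {y..x} (\<lambda>t. 1 + norm (q t))" for x
  define K where "K = norm a + norm b"
  define P Q where "P n = fst (picard q y a b n)" and "Q n = snd (picard q y a b n)" for n
  note B = picard_bounds[OF q, of y _ a b, folded W_def K_def P_def Q_def]
  have qi: "q absolutely_integrable_on {y..X}" for X using q by (simp add: locally_integrable_def)
  have wi: "(\<lambda>t. 1 + norm (q t)) absolutely_integrable_on {y..X}" for X
    using qi by (intro set_integral_add(1) absolutely_integrable_norm[unfolded o_def])
      (auto intro: absolutely_integrable_continuous_real)
  have Wmono: "W s \<le> W t" if "y \<le> s" "s \<le> t" for s t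
    unfolding W_def using wi that
    by (intro integral_subset_le) (auto simp: absolutely_integrable_on_def)
  have Ws: "(\<lambda>n. K * (W x ^ n / fact n)) sums (K * exp (W x))" for x
    using exp_converges[of "W x"] by (intro sums_mult) (simp add: field_simps)
  have bd: "norm (P n x) \<le> K * (W x ^ n / fact n)" "norm (Q n x) \<le> K * (W x ^ n / fact n)"
    if "y \<le> x" for n x
    using B[of x n] that by auto
  have sm: "summable (\<lambda>n. P n x)" "summable (\<lambda>n. Q n x)" if "y \<le> x" for x
    using summable_comparison_test'[OF sums_summable[OF Ws], of 0 "\<lambda>n. P n x" x]
      summable_comparison_test'[OF sums_summable[OF Ws], of 0 "\<lambda>n. Q n x" x] bd[OF that] by auto
  define u v where "u x = (\<Sum>n. P n x)" and "v x = (\<Sum>n. Q n x)" for x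
  have part: "norm (\<Sum>k<n. P k t) \<le> K * exp (W x)" "norm (\<Sum>k<n. Q k t) \<le> K * exp (W x)"
    if "y \<le> t" "t \<le> x" for n t x
  proof -
    have K: "0 \<le> K" by (simp add: K_def)
    have W0: "0 \<le> W t" using Wmono[of y t] that by (simp add: W_def)
    have "(\<Sum>k<n. K * (W t ^ k / fact k)) \<le> K * exp (W t)"
      unfolding sums_unique[OF Ws] by (rule sum_le_suminf[OF sums_summable[OF Ws]]) (use K W0 in auto)
    also have "\<dots> \<le> K * exp (W x)"
      using Wmono[OF that] K by (intro mult_left_mono) auto
    finally show "norm (\<Sum>k<n. P k t) \<le> K * exp (W x)" "norm (\<Sum>k<n. Q k t) \<le> K * exp (W x)"
      using sum_norm_le[of "{..<n}" "\<lambda>k. P k t", OF bd(1)] sum_norm_le[of "{..<n}" "\<lambda>k. Q k t", OF bd(2)] that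
      by (meson order_trans)+
  qed
  \<comment> \<open>One statement serves both equations: the multiplier \<open>m\<close> is 1 for u'
    = v and \<open>q\<close> for v' = q u.\<close>
  have main: "(\<lambda>t. m t * (\<Sum>k. R k t)) absolutely_integrable_on {y..x} \<and>
      (\<lambda>n. integral {y..x} (\<lambda>t. m t * R n t)) sums integral {y..x} (\<lambda>t. m t * (\<Sum>k. R k t))"
    if x: "y \<le> x" and m: "m absolutely_integrable_on {y..x}"
      and R: "\<And>n. continuous_on {y..x} (R n)" "\<And>t. y \<le> t \<Longrightarrow> summable (\<lambda>n. R n t)"
        "\<And>n t. y \<le> t \<Longrightarrow> t \<le> x \<Longrightarrow> norm (\<Sum>k<n. R k t) \<le> K * exp (W x)"
    for x and m :: "real \<Rightarrow> complex" and R :: "nat \<Rightarrow> real \<Rightarrow> complex"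
  proof -
    have ci: "(\<lambda>t. m t * R n t) integrable_on {y..x}" for n
      using absolutely_integrable_mult_continuous(2)[OF m R(1)] by (simp add: absolutely_integrable_on_def)
    have si: "(\<lambda>t. m t * (\<Sum>k<n. R k t)) integrable_on {y..x}" for n
      using absolutely_integrable_mult_continuous(2)[OF m continuous_on_sum[of "{..<n}", OF R(1)]]
      by (simp add: absolutely_integrable_on_def)
    have hi: "(\<lambda>t. norm (m t) * (K * exp (W x))) integrable_on {y..x}"
      using m by (intro integrable_on_mult_left) (simp add: absolutely_integrable_on_def)
    have le: "norm (m t * (\<Sum>k<n. R k t)) \<le> norm (m t) * (K * exp (W x))" if "t \<in> {y..x}" for n t
      using R(3)[of t n] that by (auto simp: norm_mult intro: mult_left_mono)
    have lim: "(\<lambda>n. m t * (\<Sum>k<n. R k t)) \<longlonglongrightarrow> m t * (\<Sum>k. R k t)" if "t \<in> {y..x}" for t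
      using R(2)[of t] that by (intro tendsto_intros summable_LIMSEQ) auto
    note D = dominated_convergence[OF si hi le lim]
    have le': "norm (m t * (\<Sum>k. R k t)) \<le> norm (m t) * (K * exp (W x))" if "t \<in> {y..x}" for t
      by (rule LIMSEQ_le_const2[OF tendsto_norm[OF lim[OF that]]]) (use le that in blast)
    have eq: "integral {y..x} (\<lambda>t. m t * (\<Sum>k<n. R k t)) = (\<Sum>k<n. integral {y..x} (\<lambda>t. m t * R k t))" for n
      unfolding sum_distrib_left by (rule Henstock_Kurzweil_Integration.integral_sum) (use ci in auto)
    show ?thesis
      using D(2) absolutely_integrable_integrable_bound[OF le' D(1) hi] by (simp add: eq sums_def)
  qed
  have cont: "continuous_on {y..x} (P n)" "continuous_on {y..x} (Q n)" for x n using B by auto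
  have one: "(\<lambda>_. 1 :: complex) absolutely_integrable_on {y..x}" for x
    by (rule absolutely_integrable_continuous_real) auto
  have shift: "R 0 x + s = (\<Sum>n. R n x)" if "(\<lambda>n. R (Suc n) x) sums s" for R :: "nat \<Rightarrow> real \<Rightarrow> complex" and x s
    using sums_Suc[OF that] by (simp add: sums_unique add.commute)
  have u: "v absolutely_integrable_on {y..x} \<and> u x = a + integral {y..x} v" if "y \<le> x" for x
  proof -
    note M = main[OF that one cont(2) sm(2) part(2), simplified]
    have "(\<lambda>n. P (Suc n) x) sums integral {y..x} v"
      using M by (simp add: P_def Q_def v_def[abs_def])
    from shift[of P, OF this] M show ?thesis by (simp add: P_def u_def v_def[abs_def])
  qed
  have v: "(\<lambda>t. q t * u t) absolutely_integrable_on {y..x} \<and> v x = b + integral {y..x} (\<lambda>t. q t * u t)"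
    if "y \<le> x" for x
  proof -
    note M = main[OF that qi cont(1) sm(1) part(1), simplified]
    have "(\<lambda>n. Q (Suc n) x) sums integral {y..x} (\<lambda>t. q t * u t)"
      using M by (simp add: P_def Q_def u_def[abs_def])
    from shift[of Q, OF this] M show ?thesis by (simp add: Q_def v_def u_def[abs_def])
  qed
  have uy: "u y = a" "v y = b" using u[of y] v[of y] by auto
  have "has_ac_derivative_on u v {y..}"
    by (rule has_ac_derivative_on_atLeast) (use u uy in auto)
  moreover have "has_ac_derivative_on v (\<lambda>x. q x * u x) {y..}"
    by (rule has_ac_derivative_on_atLeast) (use v uy in auto)
  ultimately show ?thesis using uy by blast
qed

section \<open>The inhomogeneous equation: symmetries, existence, a priori bound\<close>

lemma has_ac_derivative_on_uminus:
  "has_ac_derivative_on f g I \<Longrightarrow> has_ac_derivative_on (\<lambda>x. - f x) (\<lambda>x. - g x) I"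
  using has_ac_derivative_on_linear[of f g I f g "-1" 0] by simp

lemma schroedinger_eq_linear:
  assumes "schroedinger_eq V z h I u u'" "schroedinger_eq V z k I v v'"
  shows "schroedinger_eq V z (\<lambda>x. r * h x + s * k x) I (\<lambda>x. r * u x + s * v x) (\<lambda>x. r * u' x + s * v' x)"
proof -
  have eq: "(\<lambda>x. r * ((complex_of_real (V x) - z) * u x - h x) + s * ((complex_of_real (V x) - z) * v x - k x))
      = (\<lambda>x. (complex_of_real (V x) - z) * (r * u x + s * v x) - (r * h x + s * k x))"
    by (simp add: fun_eq_iff algebra_simps)
  show ?thesis
    using assms has_ac_derivative_on_linear[of u u' I v v' r s]
      has_ac_derivative_on_linear[of u' "\<lambda>x. (complex_of_real (V x) - z) * u x - h x" I
        v' "\<lambda>x. (complex_of_real (V x) - z) * v x - k x" r s]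
    unfolding schroedinger_eq_def eq by blast
qed

text \<open>A shift of the energy becomes a source term; thus the difference of solutions at two
  energies falls under \<open>schroedinger_eq_bound\<close>.\<close>

lemma schroedinger_eq_change_energy:
  assumes "schroedinger_eq V z (\<lambda>_. 0) I u u'"
  shows "schroedinger_eq V w (\<lambda>x. (z - w) * u x) I u u'"
  using assms unfolding schroedinger_eq_def by (simp add: algebra_simps)

lemma schroedinger_eq_reflect:
  assumes "schroedinger_eq V z h I u u'"
  shows "schroedinger_eq (\<lambda>x. V (- x)) z (\<lambda>x. h (- x)) (uminus ` I) (\<lambda>x. u (- x)) (\<lambda>x. - u' (- x))"
  using assms has_ac_derivative_on_reflect[of u u' I]
    has_ac_derivative_on_uminus[OF has_ac_derivative_on_reflect[of u' "\<lambda>x. (complex_of_real (V x) - z) * u x - h x" I]]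
  unfolding schroedinger_eq_def by (simp add: algebra_simps)

lemma schroedinger_eq_continuous:
  assumes "schroedinger_eq V z h I u u'" "{a..b} \<subseteq> I"
  shows "continuous_on {a..b} u" "continuous_on {a..b} u'"
  using assms unfolding schroedinger_eq_def by (auto intro: has_ac_derivative_on_continuous)

lemma locally_integrable_reflect:
  "locally_integrable V \<Longrightarrow> locally_integrable (\<lambda>x. V (- x))"
  unfolding locally_integrable_def
  using absolutely_integrable_reflect_real[where f = V and a = "- b" and b = "- a" for a b] by auto

lemma solution_exists:
  assumes V: "locally_integrable V"
  obtains u u' where "solution V z u u'" "u y = a" "u' y = b"
proof -
  obtain u1 v1 where r: "has_ac_derivative_on u1 v1 {y..}"
      "has_ac_derivative_on v1 (\<lambda>x. (complex_of_real (V x) - z) * u1 x) {y..}" "u1 y = a" "v1 y = b"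
    using second_order_ode_forward[OF locally_integrable_of_real_diff[OF V]] by blast
  \<comment> \<open>Reflection reverses the sign of the derivative, hence the initial value
    \<open>- b\<close>.\<close>
  obtain u2 v2 where l: "has_ac_derivative_on u2 v2 {-y..}"
      "has_ac_derivative_on v2 (\<lambda>x. (complex_of_real (V (- x)) - z) * u2 x) {-y..}" "u2 (-y) = a" "v2 (-y) = - b"
    using second_order_ode_forward[OF locally_integrable_of_real_diff[OF locally_integrable_reflect[OF V]]] by blast
  have "schroedinger_eq (\<lambda>x. V (- x)) z (\<lambda>_. 0) {-y..} u2 v2"
    using l by (simp add: schroedinger_eq_def)
  from schroedinger_eq_reflect[OF this]
  have l': "schroedinger_eq V z (\<lambda>_. 0) {..y} (\<lambda>x. u2 (- x)) (\<lambda>x. - v2 (- x))"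
    by simp
  define u where "u x = (if x \<le> y then u2 (- x) else u1 x)" for x
  define u' where "u' x = (if x \<le> y then - v2 (- x) else v1 x)" for x
  have ul: "u2 (- x) = u x" "- v2 (- x) = u' x" if "x \<in> {..y}" for x
    using that by (auto simp: u_def u'_def)
  have ur: "u1 x = u x" "v1 x = u' x" if "x \<in> {y..}" for x
    using that l(3,4) r(3,4) by (auto simp: u_def u'_def)
  have "has_ac_derivative_on u u' UNIV"
    using l' r(1) unfolding schroedinger_eq_def
    by (intro has_ac_derivative_on_union[of u u' y])
      (auto intro: has_ac_derivative_on_cong simp: ul ur is_interval_1)
  moreover have "has_ac_derivative_on u' (\<lambda>x. (complex_of_real (V x) - z) * u x - 0) UNIV"
  proof (rule has_ac_derivative_on_union[of _ _ y])
    show "has_ac_derivative_on u' (\<lambda>x. (complex_of_real (V x) - z) * u x - 0) {..y}"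
      by (rule has_ac_derivative_on_cong[of "\<lambda>x. - v2 (- x)" "\<lambda>x. (complex_of_real (V x) - z) * u2 (- x) - 0"])
        (use l' in \<open>auto simp: schroedinger_eq_def ul is_interval_1\<close>)
    show "has_ac_derivative_on u' (\<lambda>x. (complex_of_real (V x) - z) * u x - 0) {y..}"
      by (rule has_ac_derivative_on_cong[OF r(2)]) (auto simp: ur is_interval_1)
  qed
  ultimately have "solution V z u u'" by (simp add: schroedinger_eq_def)
  moreover have "u y = a" "u' y = b" using l by (auto simp: u_def u'_def)
  ultimately show ?thesis by (rule that)
qed

text \<open>Gronwall's inequality for \<open>norm (u x) + norm (u' x)\<close>: the weight
  \<open>1 + \<bar>V t\<bar> + B\<close> dominates both coefficients 1 and V - z of the first-order
  system. The energy enters only through \<open>B\<close>, which makes the bound locally uniform in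
  \<open>z\<close>. Zero data and zero source give uniqueness.\<close>

lemma schroedinger_eq_bound:
  assumes V: "locally_integrable V" and eq: "schroedinger_eq V z h I u u'" and sub: "{a..b} \<subseteq> I"
    and h: "h absolutely_integrable_on {a..b}" and z: "norm z \<le> B" and x: "x \<in> {a..b}"
  shows "norm (u x) + norm (u' x)
    \<le> (norm (u a) + norm (u' a) + integral {a..b} (\<lambda>t. norm (h t)))
      * exp (integral {a..b} (\<lambda>t. 1 + \<bar>V t\<bar> + B))"
proof -
  define w where "w t = 1 + \<bar>V t\<bar> + B" for t
  define q where "q t = complex_of_real (V t) - z" for t
  define \<phi> where "\<phi> t = norm (u t) + norm (u' t)" for t
  have B: "0 \<le> B" using z norm_ge_zero order_trans by blast
  have qw: "1 \<le> w t" "norm (q t) \<le> w t" for t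
    using z B norm_triangle_ineq4[of "complex_of_real (V t)" z] by (auto simp: w_def q_def)
  have Vab: "V absolutely_integrable_on {a..b}" using V by (simp add: locally_integrable_def)
  have w: "w absolutely_integrable_on {a..b}"
    unfolding w_def using absolutely_integrable_norm[OF Vab]
    by (intro set_integral_add(1)) (auto intro: absolutely_integrable_continuous_real simp: o_def)
  have cu: "continuous_on {a..b} u" "continuous_on {a..b} u'"
    using schroedinger_eq_continuous[OF eq sub] .
  have \<phi>: "continuous_on {a..b} \<phi>" unfolding \<phi>_def by (intro continuous_intros cu)
  have qab: "q absolutely_integrable_on {a..b}"
    unfolding q_def using locally_integrable_of_real_diff[OF V] by (simp add: locally_integrable_def)
  have qu: "(\<lambda>t. q t * u t) absolutely_integrable_on {a..b}"
    by (rule absolutely_integrable_mult_continuous[OF qab cu(1)])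
  have ac: "has_ac_derivative_on u u' I" "has_ac_derivative_on u' (\<lambda>x. q x * u x - h x) I"
    using eq by (auto simp: schroedinger_eq_def q_def)
  have ineq: "\<phi> s \<le> (\<phi> a + integral {a..b} (\<lambda>t. norm (h t))) + integral {a..s} (\<lambda>t. w t * \<phi> t)"
    if s: "s \<in> {a..b}" for s
  proof -
    have ss: "{a..s} \<subseteq> {a..b}" using s by auto
    have i: "u' integrable_on {a..s}" "(\<lambda>t. norm (u' t)) integrable_on {a..s}"
      "(\<lambda>t. norm (q t * u t)) integrable_on {a..s}" "(\<lambda>t. norm (h t)) integrable_on {a..s}"
      "(\<lambda>t. q t * u t - h t) integrable_on {a..s}" "(\<lambda>t. w t * \<phi> t) integrable_on {a..s}"
      using has_ac_derivative_onD(1)[OF ac(1) sub s] has_ac_derivative_onD(1)[OF ac(2) sub s]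
        absolutely_integrable_on_subinterval[OF qu ss] absolutely_integrable_on_subinterval[OF h ss]
        absolutely_integrable_on_subinterval[OF absolutely_integrable_mult_continuous(2)[OF w \<phi>] ss]
      by (auto simp: absolutely_integrable_on_def)
    have "norm (u s) \<le> norm (u a) + norm (integral {a..s} u')"
      unfolding has_ac_derivative_onD(2)[OF ac(1) sub s] by (rule norm_triangle_ineq)
    also have "norm (integral {a..s} u') \<le> integral {a..s} (\<lambda>t. norm (u' t))"
      by (rule Henstock_Kurzweil_Integration.integral_norm_bound_integral[OF i(1,2)]) simp
    finally have 1: "norm (u s) \<le> norm (u a) + integral {a..s} (\<lambda>t. norm (u' t))" by simp
    have "norm (u' s) \<le> norm (u' a) + norm (integral {a..s} (\<lambda>t. q t * u t - h t))"
      unfolding has_ac_derivative_onD(2)[OF ac(2) sub s] by (rule norm_triangle_ineq)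
    also have "norm (integral {a..s} (\<lambda>t. q t * u t - h t))
        \<le> integral {a..s} (\<lambda>t. norm (q t * u t) + norm (h t))"
      by (intro Henstock_Kurzweil_Integration.integral_norm_bound_integral i
          Henstock_Kurzweil_Integration.integrable_add norm_triangle_ineq4)
    also have "\<dots> = integral {a..s} (\<lambda>t. norm (q t * u t)) + integral {a..s} (\<lambda>t. norm (h t))"
      by (rule Henstock_Kurzweil_Integration.integral_add[OF i(3,4)])
    also have "integral {a..s} (\<lambda>t. norm (h t)) \<le> integral {a..b} (\<lambda>t. norm (h t))"
      using h i(4) ss by (intro integral_subset_le) (auto simp: absolutely_integrable_on_def)
    finally have 2: "norm (u' s) \<le> norm (u' a) + (integral {a..s} (\<lambda>t. norm (q t * u t))
        + integral {a..b} (\<lambda>t. norm (h t)))" by simp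
    have "integral {a..s} (\<lambda>t. norm (u' t)) + integral {a..s} (\<lambda>t. norm (q t * u t))
        = integral {a..s} (\<lambda>t. norm (u' t) + norm (q t * u t))"
      by (rule Henstock_Kurzweil_Integration.integral_add[OF i(2,3), symmetric])
    also have "\<dots> \<le> integral {a..s} (\<lambda>t. w t * \<phi> t)"
    proof (rule integral_le)
      show "(\<lambda>t. norm (u' t) + norm (q t * u t)) integrable_on {a..s}"
        by (rule Henstock_Kurzweil_Integration.integrable_add[OF i(2,3)])
      show "norm (u' t) + norm (q t * u t) \<le> w t * \<phi> t" for t
        using mult_right_mono[OF qw(1)[of t], of "norm (u' t)"]
          mult_right_mono[OF qw(2)[of t], of "norm (u t)"]
        by (simp add: \<phi>_def norm_mult distrib_left)
    qed (rule i)
    finally show ?thesis using 1 2 by (simp add: \<phi>_def)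
  qed
  have h0: "0 \<le> integral {a..b} (\<lambda>t. norm (h t))"
    using h by (intro Henstock_Kurzweil_Integration.integral_nonneg) (auto simp: absolutely_integrable_on_def)
  have "0 \<le> w t" for t using qw(1)[of t] by simp
  from gronwall[OF w this \<phi> ineq x]
  have "\<phi> x \<le> (\<phi> a + integral {a..b} (\<lambda>t. norm (h t))) * exp (integral {a..x} w)" by simp
  also have "\<dots> \<le> (\<phi> a + integral {a..b} (\<lambda>t. norm (h t))) * exp (integral {a..b} w)"
  proof (intro mult_left_mono)
    have "integral {a..x} w \<le> integral {a..b} w"
      using w absolutely_integrable_on_subinterval[OF w, of a x] x order_trans[OF zero_le_one qw(1)]
      by (intro integral_subset_le) (auto simp: absolutely_integrable_on_def)
    then show "exp (integral {a..x} w) \<le> exp (integral {a..b} w)" by simp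
    show "0 \<le> \<phi> a + integral {a..b} (\<lambda>t. norm (h t))" using h0 by (simp add: \<phi>_def)
  qed
  finally show ?thesis by (simp add: \<phi>_def w_def[abs_def])
qed

lemma solution_eq_0:
  assumes V: "locally_integrable V" and sol: "solution V z u u'" and y: "u y = 0" "u' y = 0"
  shows "u x = 0 \<and> u' x = 0"
proof -
  have fwd: "u x = 0 \<and> u' x = 0" if V: "locally_integrable V" and sol: "solution V z u u'"
    and y: "u y = 0" "u' y = 0" "y \<le> x" for V u u' y x
  proof -
    have "norm (u x) + norm (u' x) \<le> 0"
      using schroedinger_eq_bound[OF V sol, of y x "norm z" x] y by simp
    then have "norm (u x) = 0" "norm (u' x) = 0" using norm_ge_zero[of "u x"] norm_ge_zero[of "u' x"] by linarith+
    then show ?thesis by simp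
  qed
  show ?thesis
  proof (cases "y \<le> x")
    case True
    then show ?thesis using fwd[OF V sol y] by simp
  next
    case False
    have "solution (\<lambda>x. V (- x)) z (\<lambda>x. u (- x)) (\<lambda>x. - u' (- x))"
      using schroedinger_eq_reflect[OF sol] by simp
    from fwd[OF locally_integrable_reflect[OF V] this, of "-y" "-x"] show ?thesis
      using y False by auto
  qed
qed

lemma solution_unique:
  assumes V: "locally_integrable V" and sol: "solution V z u u'" "solution V z v v'"
    and y: "u y = v y" "u' y = v' y"
  shows "u = v" "u' = v'"
proof -
  have "solution V z (\<lambda>x. 1 * u x + (-1) * v x) (\<lambda>x. 1 * u' x + (-1) * v' x)"
    using schroedinger_eq_linear[OF sol, of 1 "-1"] by simp
  from solution_eq_0[OF V this, of y] y show "u = v" "u' = v'" by (auto simp: fun_eq_iff)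
qed

section \<open>Wronskians and transfer matrices\<close>

lemma wronskian_identity:
  assumes u: "solution V z u u'" and v: "solution V w v v'" and "a \<le> b"
  shows "(u b * v' b - u' b * v b) - (u a * v' a - u' a * v a) = (z - w) * integral {a..b} (\<lambda>t. u t * v t)"
proof -
  have I: "is_interval (UNIV :: real set)" by simp
  note u' = u[unfolded schroedinger_eq_def] and v' = v[unfolded schroedinger_eq_def]
  note 1 = has_ac_derivative_on_mult[OF u'[THEN conjunct1] v'[THEN conjunct2] I]
  note 2 = has_ac_derivative_on_mult[OF u'[THEN conjunct2] v'[THEN conjunct1] I]
  note 3 = has_ac_derivative_on_linear[OF 1 2, of 1 "-1"]
  have eq: "1 * (u' x * v' x + u x * ((complex_of_real (V x) - w) * v x - 0)) +
      - 1 * (((complex_of_real (V x) - z) * u x - 0) * v x + u' x * v' x) = (z - w) * (u x * v x)" for x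
    by (simp add: algebra_simps)
  show ?thesis
    using has_ac_derivative_onD(2)[OF 3[unfolded eq], of a b b] \<open>a \<le> b\<close>
    by (simp only: integral_mult_right) (simp add: algebra_simps)
qed

text \<open>The columns of the matrix are the values at \<open>x\<close> of the solutions with data
  (1, 0) and (0, 1) at \<open>y\<close>. Linearity and uniqueness of solutions show that this matrix
  propagates every solution, and testing a competitor on these two solutions fixes its columns; so
  the definite description is meaningful.\<close>

lemma transfer_matrix_apply:
  assumes V: "locally_integrable V" and sol: "solution V z u u'"
  shows "transfer_matrix V x y z *v vector [u y, u' y] = vector [u x, u' x]"
proof -
  obtain s s' where s: "solution V z s s'" "s y = 1" "s' y = 0" using solution_exists[OF V] .
  obtain t t' where t: "solution V z t t'" "t y = 0" "t' y = 1" using solution_exists[OF V] .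
  let ?P = "\<lambda>M :: complex^2^2. \<forall>u u'. solution V z u u' \<longrightarrow> M *v vector [u y, u' y] = vector [u x, u' x]"
  define M :: "complex^2^2" where "M = vector [vector [s x, t x], vector [s' x, t' x]]"
  have "?P M"
  proof (intro allI impI)
    fix u u' assume sol: "solution V z u u'"
    have "solution V z (\<lambda>x. u y * s x + u' y * t x) (\<lambda>x. u y * s' x + u' y * t' x)"
      using schroedinger_eq_linear[OF s(1) t(1), of "u y" "u' y"] by simp
    from solution_unique[OF V sol this, of y] s t
    have "u x = u y * s x + u' y * t x" "u' x = u y * s' x + u' y * t' x" by (auto dest: fun_cong)
    then show "M *v vector [u y, u' y] = vector [u x, u' x]"
      by (simp add: M_def vec_eq_iff matrix_vector_mult_def sum_2 forall_2 mult.commute)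
  qed
  moreover have "M' = M" if "?P M'" for M'
  proof -
    have "M' *v vector [s y, s' y] = vector [s x, s' x]" "M' *v vector [t y, t' y] = vector [t x, t' x]"
      using that s(1) t(1) by blast+
    then show ?thesis
      by (simp add: M_def vec_eq_iff matrix_vector_mult_def sum_2 forall_2 s t)
  qed
  ultimately have "?P (transfer_matrix V x y z)"
    unfolding transfer_matrix_def by (rule theI)
  then show ?thesis using sol by blast
qed

lemma bounded_linear_matrix_vector_complex: "bounded_linear ((*v) (M :: complex^'n^'m))"
  by (intro linear_conv_bounded_linear[THEN iffD1] linearI)
    (auto simp: vec_eq_iff matrix_vector_mult_def scaleR_sum_right sum.distrib distrib_left)

text \<open>A bound on values of \<open>v\<close> alone is enough: in the perturbation argument the
  Wronskian recovers both \<open>u\<close> and its derivative from such values.\<close>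

lemma norm_solution_le:
  assumes V: "locally_integrable V" and sol: "solution V (complex_of_real E) v v'"
    and E: "E \<in> power_bounded_energies V \<alpha> C N" and st: "s \<in> {0..N}" "t \<in> {0..N}"
  shows "norm (v s) \<le> C * N powr \<alpha> * (norm (v t) + norm (v' t))"
proof -
  let ?M = "transfer_matrix V s t (complex_of_real E)"
  have "norm (v s) = norm ((?M *v vector [v t, v' t]) $ 1)"
    by (simp add: transfer_matrix_apply[OF V sol])
  also have "\<dots> \<le> norm (?M *v vector [v t, v' t])" by (rule Finite_Cartesian_Product.norm_nth_le)
  also have "\<dots> \<le> onorm ((*v) ?M) * norm (vector [v t, v' t] :: complex^2)"
    by (rule onorm[OF bounded_linear_matrix_vector_complex])
  also have "\<dots> \<le> C * N powr \<alpha> * (norm (v t) + norm (v' t))"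
  proof (rule mult_mono)
    show le: "onorm ((*v) ?M) \<le> C * N powr \<alpha>"
      using E st by (simp add: power_bounded_energies_def)
    show "norm (vector [v t, v' t] :: complex^2) \<le> norm (v t) + norm (v' t)"
      unfolding norm_vec_def by (rule order_trans[OF L2_set_le_sum]) (auto simp: sum_2)
    show "0 \<le> C * N powr \<alpha>"
      using onorm_pos_le[OF bounded_linear_matrix_vector_complex[of ?M]] le by linarith
  qed simp
  finally show ?thesis .
qed

section \<open>The Dirichlet solution and its dependence on the energy\<close>

text \<open>The derivative is carried along because \<open>dirichlet_solution\<close> only returns the function.\<close>

definition dirichlet_solution_deriv :: "(real \<Rightarrow> real) \<Rightarrow> complex \<Rightarrow> real \<Rightarrow> complex" where
  "dirichlet_solution_deriv V z =
     (SOME u'. solution V z (dirichlet_solution V z) u' \<and> dirichlet_solution V z 0 = 0 \<and> u' 0 = 1)"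

lemma dirichlet_solution:
  assumes V: "locally_integrable V"
  shows "solution V z (dirichlet_solution V z) (dirichlet_solution_deriv V z)"
    and "dirichlet_solution V z 0 = 0" and "dirichlet_solution_deriv V z 0 = 1"
proof -
  obtain u u' where u: "solution V z u u'" "u 0 = 0" "u' 0 = 1" using solution_exists[OF V] .
  have "\<exists>u'. solution V z (dirichlet_solution V z) u' \<and> dirichlet_solution V z 0 = 0 \<and> u' 0 = 1"
    unfolding dirichlet_solution_def
  proof (rule theI[of "\<lambda>u. \<exists>u'. solution V z u u' \<and> u 0 = 0 \<and> u' 0 = 1" u])
    show "\<exists>u'. solution V z u u' \<and> u 0 = 0 \<and> u' 0 = 1" using u by blast
    show "v = u" if "\<exists>v'. solution V z v v' \<and> v 0 = 0 \<and> v' 0 = 1" for v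
      using that u solution_unique(1)[OF V] by metis
  qed
  from someI_ex[OF this] show "solution V z (dirichlet_solution V z) (dirichlet_solution_deriv V z)"
    "dirichlet_solution V z 0 = 0" "dirichlet_solution_deriv V z 0 = 1"
    unfolding dirichlet_solution_deriv_def by auto
qed

lemma has_ac_derivative_on_cnj:
  assumes "has_ac_derivative_on f g I"
  shows "has_ac_derivative_on (\<lambda>x. cnj (f x)) (\<lambda>x. cnj (g x)) I"
  unfolding has_ac_derivative_on_def
proof (intro ballI impI conjI)
  fix a b assume "a \<in> I" "b \<in> I" "a \<le> b"
  then have g: "g absolutely_integrable_on {a..b}" "f b - f a = integral {a..b} g"
    using assms by (auto simp: has_ac_derivative_on_def)
  show "(\<lambda>x. cnj (g x)) absolutely_integrable_on {a..b}"
    using absolutely_integrable_linear[OF g(1) bounded_linear_cnj] by (simp add: o_def)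
  have "integral {a..b} (cnj \<circ> g) = cnj (integral {a..b} g)"
    using g(1) by (intro integral_linear bounded_linear_cnj) (simp add: absolutely_integrable_on_def)
  then show "cnj (f b) - cnj (f a) = integral {a..b} (\<lambda>x. cnj (g x))"
    using g(2) by (simp add: o_def flip: complex_cnj_diff)
qed

text \<open>This turns the hypothesis on
  \<open>pairing (dirichlet_solution V (complex_of_real E\<^sub>0)) f\<close> into one on the
  integral of \<open>f\<close> against the unconjugated solution, which is the quantity that the
  Laplace transform produces.\<close>

lemma dirichlet_solution_real:
  assumes V: "locally_integrable V"
  shows "cnj (dirichlet_solution V (complex_of_real E) x) = dirichlet_solution V (complex_of_real E) x"
proof -
  let ?u = "dirichlet_solution V (complex_of_real E)" and ?u' = "dirichlet_solution_deriv V (complex_of_real E)"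
  have "solution V (complex_of_real E) (\<lambda>x. cnj (?u x)) (\<lambda>x. cnj (?u' x))"
    using dirichlet_solution(1)[OF V, of "complex_of_real E"] has_ac_derivative_on_cnj[of ?u ?u']
      has_ac_derivative_on_cnj[of ?u' "\<lambda>x. (complex_of_real (V x) - complex_of_real E) * ?u x - 0"]
    unfolding schroedinger_eq_def by simp
  from solution_unique(1)[OF V this dirichlet_solution(1)[OF V], of 0]
  have "(\<lambda>x. cnj (?u x)) = ?u" by (simp add: dirichlet_solution[OF V])
  then show ?thesis by (rule fun_cong)
qed

text \<open>The Wronskian with solutions at the nearby energy \<open>E\<close> that have unit data at \<open>x\<close> plays the role of
  the variation of constants formula; Gronwall's inequality then absorbs the error.\<close>

lemma dirichlet_solution_perturbation:
  assumes V: "locally_integrable V" and E: "E \<in> power_bounded_energies V \<alpha> C N"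
    and C: "0 \<le> C" and N: "0 \<le> N" and z: "norm (z - complex_of_real E) \<le> \<delta>" and x: "x \<in> {0..N}"
  defines "B \<equiv> C * N powr \<alpha>"
  shows "norm (dirichlet_solution V z x) \<le> B * (1 + B * \<delta> * N) * exp (B * \<delta> * N)"
    and "norm (dirichlet_solution_deriv V z x) \<le> B * (1 + B * \<delta> * N) * exp (B * \<delta> * N)"
proof -
  define u u' where "u = dirichlet_solution V z" and "u' = dirichlet_solution_deriv V z"
  have u: "solution V z u u'" "u 0 = 0" "u' 0 = 1"
    using dirichlet_solution[OF V] by (auto simp: u_def u'_def)
  have cu: "continuous_on {0..N} u" using schroedinger_eq_continuous[OF u(1)] by simp
  have \<delta>: "0 \<le> \<delta>" using z norm_ge_zero order_trans by blast
  have B: "0 \<le> B" using C by (simp add: B_def)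
  have W: "norm (u x * v' x - u' x * v x) \<le> B + integral {0..x} (\<lambda>t. B * \<delta> * norm (u t))"
    if v: "solution V (complex_of_real E) v v'" "norm (v x) + norm (v' x) = 1" and x: "x \<in> {0..N}"
    for v v' x
  proof -
    have cx: "continuous_on {0..x} u" using cu x by (auto intro: continuous_on_subset)
    have vB: "norm (v t) \<le> B" if "t \<in> {0..x}" for t
      using norm_solution_le[OF V v(1) E, of t x] that x v(2) by (simp add: B_def)
    have "norm ((z - complex_of_real E) * integral {0..x} (\<lambda>t. u t * v t))
        \<le> \<delta> * integral {0..x} (\<lambda>t. B * norm (u t))"
      unfolding norm_mult
    proof (intro mult_mono z \<delta>)
      show "norm (integral {0..x} (\<lambda>t. u t * v t)) \<le> integral {0..x} (\<lambda>t. B * norm (u t))"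
      proof (rule Henstock_Kurzweil_Integration.integral_norm_bound_integral)
        show "(\<lambda>t. u t * v t) integrable_on {0..x}"
          using schroedinger_eq_continuous[OF v(1), of 0 x] cx
          by (intro integrable_continuous_real continuous_intros) auto
        show "(\<lambda>t. B * norm (u t)) integrable_on {0..x}"
          using cx by (intro integrable_continuous_real continuous_intros) auto
        show "norm (u t * v t) \<le> B * norm (u t)" if "t \<in> {0..x}" for t
          using mult_right_mono[OF vB[OF that], of "norm (u t)"] by (simp add: norm_mult mult.commute)
      qed
    qed simp
    also have "\<dots> = integral {0..x} (\<lambda>t. B * \<delta> * norm (u t))"
      by (simp add: mult.assoc mult.left_commute)
    finally have 1: "norm ((z - complex_of_real E) * integral {0..x} (\<lambda>t. u t * v t)) \<le> \<dots>" .
    \<comment> \<open>At 0 the Wronskian equals \<open>- v 0\<close>, because \<open>u 0 = 0\<close>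
      and \<open>u' 0 = 1\<close>; like every value of \<open>v\<close> it is bounded by
      \<open>B\<close>.\<close>
    have "u x * v' x - u' x * v x = - v 0 + (z - complex_of_real E) * integral {0..x} (\<lambda>t. u t * v t)"
      using wronskian_identity[OF u(1) v(1), of 0 x] x u by (simp add: eq_diff_eq)
    then have "norm (u x * v' x - u' x * v x)
        \<le> norm (v 0) + norm ((z - complex_of_real E) * integral {0..x} (\<lambda>t. u t * v t))"
      by (metis norm_minus_cancel norm_triangle_ineq)
    then show ?thesis using 1 vB[of 0] x by simp
  qed
  \<comment> \<open>Data (0, 1) of \<open>v\<close> at \<open>x\<close> make the Wronskian equal to
    \<open>u x\<close>; the data (1, 0) used for \<open>g2\<close> make it
    \<open>- u' x\<close>.\<close>
  have g1: "norm (u x) \<le> B + integral {0..x} (\<lambda>t. B * \<delta> * norm (u t))" if "x \<in> {0..N}" for x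
  proof -
    obtain v v' where "solution V (complex_of_real E) v v'" "v x = 0" "v' x = 1"
      using solution_exists[OF V] .
    then show ?thesis using W[of v v' x] that by simp
  qed
  have g2: "norm (u' x) \<le> B + integral {0..x} (\<lambda>t. B * \<delta> * norm (u t))" if "x \<in> {0..N}" for x
  proof -
    obtain v v' where "solution V (complex_of_real E) v v'" "v x = 1" "v' x = 0"
      using solution_exists[OF V] .
    then show ?thesis using W[of v v' x] that by simp
  qed
  have bd: "norm (u t) \<le> B * exp (B * \<delta> * N)" if t: "t \<in> {0..N}" for t
  proof -
    have "norm (u t) \<le> B * exp (integral {0..t} (\<lambda>_. B * \<delta>))"
    proof (rule gronwall[OF _ _ _ g1 t])
      show "(\<lambda>_. B * \<delta>) absolutely_integrable_on {0..N}"
        by (rule absolutely_integrable_continuous_real) auto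
      show "continuous_on {0..N} (\<lambda>x. norm (u x))" by (intro continuous_intros cu)
    qed (use B \<delta> in auto)
    also have "\<dots> \<le> B * exp (B * \<delta> * N)"
      using t B \<delta> mult_left_mono[of t N "B * \<delta>"] by (intro mult_left_mono) (auto simp: mult_ac)
    finally show ?thesis .
  qed
  have "B + integral {0..x} (\<lambda>t. B * \<delta> * norm (u t)) \<le> B * (1 + B * \<delta> * N) * exp (B * \<delta> * N)"
  proof -
    have "integral {0..x} (\<lambda>t. B * \<delta> * norm (u t)) \<le> integral {0..x} (\<lambda>t. B * \<delta> * (B * exp (B * \<delta> * N)))"
    proof (rule integral_le)
      show "(\<lambda>t. B * \<delta> * norm (u t)) integrable_on {0..x}"
        using cu x by (intro integrable_continuous_real continuous_intros) (auto intro: continuous_on_subset)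
      show "B * \<delta> * norm (u t) \<le> B * \<delta> * (B * exp (B * \<delta> * N))" if "t \<in> {0..x}" for t
        using bd[of t] that x B \<delta> by (intro mult_left_mono) auto
    qed auto
    also have "\<dots> \<le> B * \<delta> * (B * exp (B * \<delta> * N)) * N"
      using x B \<delta> mult_left_mono[of x N "B * \<delta> * (B * exp (B * \<delta> * N))"] by (simp add: mult_ac)
    also have "B + \<dots> \<le> B * exp (B * \<delta> * N) + B * \<delta> * (B * exp (B * \<delta> * N)) * N"
      using B \<delta> N mult_left_mono[of 1 "exp (B * \<delta> * N)" B] by simp
    finally show ?thesis by (simp add: algebra_simps)
  qed
  with g1[OF x] g2[OF x] show "norm (dirichlet_solution V z x) \<le> B * (1 + B * \<delta> * N) * exp (B * \<delta> * N)"
    "norm (dirichlet_solution_deriv V z x) \<le> B * (1 + B * \<delta> * N) * exp (B * \<delta> * N)"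
    by (auto simp: u_def u'_def)
qed

text \<open>The difference of the solutions at \<open>z\<close> and \<open>w\<close> has zero data
  at 0 and solves the equation at \<open>z\<close> with source (z - w) times the solution at
  \<open>w\<close>, so \<open>schroedinger_eq_bound\<close> applies twice. One constant
  \<open>L\<close> covers differences and values, which later gives measurability in the energy as
  well as stability near \<open>E\<^sub>0\<close>.\<close>

lemma dirichlet_solution_lipschitz:
  assumes V: "locally_integrable V" and R: "0 \<le> R" and B: "0 \<le> B"
  obtains L where "L > 0" and "\<And>(z :: complex) (w :: complex) x. \<lbrakk>norm z \<le> B; norm w \<le> B; x \<in> {0..R}\<rbrakk> \<Longrightarrow>
      norm (dirichlet_solution V z x - dirichlet_solution V w x) \<le> L * norm (z - w) \<and>
      norm (dirichlet_solution_deriv V z x - dirichlet_solution_deriv V w x) \<le> L * norm (z - w) \<and>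
      norm (dirichlet_solution V z x) \<le> L \<and> norm (dirichlet_solution_deriv V z x) \<le> L"
proof -
  define e where "e = exp (integral {0..R} (\<lambda>t. 1 + \<bar>V t\<bar> + B))"
  note D = dirichlet_solution[OF V]
  have bd: "norm (dirichlet_solution V z x) + norm (dirichlet_solution_deriv V z x) \<le> e"
    if "norm z \<le> B" "x \<in> {0..R}" for z x
    using schroedinger_eq_bound[OF V D(1)[of z], of 0 R B x] that D by (simp add: e_def)
  have e: "0 < e" by (simp add: e_def)
  have diff: "norm (dirichlet_solution V z x - dirichlet_solution V w x)
      + norm (dirichlet_solution_deriv V z x - dirichlet_solution_deriv V w x) \<le> (norm (z - w) * (R * e)) * e"
    if zw: "norm z \<le> B" "norm w \<le> B" and x: "x \<in> {0..R}" for z w :: complex and x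
  proof -
    let ?u = "dirichlet_solution V" and ?u' = "dirichlet_solution_deriv V"
    have s: "schroedinger_eq V z (\<lambda>x. - 1 * ((w - z) * ?u w x)) UNIV
        (\<lambda>x. ?u z x - ?u w x) (\<lambda>x. ?u' z x - ?u' w x)"
      using schroedinger_eq_linear[OF D(1)[of z] schroedinger_eq_change_energy[OF D(1)[of w], of z], of 1 "-1"]
      by simp
    have cw: "continuous_on {0..R} (?u w)" using schroedinger_eq_continuous[OF D(1)] by auto
    have "norm (?u z x - ?u w x) + norm (?u' z x - ?u' w x) \<le>
        integral {0..R} (\<lambda>t. norm (- 1 * ((w - z) * ?u w t))) * e"
      unfolding e_def
    proof -
      have "(\<lambda>x. - 1 * ((w - z) * ?u w x)) absolutely_integrable_on {0..R}"
        by (intro absolutely_integrable_continuous_real continuous_intros cw)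
      from schroedinger_eq_bound[OF V s _ this zw(1) x] D
      show "norm (?u z x - ?u w x) + norm (?u' z x - ?u' w x) \<le>
        integral {0..R} (\<lambda>t. norm (- 1 * ((w - z) * ?u w t))) * exp (integral {0..R} (\<lambda>t. 1 + \<bar>V t\<bar> + B))"
        by simp
    qed
    also have "integral {0..R} (\<lambda>t. norm (- 1 * ((w - z) * ?u w t))) \<le> integral {0..R} (\<lambda>t. norm (z - w) * e)"
    proof (rule integral_le)
      show "(\<lambda>t. norm (- 1 * ((w - z) * ?u w t))) integrable_on {0..R}"
        by (intro integrable_continuous_real continuous_intros cw)
      show "norm (- 1 * ((w - z) * ?u w t)) \<le> norm (z - w) * e" if "t \<in> {0..R}" for t
      proof -
        have "norm (?u w t) \<le> e" using bd[OF zw(2) that] norm_ge_zero[of "?u' w t"] by linarith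
        then have "norm (z - w) * norm (?u w t) \<le> norm (z - w) * e" by (rule mult_left_mono) simp
        then show ?thesis by (simp add: norm_mult norm_minus_commute)
      qed
    qed auto
    also have "\<dots> = norm (z - w) * (R * e)" using R by simp
    finally show ?thesis using e by (simp add: mult_right_mono)
  qed
  define L where "L = R * e * e + e"
  have L: "0 < L" "e \<le> L" "R * e * e \<le> L" using e R by (auto simp: L_def add_nonneg_pos)
  show ?thesis
  proof (rule that[OF L(1)])
    fix z w :: complex and x assume *: "norm z \<le> B" "norm w \<le> B" "x \<in> {0..R}"
    have "(norm (z - w) * (R * e)) * e \<le> L * norm (z - w)"
      using mult_right_mono[OF L(3), of "norm (z - w)"] by (simp add: mult_ac)
    with diff[OF *] bd[OF *(1,3)] L(2)
    show "norm (dirichlet_solution V z x - dirichlet_solution V w x) \<le> L * norm (z - w) \<and>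
      norm (dirichlet_solution_deriv V z x - dirichlet_solution_deriv V w x) \<le> L * norm (z - w) \<and>
      norm (dirichlet_solution V z x) \<le> L \<and> norm (dirichlet_solution_deriv V z x) \<le> L"
      using norm_ge_zero[of "dirichlet_solution V z x - dirichlet_solution V w x"]
        norm_ge_zero[of "dirichlet_solution_deriv V z x - dirichlet_solution_deriv V w x"]
        norm_ge_zero[of "dirichlet_solution V z x"] norm_ge_zero[of "dirichlet_solution_deriv V z x"]
      by linarith
  qed
qed

section \<open>The unitary group\<close>

lemma borel_measurable_cnj [measurable (raw)]:
  "f \<in> borel_measurable M \<Longrightarrow> (\<lambda>x. cnj (f x)) \<in> borel_measurable M"
  by (rule measurable_compose[of f M borel]) (auto intro: borel_measurable_continuous_onI continuous_intros)

lemma borel_measurable_cis [measurable]: "cis \<in> borel_measurable borel"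
  unfolding cis_conv_exp by (intro borel_measurable_continuous_onI continuous_intros)

lemma einterval_0_infinity: "einterval 0 \<infinity> = {0<..}"
  by (auto simp: einterval_def zero_ereal_def)

lemma AE_half_line_pos: "AE x in half_line. 0 < x"
  by (rule AE_I2) (simp add: space_restrict_space)

section \<open>The scalar product on \<open>L2\<close>\<close>

lemma L2D:
  assumes "f \<in> L2"
  shows "f \<in> borel_measurable half_line" "integrable half_line (\<lambda>x. (cmod (f x))\<^sup>2)"
  using assms by (auto simp: L2_def)

lemma integrable_L2_mult_cnj:
  assumes "f \<in> L2" "g \<in> L2"
  shows "integrable half_line (\<lambda>x. f x * cnj (g x))"
proof (rule Bochner_Integration.integrable_bound)
  show "integrable half_line (\<lambda>x. (cmod (f x))\<^sup>2 + (cmod (g x))\<^sup>2)"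
    using L2D[OF assms(1)] L2D[OF assms(2)] by auto
  have [measurable]: "f \<in> borel_measurable half_line" "g \<in> borel_measurable half_line"
    using assms L2D by auto
  show "(\<lambda>x. f x * cnj (g x)) \<in> borel_measurable half_line" by measurable
  have "a * b \<le> a\<^sup>2 + b\<^sup>2" for a b :: real
    using sum_squares_bound[of a b] zero_le_power2[of a] zero_le_power2[of b] unfolding mult.assoc by linarith
  then show "AE x in half_line. norm (f x * cnj (g x)) \<le> norm ((cmod (f x))\<^sup>2 + (cmod (g x))\<^sup>2)"
    by (auto simp: norm_mult)
qed

lemma L2_linear:
  assumes "f \<in> L2" "g \<in> L2"
  shows "(\<lambda>x. a * f x + b * g x) \<in> L2"
proof -
  have [measurable]: "f \<in> borel_measurable half_line" "g \<in> borel_measurable half_line"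
    using assms L2D by auto
  have "integrable half_line (\<lambda>x. (cmod (a * f x + b * g x))\<^sup>2)"
  proof (rule Bochner_Integration.integrable_bound)
    show "integrable half_line (\<lambda>x. 2 * (cmod a)\<^sup>2 * (cmod (f x))\<^sup>2 + 2 * (cmod b)\<^sup>2 * (cmod (g x))\<^sup>2)"
      using L2D[OF assms(1)] L2D[OF assms(2)] by auto
    have le: "(norm (u + v))\<^sup>2 \<le> 2 * (norm u)\<^sup>2 + 2 * (norm v)\<^sup>2" for u v :: complex
    proof -
      have "(norm (u + v))\<^sup>2 \<le> (norm u + norm v)\<^sup>2" by (simp add: norm_triangle_ineq)
      also have "\<dots> \<le> 2 * (norm u)\<^sup>2 + 2 * (norm v)\<^sup>2"
        using sum_squares_bound[of "norm u" "norm v"] by (simp add: power2_sum)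
      finally show ?thesis .
    qed
    show "AE x in half_line. norm ((cmod (a * f x + b * g x))\<^sup>2)
        \<le> norm (2 * (cmod a)\<^sup>2 * (cmod (f x))\<^sup>2 + 2 * (cmod b)\<^sup>2 * (cmod (g x))\<^sup>2)"
      using le[of "a * f x" "b * g x" for x] by (simp add: norm_mult power_mult_distrib mult.assoc)
  qed measurable
  then show ?thesis by (simp add: L2_def)
qed

lemma L2_diff: "f \<in> L2 \<Longrightarrow> g \<in> L2 \<Longrightarrow> (\<lambda>x. f x - g x) \<in> L2"
  using L2_linear[of f g 1 "-1"] by simp

lemma pairing_linear_left:
  assumes "f \<in> L2" "g \<in> L2" "h \<in> L2"
  shows "pairing (\<lambda>x. a * f x + b * g x) h = a * pairing f h + b * pairing g h"
  using integrable_L2_mult_cnj[OF assms(1,3)] integrable_L2_mult_cnj[OF assms(2,3)]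
  by (simp add: pairing_def distrib_right mult.assoc)

lemma pairing_cnj: "cnj (pairing f g) = pairing g f"
  using integral_bounded_linear'[OF bounded_linear_cnj bounded_linear_cnj, of half_line "\<lambda>x. f x * cnj (g x)"]
  by (simp add: pairing_def mult.commute)

lemma pairing_linear_right:
  assumes "f \<in> L2" "g \<in> L2" "h \<in> L2"
  shows "pairing h (\<lambda>x. a * f x + b * g x) = cnj a * pairing h f + cnj b * pairing h g"
  using arg_cong[OF pairing_linear_left[OF assms, of a b], of cnj] by (simp add: pairing_cnj)

lemma pairing_self: "pairing f f = of_real ((L2_norm f)\<^sup>2)"
proof -
  have "0 \<le> (\<integral>x. (cmod (f x))\<^sup>2 \<partial>half_line)" by (rule Bochner_Integration.integral_nonneg) simp
  then have "(L2_norm f)\<^sup>2 = (\<integral>x. (cmod (f x))\<^sup>2 \<partial>half_line)" by (simp add: L2_norm_def)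
  moreover have "pairing f f = of_real (\<integral>x. (cmod (f x))\<^sup>2 \<partial>half_line)"
    unfolding pairing_def integral_complex_of_real[symmetric]
    by (simp add: complex_norm_square[symmetric])
  ultimately show ?thesis by simp
qed

lemma L2_norm_nonneg: "0 \<le> L2_norm f"
  unfolding L2_norm_def by simp

lemma L2_norm_square_linear:
  assumes "f \<in> L2" "g \<in> L2"
  shows "(L2_norm (\<lambda>x. a * f x + g x))\<^sup>2 = (cmod a)\<^sup>2 * (L2_norm f)\<^sup>2 + 2 * Re (a * pairing f g) + (L2_norm g)\<^sup>2"
proof -
  have h: "(\<lambda>x. a * f x + 1 * g x) \<in> L2" using L2_linear[OF assms] .
  have "of_real ((L2_norm (\<lambda>x. a * f x + 1 * g x))\<^sup>2)
      = a * (cnj a * pairing f f + pairing f g) + (cnj a * pairing g f + pairing g g)"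
    unfolding pairing_self[symmetric]
    using pairing_linear_left[OF assms h, of a 1] pairing_linear_right[OF assms assms(1), of a 1]
      pairing_linear_right[OF assms assms(2), of a 1] by simp
  also have "pairing g f = cnj (pairing f g)" by (simp add: pairing_cnj)
  also have "a * (cnj a * pairing f f + pairing f g) + (cnj a * cnj (pairing f g) + pairing g g)
      = of_real ((cmod a)\<^sup>2) * pairing f f + (a * pairing f g + cnj (a * pairing f g)) + pairing g g"
    unfolding complex_norm_square by (simp add: algebra_simps)
  also have "\<dots> = of_real ((cmod a)\<^sup>2 * (L2_norm f)\<^sup>2 + 2 * Re (a * pairing f g) + (L2_norm g)\<^sup>2)"
    by (simp only: pairing_self complex_add_cnj of_real_add of_real_mult)
  finally show ?thesis by (simp only: of_real_eq_iff mult_1)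
qed

lemma pairing_Cauchy_Schwarz:
  assumes "f \<in> L2" "g \<in> L2"
  shows "cmod (pairing f g) \<le> L2_norm f * L2_norm g"
proof -
  let ?p = "pairing f g"
  define r where "r = L2_norm f"
  define s where "s = L2_norm g"
  have rs: "0 \<le> r" "0 \<le> s" by (auto simp: r_def s_def L2_norm_nonneg)
  \<comment> \<open>Nonnegativity of the squared norm of \<open>g\<close> minus
    \<open>c * cnj ?p\<close> times \<open>f\<close>, for every real \<open>c\<close>. The best
    choice is c = 1 / r^2; for \<open>r = 0\<close> the quadratic term disappears and a large
    \<open>c\<close> forces \<open>?p\<close> to be 0.\<close>
  have ineq: "2 * c * (cmod ?p)\<^sup>2 \<le> c\<^sup>2 * (cmod ?p)\<^sup>2 * r\<^sup>2 + s\<^sup>2" for c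
  proof -
    have "0 \<le> (L2_norm (\<lambda>x. (- of_real c * cnj ?p) * f x + g x))\<^sup>2" by simp
    also have "\<dots> = c\<^sup>2 * (cmod ?p)\<^sup>2 * r\<^sup>2 - 2 * c * (cmod ?p)\<^sup>2 + s\<^sup>2"
    proof -
      have "- of_real c * cnj ?p * ?p = of_real (- c * (cmod ?p)\<^sup>2)"
        by (simp only: of_real_mult complex_norm_square) (simp add: mult_ac)
      then show ?thesis
        unfolding L2_norm_square_linear[OF assms]
        by (simp add: norm_mult power_mult_distrib r_def s_def del: of_real_mult of_real_power)
    qed
    finally show ?thesis by simp
  qed
  have "(cmod ?p)\<^sup>2 \<le> r\<^sup>2 * s\<^sup>2"
  proof (cases "r = 0")
    case True
    have "(cmod ?p)\<^sup>2 = 0"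
    proof (rule ccontr)
      assume p: "(cmod ?p)\<^sup>2 \<noteq> 0"
      have "2 * ((s\<^sup>2 + 1) / (cmod ?p)\<^sup>2) * (cmod ?p)\<^sup>2 \<le> s\<^sup>2"
        using ineq[of "(s\<^sup>2 + 1) / (cmod ?p)\<^sup>2"] True by simp
      then have "2 * (s\<^sup>2 + 1) \<le> s\<^sup>2" using p by simp
      moreover have "0 \<le> s\<^sup>2" by simp
      ultimately show False by argo
    qed
    then show ?thesis by simp
  next
    case False
    then have r: "r\<^sup>2 > 0" by simp
    have "2 * (1 / r\<^sup>2) * (cmod ?p)\<^sup>2 \<le> (1 / r\<^sup>2) * (cmod ?p)\<^sup>2 + s\<^sup>2"
    proof -
      have "(1 / r\<^sup>2)\<^sup>2 * (cmod ?p)\<^sup>2 * r\<^sup>2 = (1 / r\<^sup>2) * (cmod ?p)\<^sup>2 * ((1 / r\<^sup>2) * r\<^sup>2)"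
        by (simp only: power2_eq_square[of "1 / r\<^sup>2"] mult_ac)
      also have "(1 / r\<^sup>2) * r\<^sup>2 = 1" using r by simp
      finally show ?thesis using ineq[of "1 / r\<^sup>2"] by simp
    qed
    then have "(cmod ?p)\<^sup>2 / r\<^sup>2 \<le> s\<^sup>2" by simp
    then show ?thesis using r by (simp add: field_simps)
  qed
  then have "(cmod ?p)\<^sup>2 \<le> (r * s)\<^sup>2" by (simp add: power_mult_distrib)
  from power2_le_imp_le[OF this mult_nonneg_nonneg[OF rs]] show ?thesis
    by (simp only: r_def s_def)
qed

lemma pairing_cong_AE:
  assumes "AE x in half_line. f x = g x" "f \<in> L2" "g \<in> L2" "h \<in> L2"
  shows "pairing f h = pairing g h"
proof -
  have [measurable]: "f \<in> borel_measurable half_line" "g \<in> borel_measurable half_line"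
      "h \<in> borel_measurable half_line"
    using assms L2D by auto
  show ?thesis
    unfolding pairing_def by (rule integral_cong_AE) (measurable, use assms(1) in auto)
qed

lemma L2_norm_cong_AE:
  assumes "AE x in half_line. f x = g x" "f \<in> L2" "g \<in> L2"
  shows "L2_norm f = L2_norm g"
proof -
  have [measurable]: "f \<in> borel_measurable half_line" "g \<in> borel_measurable half_line"
    using assms L2D by auto
  have "(\<integral>x. (cmod (f x))\<^sup>2 \<partial>half_line) = (\<integral>x. (cmod (g x))\<^sup>2 \<partial>half_line)"
    by (rule integral_cong_AE) (measurable, use assms(1) in auto)
  then show ?thesis by (simp add: L2_norm_def)
qed

lemma integrable_exp_half_line:
  fixes c :: real
  assumes c: "c > 0"
  shows "set_integrable lborel {0<..} (\<lambda>t. exp (- (t * c)))"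
proof -
  note ei = einterval_0_infinity
  have D: "((\<lambda>t. - exp (- (t * c)) / c) has_real_derivative exp (- (t * c))) (at t)" for t
    using c by (auto intro!: derivative_eq_intros)
  have A: "(((\<lambda>t. - exp (- (t * c)) / c) \<circ> real_of_ereal) \<longlongrightarrow> - 1 / c) (at_right 0)"
    unfolding zero_ereal_def ereal_tendsto_simps
    by (rule tendsto_eq_intros | simp add: c[THEN less_imp_neq, symmetric])+
  have "((\<lambda>t. exp (- (t * c))) \<longlongrightarrow> 0) at_top"
    using c by (intro filterlim_compose[OF exp_at_bot] filterlim_compose[OF filterlim_uminus_at_bot_at_top]
        filterlim_at_top_mult_tendsto_pos[OF tendsto_const] filterlim_ident)
  then have "((\<lambda>t. - exp (- (t * c)) / c) \<longlongrightarrow> - 0 / c) at_top"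
    using c by (intro tendsto_intros) auto
  then have B: "(((\<lambda>t. - exp (- (t * c)) / c) \<circ> real_of_ereal) \<longlongrightarrow> 0) (at_left \<infinity>)"
    unfolding ereal_tendsto_simps by simp
  note FTC = interval_integral_FTC_nonneg[of 0 \<infinity> "\<lambda>t. - exp (- (t * c)) / c" "\<lambda>t. exp (- (t * c))", OF _ D _ _ A B]
  show "set_integrable lborel {0<..} (\<lambda>t. exp (- (t * c)))"
    using FTC(1) by (simp add: ei)
qed

section \<open>Consequences of the group axioms\<close>

context
  fixes U :: "real \<Rightarrow> (real \<Rightarrow> complex) \<Rightarrow> (real \<Rightarrow> complex)"
  assumes U: "unitary_group U"
begin

lemma unitary_L2 [simp]: "f \<in> L2 \<Longrightarrow> U t f \<in> L2"
  and unitary_norm: "f \<in> L2 \<Longrightarrow> L2_norm (U t f) = L2_norm f"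
  using U by (auto simp: unitary_group_def)

lemma unitary_linear:
  assumes "f \<in> L2" "g \<in> L2"
  shows "AE x in half_line. U t (\<lambda>y. a * f y + b * g y) x = a * U t f x + b * U t g x"
  using U assms unfolding unitary_group_def by blast

text \<open>Polarisation: comparing the norms of \<open>a * f + g\<close> before and after applying
  \<open>U t\<close> shows that the real parts of \<open>a\<close> times either pairing agree, and a
  = 1 and a = \<i> determine the pairing.\<close>

lemma unitary_pairing:
  assumes f: "f \<in> L2" and g: "g \<in> L2"
  shows "pairing (U t f) (U t g) = pairing f g"
proof -
  have "Re (a * pairing (U t f) (U t g)) = Re (a * pairing f g)" for a
  proof -
    have "L2_norm (\<lambda>x. a * U t f x + 1 * U t g x) = L2_norm (\<lambda>x. a * f x + 1 * g x)"
      using L2_norm_cong_AE[OF unitary_linear[OF f g, of t a 1] unitary_L2[OF L2_linear[OF f g]]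
          L2_linear[OF unitary_L2[OF f] unitary_L2[OF g]]] unitary_norm[OF L2_linear[OF f g, of a 1], of t]
      by simp
    then show ?thesis
      using L2_norm_square_linear[OF f g, of a] L2_norm_square_linear[of "U t f" "U t g" a]
        unitary_norm f g by simp
  qed
  from this[of 1] this[of "\<i>"] show ?thesis by (simp add: complex_eq_iff)
qed

lemma unitary_add:
  assumes "f \<in> L2"
  shows "AE x in half_line. U (s + t) f x = U s (U t f) x"
  using U assms unfolding unitary_group_def by blast

lemma unitary_zero:
  assumes "f \<in> L2"
  shows "AE x in half_line. U 0 f x = f x"
  using U assms unfolding unitary_group_def by blast

lemma unitary_adjoint:
  assumes f: "f \<in> L2" and g: "g \<in> L2"
  shows "pairing (U s f) g = pairing f (U (- s) g)"
proof -
  have "pairing (U s f) g = pairing (U (- s) (U s f)) (U (- s) g)"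
    using f g by (simp add: unitary_pairing)
  also have "\<dots> = pairing f (U (- s) g)"
  proof (rule pairing_cong_AE)
    show "AE x in half_line. U (- s) (U s f) x = f x"
      using unitary_add[OF f, of "- s" s] unitary_zero[OF f] by auto
  qed (use f g in auto)
  finally show ?thesis .
qed

text \<open>The isometry \<open>U t\<close> carries the difference back to time 0, where strong
  continuity is part of \<open>unitary_group\<close>.\<close>

lemma unitary_norm_diff:
  assumes f: "f \<in> L2"
  shows "L2_norm (\<lambda>x. U s f x - U t f x) = L2_norm (\<lambda>x. U (s - t) f x - f x)"
proof -
  have "AE x in half_line. U t (\<lambda>y. 1 * U (s - t) f y + (-1) * f y) x = U s f x - U t f x"
    using unitary_linear[OF unitary_L2[OF f] f, of t 1 "s - t" "-1"] unitary_add[OF f, of t "s - t"]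
    by auto
  from L2_norm_cong_AE[OF this] f L2_diff L2_linear[of "U (s - t) f" f 1 "-1"]
  have "L2_norm (U t (\<lambda>y. U (s - t) f y - f y)) = L2_norm (\<lambda>x. U s f x - U t f x)" by simp
  then show ?thesis using unitary_norm f L2_diff by simp
qed

lemma unitary_continuous:
  assumes f: "f \<in> L2"
  shows "((\<lambda>s. L2_norm (\<lambda>x. U s f x - U t f x)) \<longlongrightarrow> 0) (at t)"
proof -
  have "((\<lambda>t. L2_norm (\<lambda>x. U t f x - f x)) \<longlongrightarrow> 0) (at 0)"
    using U f unfolding unitary_group_def by blast
  from LIM_offset[OF this, of "- t"] show ?thesis
    by (simp add: unitary_norm_diff[OF f])
qed

lemma pairing_unitary_continuous:
  assumes f: "f \<in> L2" and k: "k \<in> L2"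
  shows "continuous_on UNIV (\<lambda>t. pairing (U t f) k)"
proof -
  have "((\<lambda>s. pairing (U s f) k) \<longlongrightarrow> pairing (U t f) k) (at t)" for t
  proof (rule LIM_zero_cancel, rule Lim_null_comparison)
    show "\<forall>\<^sub>F s in at t. norm (pairing (U s f) k - pairing (U t f) k)
        \<le> L2_norm (\<lambda>x. U s f x - U t f x) * L2_norm k"
    proof (intro always_eventually allI)
      fix s
      have "pairing (U s f) k - pairing (U t f) k = pairing (\<lambda>x. U s f x - U t f x) k"
        using pairing_linear_left[of "U s f" "U t f" k 1 "-1"] f k by simp
      also have "cmod \<dots> \<le> L2_norm (\<lambda>x. U s f x - U t f x) * L2_norm k"
        using f k by (intro pairing_Cauchy_Schwarz L2_diff) auto
      finally show "norm (pairing (U s f) k - pairing (U t f) k)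
          \<le> L2_norm (\<lambda>x. U s f x - U t f x) * L2_norm k" .
    qed
    show "((\<lambda>s. L2_norm (\<lambda>x. U s f x - U t f x) * L2_norm k) \<longlongrightarrow> 0) (at t)"
      using tendsto_mult_left_zero[OF unitary_continuous[OF f]] .
  qed
  then show ?thesis by (simp add: continuous_on_def)
qed

text \<open>The vector \<open>f\<close> is arbitrary in \<open>L2\<close>, so the orbit of
  \<open>f\<close> itself need not be differentiable. The adjoint moves the increment of time onto
  \<open>\<phi>\<close>, where it becomes a difference quotient of the generator at
  \<open>- s\<close>; conjugate linearity on the right restores the sign.\<close>

lemma pairing_unitary_derivative:
  assumes f: "f \<in> L2" and \<phi>: "\<phi> \<in> L2" and \<psi>: "\<psi> \<in> L2"
    and gen: "((\<lambda>t. L2_norm (\<lambda>x. (U t \<phi> x - \<phi> x) / complex_of_real t - (- \<i> * \<psi> x))) \<longlongrightarrow> 0) (at 0)"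
  shows "((\<lambda>t. pairing (U t f) \<phi>) has_vector_derivative - \<i> * pairing (U t f) \<psi>) (at t)"
proof -
  let ?g = "U t f"
  define D where "D s = (\<lambda>x. (U s \<phi> x - \<phi> x) / complex_of_real s - (- \<i> * \<psi> x))" for s
  have DL: "D s \<in> L2" for s
    unfolding D_def using L2_linear[OF L2_diff[OF unitary_L2[OF \<phi>] \<phi>] \<psi>, of "1 / of_real s" s "\<i>"]
    by (simp add: divide_inverse mult.commute)
  have quot: "(pairing (U (t + s) f) \<phi> - pairing ?g \<phi>) / of_real s - (- \<i> * pairing ?g \<psi>) = - pairing ?g (D (- s))"
    if "s \<noteq> 0" for s
  proof -
    have "pairing (U (t + s) f) \<phi> = pairing (U s ?g) \<phi>"
      using unitary_add[OF f, of s t] f \<phi> by (intro pairing_cong_AE) (auto simp: add.commute)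
    also have "\<dots> = pairing ?g (U (- s) \<phi>)" using f \<phi> by (simp add: unitary_adjoint)
    finally have 1: "pairing (U (t + s) f) \<phi> = pairing ?g (U (- s) \<phi>)" .
    have "pairing ?g (D (- s)) = pairing ?g (\<lambda>x. (- 1 / of_real s) * (1 * U (- s) \<phi> x + (- 1) * \<phi> x) + \<i> * \<psi> x)"
      unfolding D_def by (simp add: divide_inverse algebra_simps)
    also have "\<dots> = cnj (- 1 / of_real s) * (cnj 1 * pairing ?g (U (- s) \<phi>) + cnj (- 1) * pairing ?g \<phi>) + cnj \<i> * pairing ?g \<psi>"
      using f \<phi> \<psi> L2_linear[of "U (- s) \<phi>" \<phi>]
        pairing_linear_right[of "\<lambda>x. 1 * U (- s) \<phi> x + (- 1) * \<phi> x" \<psi> ?g "- 1 / of_real s" "\<i>"]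
        pairing_linear_right[of "U (- s) \<phi>" \<phi> ?g 1 "-1"]
      by (simp only: unitary_L2)
    finally show ?thesis using 1 that by (simp add: field_simps)
  qed
  have "((\<lambda>s. (pairing (U (t + s) f) \<phi> - pairing ?g \<phi>) / of_real s) \<longlongrightarrow> - \<i> * pairing ?g \<psi>) (at 0)"
  proof (rule LIM_zero_cancel, rule Lim_null_comparison)
    show "\<forall>\<^sub>F s in at 0. norm ((pairing (U (t + s) f) \<phi> - pairing ?g \<phi>) / of_real s - (- \<i> * pairing ?g \<psi>))
        \<le> L2_norm ?g * L2_norm (D (- s))"
      unfolding eventually_at_filter
    proof (intro always_eventually allI impI)
      fix s :: real assume "s \<noteq> 0"
      show "norm ((pairing (U (t + s) f) \<phi> - pairing ?g \<phi>) / of_real s - (- \<i> * pairing ?g \<psi>))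
          \<le> L2_norm ?g * L2_norm (D (- s))"
        unfolding quot[OF \<open>s \<noteq> 0\<close>] norm_minus_cancel
        by (rule pairing_Cauchy_Schwarz[OF unitary_L2[OF f] DL])
    qed
    have "filterlim uminus (at 0) (at (0 :: real))"
      by (rule filterlim_atI) (auto intro!: tendsto_eq_intros simp: eventually_at_filter)
    from filterlim_compose[OF gen[folded D_def] this]
    show "((\<lambda>s. L2_norm ?g * L2_norm (D (- s))) \<longlongrightarrow> 0) (at 0)"
      by (rule tendsto_mult_right_zero)
  qed
  note lim = tendsto_norm_zero[OF LIM_zero[OF this]]
  show ?thesis
    unfolding has_vector_derivative_def has_derivative_at
  proof
    show "((\<lambda>h. norm (pairing (U (t + h) f) \<phi> - pairing ?g \<phi> - h *\<^sub>R (- \<i> * pairing ?g \<psi>)) / norm h) \<longlongrightarrow> 0) (at 0)"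
    proof (rule Lim_transform_eventually[OF lim])
      have "norm ((pairing (U (t + s) f) \<phi> - pairing ?g \<phi>) / of_real s - (- \<i> * pairing ?g \<psi>))
          = norm (pairing (U (t + s) f) \<phi> - pairing ?g \<phi> - s *\<^sub>R (- \<i> * pairing ?g \<psi>)) / norm s"
        if "s \<noteq> 0" for s
      proof -
        have "(pairing (U (t + s) f) \<phi> - pairing ?g \<phi>) / of_real s - (- \<i> * pairing ?g \<psi>)
            = (pairing (U (t + s) f) \<phi> - pairing ?g \<phi> - s *\<^sub>R (- \<i> * pairing ?g \<psi>)) / of_real s"
          using that by (simp add: scaleR_conv_of_real field_simps)
        then show ?thesis by (simp only: norm_divide norm_of_real real_norm_def)
      qed
      then show "\<forall>\<^sub>F s in at 0. norm ((pairing (U (t + s) f) \<phi> - pairing ?g \<phi>) / of_real s - (- \<i> * pairing ?g \<psi>))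
          = norm (pairing (U (t + s) f) \<phi> - pairing ?g \<phi> - s *\<^sub>R (- \<i> * pairing ?g \<psi>)) / norm s"
        unfolding eventually_at_filter by (intro always_eventually) blast
    qed
  qed (rule bounded_linear_scaleR_left)
qed

text \<open>The function differentiated is
  \<open>exp (\<i> * z * of_real t) * pairing (U t f) \<phi>\<close>. Since \<open>pairing\<close>
  is conjugate linear on the right, the term produced by the exponential is absorbed into the second
  argument as \<open>cnj z * \<phi>\<close>. At infinity the exponential decays like exp (- Im z t)
  while the pairing stays bounded by Cauchy-Schwarz, so only the value at 0 survives.\<close>

lemma laplace_transform_pairing:
  assumes f: "f \<in> L2" and \<phi>: "\<phi> \<in> L2" and \<psi>: "\<psi> \<in> L2"
    and gen: "((\<lambda>t. L2_norm (\<lambda>x. (U t \<phi> x - \<phi> x) / complex_of_real t - (- \<i> * \<psi> x))) \<longlongrightarrow> 0) (at 0)"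
    and z: "Im z > 0"
  defines "k \<equiv> \<lambda>x. \<psi> x - cnj z * \<phi> x"
  shows "(LINT t:{0<..}|lborel. exp (\<i> * z * of_real t) * pairing (U t f) k) = - \<i> * pairing f \<phi>"
proof -
  define F where "F t = exp (\<i> * z * of_real t) * pairing (U t f) \<phi>" for t
  define G where "G t = - \<i> * (exp (\<i> * z * of_real t) * pairing (U t f) k)" for t
  have kL: "k \<in> L2" unfolding k_def using L2_linear[OF \<psi> \<phi>, of 1 "- cnj z"] by simp
  have F': "(F has_vector_derivative G t) (at t)" for t
  proof -
    have "pairing (U t f) \<psi> = pairing (U t f) k + z * pairing (U t f) \<phi>"
      unfolding k_def using pairing_linear_right[OF \<psi> \<phi> unitary_L2[OF f], of t 1 "- cnj z"] by simp
    note pairing_unitary_derivative[OF f \<phi> \<psi> gen, of t, unfolded this]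
    then show ?thesis
      unfolding F_def G_def
      by (auto intro!: derivative_eq_intros has_vector_derivative_mult
          has_vector_derivative_real_field simp: algebra_simps)
  qed
  have cG: "continuous_on UNIV G"
    unfolding G_def by (intro continuous_intros pairing_unitary_continuous f kL)
  have nexp: "norm (exp (\<i> * z * of_real t)) = exp (- (Im z * t))" for t by simp
  have bd: "norm (pairing (U t f) g) \<le> L2_norm f * L2_norm g" if "g \<in> L2" for t g
    using pairing_Cauchy_Schwarz[OF unitary_L2[OF f] that, of t] unitary_norm[OF f] by simp
  note ei = einterval_0_infinity
  have Gi: "set_integrable lborel {0<..} G"
    unfolding set_integrable_def
  proof (rule Bochner_Integration.integrable_bound)
    show "integrable lborel (\<lambda>t. (L2_norm f * L2_norm k) * (indicator {0<..} t *\<^sub>R exp (- (t * Im z))))"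
    proof (intro integrable_mult_right)
      show "integrable lborel (\<lambda>t. indicator {0<..} t *\<^sub>R exp (- (t * Im z)))"
        using integrable_exp_half_line[OF z] by (simp add: set_integrable_def)
    qed
    show "(\<lambda>t. indicator {0<..} t *\<^sub>R G t) \<in> borel_measurable lborel"
      using borel_measurable_continuous_onI[OF cG] by simp
    have "norm (G t) \<le> L2_norm f * L2_norm k * exp (- (t * Im z))" for t
      using mult_mono[OF bd[OF kL, of t] order_refl[of "exp (- (Im z * t))"]] L2_norm_nonneg
      unfolding G_def norm_mult nexp by (simp add: mult.commute)
    then show "AE t in lborel. norm (indicator {0<..} t *\<^sub>R G t)
        \<le> norm ((L2_norm f * L2_norm k) * (indicator {0<..} t *\<^sub>R exp (- (t * Im z))))"
      by (auto simp: indicator_def L2_norm_nonneg)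
  qed
  have "(LBINT t=0..\<infinity>. G t) = 0 - F 0"
  proof (rule interval_integral_FTC_integrable)
    show "((F \<circ> real_of_ereal) \<longlongrightarrow> F 0) (at_right 0)"
      unfolding zero_ereal_def ereal_tendsto_simps
      using has_vector_derivative_continuous[OF F'[of 0]]
      by (simp add: continuous_at filterlim_at_split)
    show "((F \<circ> real_of_ereal) \<longlongrightarrow> 0) (at_left \<infinity>)"
      unfolding ereal_tendsto_simps
    proof (rule Lim_null_comparison)
      show "\<forall>\<^sub>F t in at_top. norm (F t) \<le> exp (- (Im z * t)) * (L2_norm f * L2_norm \<phi>)"
        unfolding F_def norm_mult nexp by (intro always_eventually allI mult_left_mono bd \<phi>) simp
      have "((\<lambda>t. exp (- (Im z * t))) \<longlongrightarrow> 0) at_top"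
        using z by (intro filterlim_compose[OF exp_at_bot] filterlim_compose[OF filterlim_uminus_at_bot_at_top]
            filterlim_tendsto_pos_mult_at_top[OF tendsto_const] filterlim_ident)
      then show "((\<lambda>t. exp (- (Im z * t)) * (L2_norm f * L2_norm \<phi>)) \<longlongrightarrow> 0) at_top"
        by (rule tendsto_mult_left_zero)
    qed
    show "isCont G t" for t using cG by (simp add: continuous_on_eq_continuous_at)
  qed (use F' Gi ei in auto)
  then have "(LINT t:{0<..}|lborel. G t) = - F 0"
    by (simp add: interval_lebesgue_integral_def ei)
  moreover have "(LINT t:{0<..}|lborel. G t)
      = - \<i> * (LINT t:{0<..}|lborel. exp (\<i> * z * of_real t) * pairing (U t f) k)"
    unfolding G_def by (rule set_integral_mult_right)
  moreover have "F 0 = pairing f \<phi>"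
    using pairing_cong_AE[OF unitary_zero[OF f] _ f \<phi>] f by (simp add: F_def)
  ultimately have "\<i> * (- \<i> * (LINT t:{0<..}|lborel. exp (\<i> * z * of_real t) * pairing (U t f) k)) = \<i> * (- pairing f \<phi>)"
    by simp
  then show ?thesis by simp
qed

end

section \<open>Plancherel inequalities\<close>

lemma le_one_plus_square: "a \<le> 1 + a\<^sup>2" for a :: real
proof -
  have "2 * a \<le> a\<^sup>2 + 1" using zero_le_power2[of "a - 1"] by (simp add: power2_diff)
  moreover have "0 \<le> a\<^sup>2" by auto
  ultimately show ?thesis by argo
qed

text \<open>Rounding \<open>t\<close> down to the grid of mesh 1 / (n + 1) gives countably many
  measurable pieces, and continuity in \<open>t\<close> gives the limit. Used for the solutions,
  continuous in the energy and measurable in \<open>x\<close>, and for the pairings, continuous in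
  time and measurable in the energy.\<close>

lemma caratheodory_measurable:
  fixes f :: "real \<Rightarrow> 'a \<Rightarrow> 'b::{metric_space, second_countable_topology}"
  assumes meas: "\<And>t. f t \<in> borel_measurable M"
    and cont: "\<And>x. x \<in> space M \<Longrightarrow> continuous_on UNIV (\<lambda>t. f t x)"
  shows "(\<lambda>p. f (fst p) (snd p)) \<in> borel_measurable (borel \<Otimes>\<^sub>M M)"
proof (rule borel_measurable_LIMSEQ_metric)
  define d where "d n t = real_of_int \<lfloor>real (Suc n) * t\<rfloor> / real (Suc n)" for n t
  have step: "(\<lambda>p. f (d n (fst p)) (snd p)) \<in> borel_measurable (borel \<Otimes>\<^sub>M M)" for n
  proof -
    have "(\<lambda>p. (\<lambda>i p. f (real_of_int i / real (Suc n)) (snd p)) \<lfloor>real (Suc n) * fst p\<rfloor> p)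
        \<in> borel_measurable (borel \<Otimes>\<^sub>M M)"
      by (rule measurable_compose_countable) (use meas in measurable)
    then show ?thesis by (simp add: d_def)
  qed
  show "(\<lambda>p. f (d n (fst p)) (snd p)) \<in> borel_measurable (borel \<Otimes>\<^sub>M M)" for n
    by (rule step)
  fix p :: "real \<times> 'a" assume "p \<in> space (borel \<Otimes>\<^sub>M M)"
  then have x: "snd p \<in> space M" by (auto simp: space_pair_measure)
  have "(\<lambda>n. d n t) \<longlonglongrightarrow> t" for t
  proof (rule LIM_zero_cancel, rule Lim_null_comparison)
    have "\<bar>real_of_int \<lfloor>real (Suc n) * t\<rfloor> - real (Suc n) * t\<bar> \<le> 1" for n by linarith
    then have "\<bar>real_of_int \<lfloor>real (Suc n) * t\<rfloor> - real (Suc n) * t\<bar> / real (Suc n) \<le> 1 / real (Suc n)" for n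
      by (intro divide_right_mono) auto
    moreover have "d n t - t = (real_of_int \<lfloor>real (Suc n) * t\<rfloor> - real (Suc n) * t) / real (Suc n)" for n
      by (simp add: d_def diff_divide_distrib del: of_nat_Suc)
    ultimately show "\<forall>\<^sub>F n in sequentially. norm (d n t - t) \<le> 1 / real (Suc n)"
      by (simp del: of_nat_Suc)
    show "(\<lambda>n. 1 / real (Suc n)) \<longlonglongrightarrow> 0"
      using LIMSEQ_inverse_real_of_nat by (simp add: inverse_eq_divide)
  qed
  moreover have "isCont (\<lambda>t. f t (snd p)) (fst p)"
    using cont[OF x] by (simp add: continuous_on_eq_continuous_at)
  ultimately show "(\<lambda>n. f (d n (fst p)) (snd p)) \<longlonglongrightarrow> f (fst p) (snd p)"
    by (rule isCont_tendsto_compose[rotated])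
qed

lemma norm_integral_le:
  fixes f :: "'a \<Rightarrow> 'b::{banach, second_countable_topology}"
  assumes "integrable M f" "integrable M g" "\<And>x. x \<in> space M \<Longrightarrow> norm (f x) \<le> g x"
  shows "norm (\<integral>x. f x \<partial>M) \<le> (\<integral>x. g x \<partial>M)"
  using assms by (intro order_trans[OF integral_norm_bound integral_mono]) auto

lemma integral_complex_cnj: "(\<integral>x. cnj (f x) \<partial>M) = cnj (\<integral>x. f x \<partial>M)"
  by (rule integral_bounded_linear'[OF bounded_linear_cnj bounded_linear_cnj]) simp

text \<open>The positive half-line contributes 1 / (c + \<i> \<xi>) by the fundamental theorem; the
  negative one is its reflection with \<open>- \<xi>\<close> in place of \<open>\<xi>\<close>, and
  the point 0 is negligible.\<close>

lemma integral_exp_abs_cis: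
  fixes c \<xi> :: real
  assumes c: "c > 0"
  shows "integrable lborel (\<lambda>t. complex_of_real (exp (- c * \<bar>t\<bar>)) * cis (- (\<xi> * t)))"
    and "(\<integral>t. complex_of_real (exp (- c * \<bar>t\<bar>)) * cis (- (\<xi> * t)) \<partial>lborel) = of_real (2 * c / (c\<^sup>2 + \<xi>\<^sup>2))"
proof -
  define f where "f \<xi> t = complex_of_real (exp (- c * \<bar>t\<bar>)) * cis (- (\<xi> * t))" for \<xi> t
  define w where "w \<xi> = Complex c \<xi>" for \<xi>
  have w: "w \<xi> \<noteq> 0" for \<xi> using c by (simp add: w_def complex_eq_iff)
  have f_pos: "f \<xi> t = exp (- w \<xi> * of_real t)" if "t > 0" for \<xi> t
    using that by (simp add: f_def w_def exp_eq_polar mult.commute)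
  note ei = einterval_0_infinity
  have meas: "f \<xi> \<in> borel_measurable lborel" for \<xi>
    unfolding f_def cis_conv_exp
    by (auto intro!: borel_measurable_continuous_onI continuous_intros)
  have int: "set_integrable lborel {0<..} (f \<xi>)" for \<xi>
    unfolding set_integrable_def
  proof (rule Bochner_Integration.integrable_bound)
    show "integrable lborel (\<lambda>t. indicator {0<..} t *\<^sub>R exp (- (t * c)))"
      using integrable_exp_half_line[OF c] by (simp add: set_integrable_def)
    show "(\<lambda>t. indicator {0<..} t *\<^sub>R f \<xi> t) \<in> borel_measurable lborel"
      using meas[of \<xi>] by simp
  qed (auto simp: f_def indicator_def norm_mult mult.commute)
  have half: "(LBINT t:{0<..}. f \<xi> t) = 1 / w \<xi>" for \<xi>
  proof -
    have "(LBINT t=0..\<infinity>. exp (- w \<xi> * of_real t)) = 0 - (- 1 / w \<xi>)"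
    proof (rule interval_integral_FTC_integrable[where F = "\<lambda>t. - exp (- w \<xi> * of_real t) / w \<xi>"])
      show "((\<lambda>t. - exp (- w \<xi> * of_real t) / w \<xi>) has_vector_derivative exp (- w \<xi> * of_real t)) (at t)" for t
        using w[of \<xi>] by (auto intro!: derivative_eq_intros has_vector_derivative_real_field)
      show "set_integrable lborel (einterval 0 \<infinity>) (\<lambda>t. exp (- w \<xi> * of_real t))"
        unfolding ei using int[of \<xi>] f_pos[of _ \<xi>]
        by (subst set_integrable_cong[where f' = "f \<xi>"]) auto
      have "((\<lambda>t. - exp (- w \<xi> * of_real t) / w \<xi>) \<longlongrightarrow> - exp (- w \<xi> * of_real 0) / w \<xi>) (at_right 0)"
        by (intro tendsto_intros w)
      then show "(((\<lambda>t. - exp (- w \<xi> * of_real t) / w \<xi>) \<circ> real_of_ereal) \<longlongrightarrow> - 1 / w \<xi>) (at_right 0)"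
        unfolding zero_ereal_def ereal_tendsto_simps by simp
      have "((\<lambda>t. exp (- (t * c))) \<longlongrightarrow> 0) at_top"
        using c by (intro filterlim_compose[OF exp_at_bot] filterlim_compose[OF filterlim_uminus_at_bot_at_top]
            filterlim_at_top_mult_tendsto_pos[OF tendsto_const] filterlim_ident)
      then have "((\<lambda>t. exp (- w \<xi> * of_real t)) \<longlongrightarrow> 0) at_top"
        by (rule Lim_null_comparison[rotated]) (simp add: w_def mult.commute)
      then have "((\<lambda>t. - exp (- w \<xi> * of_real t) / w \<xi>) \<longlongrightarrow> - 0 / w \<xi>) at_top"
        by (intro tendsto_intros w)
      then show "(((\<lambda>t. - exp (- w \<xi> * of_real t) / w \<xi>) \<circ> real_of_ereal) \<longlongrightarrow> 0) (at_left \<infinity>)"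
        unfolding ereal_tendsto_simps by simp
      show "isCont (\<lambda>t. exp (- w \<xi> * of_real t)) t" for t :: real by (intro continuous_intros)
    qed simp
    then have "(LBINT t:{0<..}. exp (- w \<xi> * of_real t)) = 1 / w \<xi>"
      by (simp add: interval_lebesgue_integral_def ei)
    moreover have "(LBINT t:{0<..}. f \<xi> t) = (LBINT t:{0<..}. exp (- w \<xi> * of_real t))"
      using f_pos by (intro set_lebesgue_integral_cong) auto
    ultimately show ?thesis by simp
  qed
  let ?p = "\<lambda>\<xi> t. indicator {0<..} t *\<^sub>R f \<xi> t"
  have pi: "integrable lborel (?p \<xi>)" for \<xi> using int by (simp add: set_integrable_def)
  have pi': "integrable lborel (\<lambda>t. ?p (- \<xi>) (0 + (- 1) * t))"
    by (rule lborel_integrable_real_affine[OF pi]) simp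
  have "(\<integral>t. ?p (- \<xi>) t \<partial>lborel) = \<bar>- 1\<bar> *\<^sub>R (\<integral>t. ?p (- \<xi>) (0 + (- 1) * t) \<partial>lborel)"
    by (rule lborel_integral_real_affine) simp
  then have refl: "(\<integral>t. ?p (- \<xi>) (0 + (- 1) * t) \<partial>lborel) = 1 / w (- \<xi>)"
    using half[of "- \<xi>"] by (simp add: set_lebesgue_integral_def)
  have split: "AE t in lborel. f \<xi> t = ?p \<xi> t + ?p (- \<xi>) (0 + (- 1) * t)"
    using AE_lborel_singleton[of 0]
    by eventually_elim (auto simp: indicator_def f_def)
  have m: "f \<xi> \<in> borel_measurable lborel" "(\<lambda>t. ?p \<xi> t + ?p (- \<xi>) (0 + (- 1) * t)) \<in> borel_measurable lborel"
    using pi[of \<xi>] pi' meas[of \<xi>] by auto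
  have "integrable lborel (f \<xi>)"
    using integrable_cong_AE[OF m split] pi[of \<xi>] pi' by simp
  then show "integrable lborel (\<lambda>t. complex_of_real (exp (- c * \<bar>t\<bar>)) * cis (- (\<xi> * t)))"
    by (simp add: f_def[abs_def])
  have "(\<integral>t. f \<xi> t \<partial>lborel) = (\<integral>t. ?p \<xi> t + ?p (- \<xi>) (0 + (- 1) * t) \<partial>lborel)"
    by (rule integral_cong_AE[OF m split])
  also have "\<dots> = 1 / w \<xi> + 1 / w (- \<xi>)"
    using pi[of \<xi>] pi' half[of \<xi>] refl by (simp add: set_lebesgue_integral_def)
  also have "\<dots> = of_real (2 * c / (c\<^sup>2 + \<xi>\<^sup>2))"
  proof -
    have "c\<^sup>2 + \<xi>\<^sup>2 \<noteq> 0" using c by (simp add: sum_power2_eq_zero_iff)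
    then show ?thesis
      by (simp add: complex_eq_iff w_def Re_divide Im_divide power2_eq_square[of "c\<^sup>2 + \<xi>\<^sup>2"]
          flip: add_divide_distrib)
  qed
  finally show "(\<integral>t. complex_of_real (exp (- c * \<bar>t\<bar>)) * cis (- (\<xi> * t)) \<partial>lborel) = of_real (2 * c / (c\<^sup>2 + \<xi>\<^sup>2))"
    by (simp add: f_def)
qed

text \<open>An antiderivative is \<open>2 * arctan (\<xi> / c)\<close>. The real line is covered by
  two closed half-lines that share the point 0, hence the inequality, which is all that Schur's test
  asks for.\<close>

lemma nn_integral_poisson_kernel:
  fixes c :: real
  assumes c: "c > 0"
  shows "(\<integral>\<^sup>+\<xi>. ennreal (2 * c / (c\<^sup>2 + \<xi>\<^sup>2)) \<partial>lborel) \<le> ennreal (2 * pi)"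
proof -
  define K where "K \<xi> = 2 * c / (c\<^sup>2 + \<xi>\<^sup>2)" for \<xi>
  have Km[measurable]: "K \<in> borel_measurable borel" unfolding K_def by measurable
  have K0: "0 \<le> K \<xi>" for \<xi> using c by (simp add: K_def)
  have A: "(\<integral>\<^sup>+\<xi>. ennreal (K \<xi>) * indicator {0..} \<xi> \<partial>lborel) = ennreal (2 * (pi / 2) - 2 * arctan (0 / c))"
  proof (rule nn_integral_FTC_atLeast)
    show "((\<lambda>\<xi>. 2 * arctan (\<xi> / c)) has_real_derivative K \<xi>) (at \<xi>)" for \<xi>
    proof -
      have "c\<^sup>2 + \<xi>\<^sup>2 \<noteq> 0" using c by (simp add: add_pos_nonneg power2_eq_square)
      then show ?thesis
        using c by (auto intro!: derivative_eq_intros simp: K_def field_simps power2_eq_square)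
    qed
    have "filterlim (\<lambda>\<xi>. \<xi> / c) at_top at_top"
      using c by (simp add: divide_inverse filterlim_at_top_mult_tendsto_pos[OF tendsto_const _ filterlim_ident])
    from filterlim_compose[OF tendsto_arctan_at_top this]
    show "((\<lambda>\<xi>. 2 * arctan (\<xi> / c)) \<longlongrightarrow> 2 * (pi / 2)) at_top" by (intro tendsto_intros)
  qed (use K0 in auto)
  have "(\<integral>\<^sup>+\<xi>. ennreal (K \<xi>) \<partial>lborel) \<le> (\<integral>\<^sup>+\<xi>. ennreal (K \<xi>) * indicator {0..} \<xi> + ennreal (K \<xi>) * indicator {..0} \<xi> \<partial>lborel)"
    by (intro nn_integral_mono) (auto simp: indicator_def)
  also have "\<dots> = (\<integral>\<^sup>+\<xi>. ennreal (K \<xi>) * indicator {0..} \<xi> \<partial>lborel) + (\<integral>\<^sup>+\<xi>. ennreal (K \<xi>) * indicator {..0} \<xi> \<partial>lborel)"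
    by (rule nn_integral_add) auto
  also have "(\<integral>\<^sup>+\<xi>. ennreal (K \<xi>) * indicator {..0} \<xi> \<partial>lborel) = (\<integral>\<^sup>+\<xi>. ennreal (K \<xi>) * indicator {0..} \<xi> \<partial>lborel)"
    by (subst nn_integral_real_affine[where c = "- 1" and t = 0])
      (auto intro!: nn_integral_cong simp: K_def indicator_def)
  also have "(\<integral>\<^sup>+\<xi>. ennreal (K \<xi>) * indicator {0..} \<xi> \<partial>lborel) = ennreal pi" unfolding A by simp
  also have "ennreal pi + ennreal pi = ennreal (2 * pi)"
    by (subst ennreal_plus[symmetric]) auto
  finally show ?thesis by (simp add: K_def)
qed

lemma (in pair_sigma_finite) integrable_mult_pair:
  fixes f :: "'a \<Rightarrow> complex" and g :: "'b \<Rightarrow> complex"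
  assumes f: "integrable M1 f" and g: "integrable M2 g"
  shows "integrable (M1 \<Otimes>\<^sub>M M2) (\<lambda>p. f (fst p) * g (snd p))"
proof (rule Fubini_integrable)
  have [measurable]: "f \<in> borel_measurable M1" "g \<in> borel_measurable M2" using f g by auto
  show "(\<lambda>p. f (fst p) * g (snd p)) \<in> borel_measurable (M1 \<Otimes>\<^sub>M M2)" by measurable
  show "integrable M1 (\<lambda>x. \<integral>y. norm (f (fst (x, y)) * g (snd (x, y))) \<partial>M2)"
    using f by (simp add: norm_mult)
qed (use g in auto)

text \<open>The weight \<open>exp (- c \<bar>t\<bar>)\<close> has a nonnegative Fourier transform of total mass \<open>2 \<pi>\<close>; this yields
  the upper half of Plancherel's identity by Schur's test, uniformly in the weight.\<close>

lemma weighted_plancherel_le: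
  fixes h :: "real \<Rightarrow> complex"
  assumes c: "c > 0" and h: "integrable lborel h" and h2: "integrable lborel (\<lambda>E. (cmod (h E))\<^sup>2)"
  shows "(\<integral>\<^sup>+t. ennreal (exp (- c * \<bar>t\<bar>) * (cmod (\<integral>E. cis (- (E * t)) * h E \<partial>lborel))\<^sup>2) \<partial>lborel)
    \<le> ennreal (2 * pi * (\<integral>E. (cmod (h E))\<^sup>2 \<partial>lborel))"
proof -
  interpret Q: pair_sigma_finite "lborel :: real measure" "lborel \<Otimes>\<^sub>M lborel :: (real \<times> real) measure" ..
  let ?P = "lborel \<Otimes>\<^sub>M lborel :: (real \<times> real) measure"
  define H where "H t = (\<integral>E. cis (- (E * t)) * h E \<partial>lborel)" for t
  define q where "q p = h (fst p) * cnj (h (snd p))" for p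
  define K where "K \<xi> = 2 * c / (c\<^sup>2 + \<xi>\<^sup>2)" for \<xi>
  have hm[measurable]: "h \<in> borel_measurable borel" using h by auto
  have Km[measurable]: "K \<in> borel_measurable borel" unfolding K_def by measurable
  have K0: "0 \<le> K \<xi>" for \<xi> using c by (simp add: K_def)
  have hc: "integrable lborel (\<lambda>E. cnj (h E))" using h by (simp add: integrable_bounded_linear[OF bounded_linear_cnj])
  have q: "integrable ?P q"
    unfolding q_def using lborel_pair.integrable_mult_pair[OF h hc] .
  have [measurable]: "q \<in> borel_measurable ?P" using q by auto
  \<comment> \<open>The square becomes a double integral over two frequencies; integrating out
    \<open>t\<close> first will then turn the weight into the kernel \<open>K\<close> of their
    difference.\<close>
  have Ht: "of_real ((cmod (H t))\<^sup>2) = (\<integral>p. cis (- ((fst p - snd p) * t)) * q p \<partial>?P)" for t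
  proof -
    have i: "integrable ?P (\<lambda>p. cis (- ((fst p - snd p) * t)) * q p)"
      by (rule Bochner_Integration.integrable_bound[OF q]) (auto simp: norm_mult)
    have "(\<integral>p. cis (- ((fst p - snd p) * t)) * q p \<partial>?P)
        = (\<integral>E. \<integral>E'. (cis (- (E * t)) * h E) * cnj (cis (- (E' * t)) * h E') \<partial>lborel \<partial>lborel)"
      unfolding lborel_pair.integral_fst'[OF i, symmetric]
      by (intro Bochner_Integration.integral_cong refl)
        (simp add: q_def cis_cnj cis_mult algebra_simps)
    also have "\<dots> = (\<integral>E. (cis (- (E * t)) * h E) * cnj (H t) \<partial>lborel)"
      unfolding H_def
      by (simp only: integral_mult_right_zero integral_complex_cnj)
    also have "\<dots> = H t * cnj (H t)" by (simp add: H_def)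
    finally show ?thesis by (simp only: complex_norm_square)
  qed
  let ?\<Phi> = "\<lambda>t p. complex_of_real (exp (- c * \<bar>t\<bar>)) * (cis (- ((fst p - snd p) * t)) * q p)"
  have ei: "integrable lborel (\<lambda>t. complex_of_real (exp (- c * \<bar>t\<bar>)))"
    using integral_exp_abs_cis(1)[OF c, of 0] by simp
  have \<Phi>: "integrable (lborel \<Otimes>\<^sub>M ?P) (case_prod ?\<Phi>)"
  proof (rule Bochner_Integration.integrable_bound[OF Q.integrable_mult_pair[OF ei q]])
    show "case_prod ?\<Phi> \<in> borel_measurable (lborel \<Otimes>\<^sub>M ?P)"
      by measurable
  qed (auto simp: norm_mult)
  have inner: "(\<integral>p. ?\<Phi> t p \<partial>?P) = of_real (exp (- c * \<bar>t\<bar>) * (cmod (H t))\<^sup>2)" for t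
    by (simp add: Ht del: of_real_power)
  have wi: "integrable lborel (\<lambda>t. exp (- c * \<bar>t\<bar>) * (cmod (H t))\<^sup>2)"
    using Q.integrable_fst[OF \<Phi>] unfolding inner complex_of_real_integrable_eq .
  have "of_real (\<integral>t. exp (- c * \<bar>t\<bar>) * (cmod (H t))\<^sup>2 \<partial>lborel) = (\<integral>t. (\<integral>p. ?\<Phi> t p \<partial>?P) \<partial>lborel)"
    unfolding inner by (rule integral_complex_of_real[symmetric])
  also have "\<dots> = (\<integral>p. (\<integral>t. ?\<Phi> t p \<partial>lborel) \<partial>?P)"
    by (rule Q.Fubini_integral[OF \<Phi>, symmetric])
  also have "\<dots> = (\<integral>p. of_real (K (fst p - snd p)) * q p \<partial>?P)"
  proof (intro Bochner_Integration.integral_cong refl)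
    fix p
    have "(\<integral>t. ?\<Phi> t p \<partial>lborel) = (\<integral>t. (complex_of_real (exp (- c * \<bar>t\<bar>)) * cis (- ((fst p - snd p) * t))) * q p \<partial>lborel)"
      by (simp add: mult.assoc)
    also have "\<dots> = of_real (K (fst p - snd p)) * q p"
      unfolding K_def using integral_exp_abs_cis[OF c, of "fst p - snd p"] by simp
    finally show "(\<integral>t. ?\<Phi> t p \<partial>lborel) = of_real (K (fst p - snd p)) * q p" .
  qed
  finally have eq: "complex_of_real (\<integral>t. exp (- c * \<bar>t\<bar>) * (cmod (H t))\<^sup>2 \<partial>lborel)
      = (\<integral>p. of_real (K (fst p - snd p)) * q p \<partial>?P)" .
  have nn: "0 \<le> (\<integral>t. exp (- c * \<bar>t\<bar>) * (cmod (H t))\<^sup>2 \<partial>lborel)"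
    by (intro Bochner_Integration.integral_nonneg) simp
  have "(\<integral>\<^sup>+t. ennreal (exp (- c * \<bar>t\<bar>) * (cmod (H t))\<^sup>2) \<partial>lborel) = ennreal (\<integral>t. exp (- c * \<bar>t\<bar>) * (cmod (H t))\<^sup>2 \<partial>lborel)"
    by (rule nn_integral_eq_integral[OF wi]) simp
  also have "\<dots> = ennreal (norm (\<integral>p. of_real (K (fst p - snd p)) * q p \<partial>?P))"
    unfolding eq[symmetric] norm_of_real using nn by simp
  also have "\<dots> \<le> (\<integral>\<^sup>+p. ennreal (norm (of_real (K (fst p - snd p)) * q p)) \<partial>?P)"
  proof (rule integral_norm_bound_ennreal)
    have "integrable ?P (\<lambda>p. of_real (2 / c) * q p)" using q by simp
    then show "integrable ?P (\<lambda>p. of_real (K (fst p - snd p)) * q p)"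
    proof (rule Bochner_Integration.integrable_bound)
      have "K \<xi> \<le> 2 / c" for \<xi>
      proof -
        have "K \<xi> \<le> 2 * c / c\<^sup>2" unfolding K_def using c by (intro divide_left_mono) (auto intro!: mult_pos_pos add_pos_nonneg)
        then show ?thesis using c by (simp add: power2_eq_square)
      qed
      then show "AE p in ?P. norm (of_real (K (fst p - snd p)) * q p) \<le> norm (of_real (2 / c) * q p)"
        unfolding norm_mult norm_of_real using K0 c by (intro AE_I2 mult_right_mono) auto
    qed measurable
  qed
  \<comment> \<open>Schur's test: the inequality of arithmetic and geometric means separates the two
    frequencies, leaving in each half one free variable in which \<open>K\<close> has mass at most 2
    \<pi>.\<close>
  also have "\<dots> \<le> (\<integral>\<^sup>+p. ennreal ((cmod (h (fst p)))\<^sup>2 / 2) * ennreal (K (fst p - snd p))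
      + ennreal ((cmod (h (snd p)))\<^sup>2 / 2) * ennreal (K (fst p - snd p)) \<partial>?P)"
  proof (rule nn_integral_mono)
    fix p :: "real \<times> real"
    have "norm (of_real (K (fst p - snd p)) * q p) = K (fst p - snd p) * (cmod (h (fst p)) * cmod (h (snd p)))"
      using K0 by (simp add: q_def norm_mult)
    also have "\<dots> \<le> K (fst p - snd p) * ((cmod (h (fst p)))\<^sup>2 / 2 + (cmod (h (snd p)))\<^sup>2 / 2)"
      using sum_squares_bound[of "cmod (h (fst p))" "cmod (h (snd p))"] by (intro mult_left_mono K0) simp
    also have "\<dots> = (cmod (h (fst p)))\<^sup>2 / 2 * K (fst p - snd p) + (cmod (h (snd p)))\<^sup>2 / 2 * K (fst p - snd p)"
      by (simp add: algebra_simps)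
    finally show "ennreal (norm (of_real (K (fst p - snd p)) * q p))
        \<le> ennreal ((cmod (h (fst p)))\<^sup>2 / 2) * ennreal (K (fst p - snd p))
          + ennreal ((cmod (h (snd p)))\<^sup>2 / 2) * ennreal (K (fst p - snd p))"
      using K0 by (simp add: ennreal_mult[symmetric] ennreal_plus[symmetric] del: ennreal_plus)
  qed
  also have "\<dots> = (\<integral>\<^sup>+p. ennreal ((cmod (h (fst p)))\<^sup>2 / 2) * ennreal (K (fst p - snd p)) \<partial>?P)
      + (\<integral>\<^sup>+p. ennreal ((cmod (h (snd p)))\<^sup>2 / 2) * ennreal (K (fst p - snd p)) \<partial>?P)"
    by (rule nn_integral_add) measurable
  also have "\<dots> \<le> ennreal (pi * (\<integral>E. (cmod (h E))\<^sup>2 \<partial>lborel)) + ennreal (pi * (\<integral>E. (cmod (h E))\<^sup>2 \<partial>lborel))"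
  proof (rule add_mono)
    have kint: "(\<integral>\<^sup>+y. ennreal (K (x - y)) \<partial>lborel) \<le> ennreal (2 * pi)" "(\<integral>\<^sup>+y. ennreal (K (y - x)) \<partial>lborel) \<le> ennreal (2 * pi)" for x
    proof -
      have "(\<integral>\<^sup>+\<xi>. ennreal (K \<xi>) \<partial>lborel) = (\<integral>\<^sup>+y. ennreal (K (x - y)) \<partial>lborel)"
        by (subst nn_integral_real_affine[where c = "- 1" and t = x]) auto
      then show "(\<integral>\<^sup>+y. ennreal (K (x - y)) \<partial>lborel) \<le> ennreal (2 * pi)"
        using nn_integral_poisson_kernel[OF c] by (simp add: K_def)
      moreover have "K (y - x) = K (x - y)" for y by (simp add: K_def power2_commute)
      ultimately show "(\<integral>\<^sup>+y. ennreal (K (y - x)) \<partial>lborel) \<le> ennreal (2 * pi)" by simp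
    qed
    have tot: "(\<integral>\<^sup>+x. ennreal ((cmod (h x))\<^sup>2 / 2) * ennreal (2 * pi) \<partial>lborel) = ennreal (pi * (\<integral>E. (cmod (h E))\<^sup>2 \<partial>lborel))"
    proof -
      have "(\<integral>\<^sup>+x. ennreal ((cmod (h x))\<^sup>2 / 2) * ennreal (2 * pi) \<partial>lborel) = (\<integral>\<^sup>+x. ennreal (pi * (cmod (h x))\<^sup>2) \<partial>lborel)"
        by (intro nn_integral_cong) (simp add: ennreal_mult[symmetric] mult.commute)
      also have "\<dots> = ennreal (\<integral>x. pi * (cmod (h x))\<^sup>2 \<partial>lborel)"
        by (rule nn_integral_eq_integral) (use h2 in auto)
      finally show ?thesis by simp
    qed
    have "(\<integral>\<^sup>+p. ennreal ((cmod (h (fst p)))\<^sup>2 / 2) * ennreal (K (fst p - snd p)) \<partial>?P)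
        = (\<integral>\<^sup>+x. \<integral>\<^sup>+y. ennreal ((cmod (h x))\<^sup>2 / 2) * ennreal (K (x - y)) \<partial>lborel \<partial>lborel)"
      using lborel.nn_integral_fst[of "\<lambda>p. ennreal ((cmod (h (fst p)))\<^sup>2 / 2) * ennreal (K (fst p - snd p))" lborel]
      by (simp only: fst_conv snd_conv) measurable
    also have "\<dots> = (\<integral>\<^sup>+x. ennreal ((cmod (h x))\<^sup>2 / 2) * (\<integral>\<^sup>+y. ennreal (K (x - y)) \<partial>lborel) \<partial>lborel)"
      by (intro nn_integral_cong nn_integral_cmult) measurable
    also have "\<dots> \<le> (\<integral>\<^sup>+x. ennreal ((cmod (h x))\<^sup>2 / 2) * ennreal (2 * pi) \<partial>lborel)"
      by (intro nn_integral_mono mult_left_mono kint) simp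
    finally show "(\<integral>\<^sup>+p. ennreal ((cmod (h (fst p)))\<^sup>2 / 2) * ennreal (K (fst p - snd p)) \<partial>?P)
        \<le> ennreal (pi * (\<integral>E. (cmod (h E))\<^sup>2 \<partial>lborel))" unfolding tot .
    have "(\<integral>\<^sup>+p. ennreal ((cmod (h (snd p)))\<^sup>2 / 2) * ennreal (K (fst p - snd p)) \<partial>?P)
        = (\<integral>\<^sup>+y. \<integral>\<^sup>+x. ennreal ((cmod (h y))\<^sup>2 / 2) * ennreal (K (x - y)) \<partial>lborel \<partial>lborel)"
      using lborel_pair.nn_integral_snd[of "\<lambda>p. ennreal ((cmod (h (snd p)))\<^sup>2 / 2) * ennreal (K (fst p - snd p))"]
      by (simp only: fst_conv snd_conv) measurable
    also have "\<dots> = (\<integral>\<^sup>+y. ennreal ((cmod (h y))\<^sup>2 / 2) * (\<integral>\<^sup>+x. ennreal (K (x - y)) \<partial>lborel) \<partial>lborel)"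
      by (intro nn_integral_cong nn_integral_cmult) measurable
    also have "\<dots> \<le> (\<integral>\<^sup>+x. ennreal ((cmod (h x))\<^sup>2 / 2) * ennreal (2 * pi) \<partial>lborel)"
      by (intro nn_integral_mono mult_left_mono kint) simp
    finally show "(\<integral>\<^sup>+p. ennreal ((cmod (h (snd p)))\<^sup>2 / 2) * ennreal (K (fst p - snd p)) \<partial>?P)
        \<le> ennreal (pi * (\<integral>E. (cmod (h E))\<^sup>2 \<partial>lborel))" unfolding tot .
  qed
  also have "\<dots> = ennreal (2 * pi * (\<integral>E. (cmod (h E))\<^sup>2 \<partial>lborel))"
    by (subst ennreal_plus[symmetric]) (auto intro!: Bochner_Integration.integral_nonneg mult_nonneg_nonneg)
  finally show ?thesis by (simp add: H_def)
qed

section \<open>Vector-valued Plancherel inequality and duality\<close>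

lemma borel_measurable_fourier_integral:
  fixes k :: "real \<Rightarrow> 'a \<Rightarrow> complex"
  assumes k: "(\<lambda>p. k (fst p) (snd p)) \<in> borel_measurable (borel \<Otimes>\<^sub>M M)"
  shows "(\<lambda>p. \<integral>E. cis (- (E * fst p)) * k E (snd p) \<partial>lborel) \<in> borel_measurable (lborel \<Otimes>\<^sub>M M)"
proof (rule lborel.borel_measurable_lebesgue_integral)
  have [measurable]: "(\<lambda>w. k (snd w) (snd (fst w))) \<in> borel_measurable ((lborel \<Otimes>\<^sub>M M) \<Otimes>\<^sub>M lborel)"
    using measurable_compose[OF _ k, of "\<lambda>w. (snd w, snd (fst w))" "(lborel \<Otimes>\<^sub>M M) \<Otimes>\<^sub>M lborel"] by simp
  show "(\<lambda>(p, E). cis (- (E * fst p)) * k E (snd p)) \<in> borel_measurable ((lborel \<Otimes>\<^sub>M M) \<Otimes>\<^sub>M lborel)"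
    unfolding case_prod_beta by measurable
qed

text \<open>Tonelli reduces this to the scalar inequality for each \<open>x\<close>. The right-hand
  side is linear in the measure of \<open>B\<close>, whereas the quantity \<open>J\<close> of the
  next lemma will be bounded below by a multiple of that measure; the quotient of J^2 by this bound
  is therefore linear in it, as the theorem requires.\<close>

lemma (in finite_measure) weighted_plancherel_vector_le:
  fixes k :: "real \<Rightarrow> 'a \<Rightarrow> complex"
  assumes c: "c > 0" and B: "B \<in> sets borel" "emeasure lborel B < \<infinity>" and \<kappa>: "0 \<le> \<kappa>"
    and k[measurable]: "(\<lambda>p. k (fst p) (snd p)) \<in> borel_measurable (borel \<Otimes>\<^sub>M M)"
    and kb: "\<And>E x. x \<in> space M \<Longrightarrow> cmod (k E x) \<le> \<kappa> * indicator B E"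
  shows "(\<integral>\<^sup>+p. ennreal (exp (- c * \<bar>fst p\<bar>) * (cmod (\<integral>E. cis (- (E * fst p)) * k E (snd p) \<partial>lborel))\<^sup>2) \<partial>(lborel \<Otimes>\<^sub>M M))
    \<le> ennreal (2 * pi * \<kappa>\<^sup>2 * measure lborel B * measure M (space M))"
proof -
  interpret Q: pair_sigma_finite lborel M ..
  note [measurable] = borel_measurable_fourier_integral[OF k]
  have [measurable]: "B \<in> sets borel" by (fact B)
  have Bi: "integrable lborel (\<lambda>E. \<kappa> * indicator B E)" "integrable lborel (\<lambda>E. \<kappa>\<^sup>2 * indicator B E)"
    using B by (auto intro!: integrable_mult_right integrable_real_indicator)
  have km: "(\<lambda>E. k E x) \<in> borel_measurable borel" if "x \<in> space M" for x
    using measurable_compose[OF measurable_Pair2'[OF that] k] by simp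
  have ki: "integrable lborel (\<lambda>E. k E x)" if "x \<in> space M" for x
    by (rule Bochner_Integration.integrable_bound[OF Bi(1)])
      (use km[OF that] kb[OF that] \<kappa> in \<open>auto intro: order_trans\<close>)
  have kb2: "(cmod (k E x))\<^sup>2 \<le> \<kappa>\<^sup>2 * indicator B E" if "x \<in> space M" for E x
  proof -
    have "(cmod (k E x))\<^sup>2 \<le> (\<kappa> * indicator B E)\<^sup>2" using kb[OF that] by (intro power_mono) auto
    also have "\<dots> = \<kappa>\<^sup>2 * indicator B E" by (auto simp: indicator_def)
    finally show ?thesis .
  qed
  have ki2: "integrable lborel (\<lambda>E. (cmod (k E x))\<^sup>2)" if "x \<in> space M" for x
    by (rule Bochner_Integration.integrable_bound[OF Bi(2)])
      (use km[OF that] kb2[OF that] in auto)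
  have bd: "(\<integral>E. (cmod (k E x))\<^sup>2 \<partial>lborel) \<le> \<kappa>\<^sup>2 * measure lborel B" if "x \<in> space M" for x
    using integral_mono[OF ki2[OF that] Bi(2) kb2[OF that]] B by simp
  have "(\<integral>\<^sup>+p. ennreal (exp (- c * \<bar>fst p\<bar>) * (cmod (\<integral>E. cis (- (E * fst p)) * k E (snd p) \<partial>lborel))\<^sup>2) \<partial>(lborel \<Otimes>\<^sub>M M))
      = (\<integral>\<^sup>+x. \<integral>\<^sup>+t. ennreal (exp (- c * \<bar>t\<bar>) * (cmod (\<integral>E. cis (- (E * t)) * k E x \<partial>lborel))\<^sup>2) \<partial>lborel \<partial>M)"
    using Q.nn_integral_snd[of "\<lambda>p. ennreal (exp (- c * \<bar>fst p\<bar>) * (cmod (\<integral>E. cis (- (E * fst p)) * k E (snd p) \<partial>lborel))\<^sup>2)"]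
    by (simp only: fst_conv snd_conv) measurable
  also have "\<dots> \<le> (\<integral>\<^sup>+x. ennreal (2 * pi * (\<kappa>\<^sup>2 * measure lborel B)) \<partial>M)"
  proof (rule nn_integral_mono)
    fix x assume x: "x \<in> space M"
    show "(\<integral>\<^sup>+t. ennreal (exp (- c * \<bar>t\<bar>) * (cmod (\<integral>E. cis (- (E * t)) * k E x \<partial>lborel))\<^sup>2) \<partial>lborel)
        \<le> ennreal (2 * pi * (\<kappa>\<^sup>2 * measure lborel B))"
      using bd[OF x] by (intro order_trans[OF weighted_plancherel_le[OF c ki[OF x] ki2[OF x]]] ennreal_leI mult_left_mono) auto
  qed
  also have "\<dots> = ennreal (2 * pi * \<kappa>\<^sup>2 * measure lborel B * measure M (space M))"
    by (simp add: emeasure_eq_measure ennreal_mult[symmetric] mult.assoc)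
  finally show ?thesis .
qed

text \<open>Fubini moves the frequency-dependent test vectors \<open>k E\<close> into \<open>G t = \<integral> cis (- E t) k E dE\<close>, to which
  the Plancherel inequality applies; so \<open>g t\<close> is only ever integrated in \<open>x\<close> at fixed \<open>t\<close>. The choice
  \<open>s = \<bar>J\<bar> / Q\<close> optimises \<open>\<parallel>g\<parallel>\<^sup>2 \<ge> 2 s Re (\<omega> \<langle>g, G\<rangle>) - s\<^sup>2 \<parallel>G\<parallel>\<^sup>2\<close>.\<close>

lemma (in finite_measure) frequency_dependent_lower_bound:
  fixes k g :: "real \<Rightarrow> 'a \<Rightarrow> complex"
  assumes c: "c > 0" and B: "B \<in> sets borel" "emeasure lborel B < \<infinity>" and \<kappa>: "0 \<le> \<kappa>"
    and k[measurable]: "(\<lambda>p. k (fst p) (snd p)) \<in> borel_measurable (borel \<Otimes>\<^sub>M M)"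
    and kb: "\<And>E x. x \<in> space M \<Longrightarrow> cmod (k E x) \<le> \<kappa> * indicator B E"
    and g[measurable]: "\<And>t. g t \<in> borel_measurable M" and g2: "\<And>t. integrable M (\<lambda>x. (cmod (g t x))\<^sup>2)"
    and gb: "\<And>t. (\<integral>x. (cmod (g t x))\<^sup>2 \<partial>M) \<le> S"
    and cont: "\<And>E. continuous_on UNIV (\<lambda>t. \<integral>x. g t x * cnj (k E x) \<partial>M)"
  defines "J \<equiv> \<integral>E. (\<integral>t. indicator {0<..} t *\<^sub>R (of_real (exp (- c * t)) * cis (E * t) * (\<integral>x. g t x * cnj (k E x) \<partial>M)) \<partial>lborel) \<partial>lborel"
  assumes Q: "2 * pi * \<kappa>\<^sup>2 * measure lborel B * measure M (space M) \<le> Q" "Q > 0"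
  shows "ennreal ((cmod J)\<^sup>2 / Q) \<le> (\<integral>\<^sup>+t\<in>{0..}. ennreal (exp (- c * t)) * (\<integral>\<^sup>+x. ennreal ((cmod (g t x))\<^sup>2) \<partial>M) \<partial>lebesgue)"
proof -
  interpret Q: pair_sigma_finite lborel M ..
  have [measurable]: "B \<in> sets borel" by (fact B)
  have kEm[measurable]: "k E \<in> borel_measurable M" for E
    using measurable_compose[OF measurable_Pair1'[of E borel M] k] by simp
  have Bi: "integrable lborel (\<lambda>E. \<kappa> * indicator B E)"
    using B by (auto intro!: integrable_mult_right integrable_real_indicator)
  have gi: "integrable M (g t)" for t
    by (rule square_integrable_imp_integrable) (use g2[of t] in \<open>auto simp: norm_power intro: integrable_norm_cancel\<close>)
  \<comment> \<open>The domination for Fubini's theorem needs a bound on the integral of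
    \<open>cmod (g t x)\<close> that is uniform in \<open>t\<close>; it comes from a \<le> 1 + a^2,
    because \<open>M\<close> is finite.\<close>
  define S' where "S' = measure M (space M) + S"
  have gb': "(\<integral>x. cmod (g t x) \<partial>M) \<le> S'" for t
  proof -
    have "(\<integral>x. cmod (g t x) \<partial>M) \<le> (\<integral>x. 1 + (cmod (g t x))\<^sup>2 \<partial>M)"
      using gi[of t] g2[of t] by (intro integral_mono le_one_plus_square) auto
    also have "\<dots> = measure M (space M) + (\<integral>x. (cmod (g t x))\<^sup>2 \<partial>M)"
      using g2[of t] by (subst Bochner_Integration.integral_add) auto
    also have "\<dots> \<le> S'" using gb[of t] by (simp add: S'_def)
    finally show ?thesis .
  qed
  define p where "p E t = (\<integral>x. g t x * cnj (k E x) \<partial>M)" for E t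
  \<comment> \<open>This stands in for joint measurability of \<open>g\<close>: the pairing is
    measurable in \<open>E\<close> for fixed \<open>t\<close> and continuous in \<open>t\<close> for
    fixed \<open>E\<close>.\<close>
  have pm: "(\<lambda>q. p (snd q) (fst q)) \<in> borel_measurable (borel \<Otimes>\<^sub>M borel)"
  proof (rule caratheodory_measurable[of "\<lambda>t E. p E t"])
    show "(\<lambda>E. p E t) \<in> borel_measurable borel" for t unfolding p_def by measurable
    show "continuous_on UNIV (\<lambda>t. p E t)" for E unfolding p_def by (rule cont)
  qed
  have pm'[measurable]: "(\<lambda>q. p (fst q) (snd q)) \<in> borel_measurable (borel \<Otimes>\<^sub>M borel)"
    using measurable_compose[OF measurable_pair_swap' pm] by (simp add: case_prod_beta)
  have pb: "cmod (p E t) \<le> \<kappa> * indicator B E * S'" for E t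
  proof -
    have "cmod (p E t) \<le> (\<integral>x. \<kappa> * indicator B E * cmod (g t x) \<partial>M)"
      unfolding p_def
    proof (rule norm_integral_le)
      have le: "norm (g t x * cnj (k E x)) \<le> \<kappa> * indicator B E * cmod (g t x)" if "x \<in> space M" for x
        using mult_left_mono[OF kb[OF that, of E], of "cmod (g t x)"] by (simp add: norm_mult mult.commute)
      then show "norm (g t x * cnj (k E x)) \<le> \<kappa> * indicator B E * cmod (g t x)" if "x \<in> space M" for x
        using that .
      show "integrable M (\<lambda>x. g t x * cnj (k E x))"
      proof (rule Bochner_Integration.integrable_bound)
        show "integrable M (\<lambda>x. \<kappa> * indicator B E * cmod (g t x))" using gi[of t] by auto
        show "AE x in M. norm (g t x * cnj (k E x)) \<le> norm (\<kappa> * indicator B E * cmod (g t x))"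
          by (rule AE_I2) (rule order_trans[OF le], simp_all)
      qed measurable
    qed (use gi[of t] in auto)
    also have "\<dots> \<le> \<kappa> * indicator B E * S'"
      using gb'[of t] \<kappa> by (simp add: mult_left_mono)
    finally show ?thesis .
  qed
  define F where "F E t = indicator {0<..} t *\<^sub>R (of_real (exp (- c * t)) * cis (E * t) * p E t)" for E t
  have ehalf: "integrable lborel (\<lambda>t. indicator {0<..} t * exp (- c * t))"
    using integrable_exp_half_line[OF c] by (simp add: set_integrable_def mult.commute)
  have Fi: "integrable (lborel \<Otimes>\<^sub>M lborel) (case_prod F)"
  proof (rule Bochner_Integration.integrable_bound)
    have "integrable lborel (\<lambda>E. complex_of_real (\<kappa> * indicator B E * S'))" "integrable lborel (\<lambda>t. complex_of_real (indicator {0<..} t * exp (- c * t)))"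
      using Bi ehalf unfolding complex_of_real_integrable_eq by auto
    from lborel_pair.integrable_mult_pair[OF this]
    show "integrable (lborel \<Otimes>\<^sub>M lborel) (\<lambda>q. complex_of_real (\<kappa> * indicator B (fst q) * S') * complex_of_real (indicator {0<..} (snd q) * exp (- c * snd q)))" .
    have "norm (F E t) \<le> norm (complex_of_real (\<kappa> * indicator B E * S') * complex_of_real (indicator {0<..} t * exp (- c * t)))" for E t
    proof -
      have "norm (F E t) = indicator {0<..} t * exp (- c * t) * cmod (p E t)"
        by (simp add: F_def norm_mult)
      also have "\<dots> \<le> indicator {0<..} t * exp (- c * t) * (\<kappa> * indicator B E * S')"
        by (intro mult_left_mono pb) simp
      also have "\<dots> \<le> norm (complex_of_real (\<kappa> * indicator B E * S') * complex_of_real (indicator {0<..} t * exp (- c * t)))"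
        unfolding of_real_mult[symmetric] norm_of_real by (simp add: mult.commute)
      finally show ?thesis .
    qed
    then show "AE q in lborel \<Otimes>\<^sub>M lborel. norm (case_prod F q) \<le> norm (complex_of_real (\<kappa> * indicator B (fst q) * S') * complex_of_real (indicator {0<..} (snd q) * exp (- c * snd q)))"
      by (auto simp: case_prod_beta)
    show "case_prod F \<in> borel_measurable (lborel \<Otimes>\<^sub>M lborel)"
      unfolding F_def case_prod_beta by measurable
  qed
  define G where "G t x = (\<integral>E. cis (- (E * t)) * k E x \<partial>lborel)" for t x
  have Gm[measurable]: "(\<lambda>q. G (fst q) (snd q)) \<in> borel_measurable (lborel \<Otimes>\<^sub>M M)"
    unfolding G_def by (rule borel_measurable_fourier_integral[OF k])
  have Gtm[measurable]: "G t \<in> borel_measurable M" for t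
    using measurable_compose[OF measurable_Pair1'[of t lborel M] Gm] by simp
  have Gb: "cmod (G t x) \<le> \<kappa> * measure lborel B" if x: "x \<in> space M" for t x
  proof -
    have "cmod (G t x) \<le> (\<integral>E. \<kappa> * indicator B E \<partial>lborel)"
      unfolding G_def
    proof (rule norm_integral_le)
      have "(\<lambda>E. k E x) \<in> borel_measurable borel"
        using measurable_compose[OF measurable_Pair2'[OF x] k] by simp
      then show "integrable lborel (\<lambda>E. cis (- (E * t)) * k E x)"
        by (intro Bochner_Integration.integrable_bound[OF Bi])
          (use kb[OF x] \<kappa> in \<open>auto simp: norm_mult\<close>)
    qed (use Bi kb[OF x] in \<open>auto simp: norm_mult\<close>)
    then show ?thesis using B by simp
  qed
  define r where "r t = (\<integral>E. cis (E * t) * p E t \<partial>lborel)" for t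
  have r_eq: "r t = (\<integral>x. g t x * cnj (G t x) \<partial>M)" for t
  proof -
    have bi: "integrable (lborel \<Otimes>\<^sub>M M) (\<lambda>(E, x). cis (E * t) * (g t x * cnj (k E x)))"
    proof (rule Bochner_Integration.integrable_bound)
      have "integrable lborel (\<lambda>E. complex_of_real (\<kappa> * indicator B E))"
        using Bi unfolding complex_of_real_integrable_eq .
      from Q.integrable_mult_pair[OF this gi[of t]]
      show "integrable (lborel \<Otimes>\<^sub>M M) (\<lambda>q. complex_of_real (\<kappa> * indicator B (fst q)) * g t (snd q))" .
      have "norm (cis (E * t) * (g t x * cnj (k E x))) \<le> norm (complex_of_real (\<kappa> * indicator B E) * g t x)"
        if "x \<in> space M" for E x
        using mult_left_mono[OF kb[OF that, of E], of "cmod (g t x)"] \<kappa> by (simp add: norm_mult mult_ac)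
      then show "AE q in lborel \<Otimes>\<^sub>M M. norm (case q of (E, x) \<Rightarrow> cis (E * t) * (g t x * cnj (k E x)))
          \<le> norm (complex_of_real (\<kappa> * indicator B (fst q)) * g t (snd q))"
        by (intro AE_I2) (auto simp: space_pair_measure)
    qed measurable
    have "r t = (\<integral>E. \<integral>x. cis (E * t) * (g t x * cnj (k E x)) \<partial>M \<partial>lborel)"
      by (simp add: r_def p_def)
    also have "\<dots> = (\<integral>x. \<integral>E. cis (E * t) * (g t x * cnj (k E x)) \<partial>lborel \<partial>M)"
      by (rule Q.Fubini_integral[OF bi, symmetric])
    also have "\<dots> = (\<integral>x. \<integral>E. g t x * cnj (cis (- (E * t)) * k E x) \<partial>lborel \<partial>M)"
      by (simp add: cis_cnj mult_ac)
    also have "\<dots> = (\<integral>x. g t x * cnj (G t x) \<partial>M)"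
      by (simp only: G_def integral_mult_right_zero integral_complex_cnj)
    finally show ?thesis .
  qed
  have F_int: "(\<integral>E. F E t \<partial>lborel) = indicator {0<..} t *\<^sub>R (of_real (exp (- c * t)) * r t)" for t
    by (simp add: F_def r_def mult.assoc)
  have JF: "J = (\<integral>t. indicator {0<..} t *\<^sub>R (of_real (exp (- c * t)) * r t) \<partial>lborel)"
  proof -
    have "J = (\<integral>t. (\<integral>E. F E t \<partial>lborel) \<partial>lborel)"
      unfolding J_def using lborel_pair.Fubini_integral[OF Fi] by (simp add: F_def p_def)
    then show ?thesis by (simp only: F_int)
  qed
  have ri: "integrable lborel (\<lambda>t. indicator {0<..} t *\<^sub>R (of_real (exp (- c * t)) * r t))"
    using lborel_pair.integrable_snd[OF Fi] by (simp only: F_int)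
  define n where "n t = (\<integral>x. (cmod (G t x))\<^sup>2 \<partial>M)" for t
  have Gnn: "(\<integral>\<^sup>+q. ennreal (indicator {0<..} (fst q) * exp (- c * fst q) * (cmod (G (fst q) (snd q)))\<^sup>2) \<partial>(lborel \<Otimes>\<^sub>M M)) \<le> ennreal Q"
  proof -
    have "(\<integral>\<^sup>+q. ennreal (indicator {0<..} (fst q) * exp (- c * fst q) * (cmod (G (fst q) (snd q)))\<^sup>2) \<partial>(lborel \<Otimes>\<^sub>M M))
        \<le> (\<integral>\<^sup>+q. ennreal (exp (- c * \<bar>fst q\<bar>) * (cmod (G (fst q) (snd q)))\<^sup>2) \<partial>(lborel \<Otimes>\<^sub>M M))"
      by (intro nn_integral_mono ennreal_leI) (auto simp: indicator_def)
    also have "\<dots> \<le> ennreal (2 * pi * \<kappa>\<^sup>2 * measure lborel B * measure M (space M))"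
      unfolding G_def by (rule weighted_plancherel_vector_le[OF c B \<kappa> k kb])
    also have "\<dots> \<le> ennreal Q" using Q by (intro ennreal_leI)
    finally show ?thesis .
  qed
  have Gpi: "integrable (lborel \<Otimes>\<^sub>M M) (\<lambda>(t, x). indicator {0<..} t * exp (- c * t) * (cmod (G t x))\<^sup>2)"
  proof (rule integrableI_nonneg)
    show "(\<integral>\<^sup>+q. ennreal (case q of (t, x) \<Rightarrow> indicator {0<..} t * exp (- c * t) * (cmod (G t x))\<^sup>2) \<partial>(lborel \<Otimes>\<^sub>M M)) < \<infinity>"
      using le_less_trans[OF Gnn ennreal_less_top] by (simp add: case_prod_beta)
  qed (auto simp: case_prod_beta)
  have ni: "integrable lborel (\<lambda>t. indicator {0<..} t * exp (- c * t) * n t)"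
    using Q.integrable_fst[OF Gpi] by (simp add: n_def)
  have nQ: "(\<integral>t. indicator {0<..} t * exp (- c * t) * n t \<partial>lborel) \<le> Q"
  proof -
    have "(\<integral>t. indicator {0<..} t * exp (- c * t) * n t \<partial>lborel)
        = (\<integral>q. (case q of (t, x) \<Rightarrow> indicator {0<..} t * exp (- c * t) * (cmod (G t x))\<^sup>2) \<partial>(lborel \<Otimes>\<^sub>M M))"
      using Q.integral_fst[OF Gpi] by (simp add: n_def)
    also have "ennreal \<dots> = (\<integral>\<^sup>+q. ennreal (case q of (t, x) \<Rightarrow> indicator {0<..} t * exp (- c * t) * (cmod (G t x))\<^sup>2) \<partial>(lborel \<Otimes>\<^sub>M M))"
      by (rule nn_integral_eq_integral[OF Gpi, symmetric]) auto
    also have "\<dots> \<le> ennreal Q" using Gnn by (simp add: case_prod_beta)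
    finally show ?thesis using Q(2) by (simp add: ennreal_le_iff)
  qed
  obtain \<omega> where \<omega>: "cmod \<omega> = 1" "\<omega> * J = of_real (cmod J)"
  proof (cases "J = 0")
    case True
    then show ?thesis using that[of 1] by simp
  next
    case False
    have "cnj J * J = of_real ((cmod J)\<^sup>2)" unfolding complex_norm_square by (simp add: mult.commute)
    then show ?thesis using False that[of "cnj J / of_real (cmod J)"]
      by (simp add: norm_divide power2_eq_square)
  qed
  define s where "s = cmod J / Q"
  have s0: "0 \<le> s" using Q by (simp add: s_def)
  define h where "h t = indicator {0<..} t * exp (- c * t) * (2 * s * Re (\<omega> * r t) - s\<^sup>2 * n t)" for t
  have pt: "2 * s * Re (\<omega> * r t) - s\<^sup>2 * n t \<le> (\<integral>x. (cmod (g t x))\<^sup>2 \<partial>M)" for t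
  proof -
    have G2: "integrable M (\<lambda>x. (cmod (G t x))\<^sup>2)"
    proof (rule integrable_const_bound[where B = "(\<kappa> * measure lborel B)\<^sup>2"])
      show "AE x in M. norm ((cmod (G t x))\<^sup>2) \<le> (\<kappa> * measure lborel B)\<^sup>2"
        using Gb by (intro AE_I2) (auto intro!: power_mono)
    qed measurable
    have gG: "integrable M (\<lambda>x. g t x * cnj (G t x))"
    proof (rule Bochner_Integration.integrable_bound[where f = "\<lambda>x. (\<kappa> * measure lborel B) * cmod (g t x)"])
      show "integrable M (\<lambda>x. (\<kappa> * measure lborel B) * cmod (g t x))" using gi[of t] by auto
      have "cmod (g t x) * cmod (G t x) \<le> \<bar>\<kappa> * measure lborel B\<bar> * cmod (g t x)" if "x \<in> space M" for x
        using mult_left_mono[OF Gb[OF that, of t], of "cmod (g t x)"] \<kappa> by (simp add: mult.commute)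
      then show "AE x in M. norm (g t x * cnj (G t x)) \<le> norm ((\<kappa> * measure lborel B) * cmod (g t x))"
        by (intro AE_I2) (simp add: norm_mult abs_mult)
    qed measurable
    have "2 * s * Re (\<omega> * r t) - s\<^sup>2 * n t = (\<integral>x. 2 * s * Re (\<omega> * (g t x * cnj (G t x))) - s\<^sup>2 * (cmod (G t x))\<^sup>2 \<partial>M)"
      using G2 gG unfolding r_eq n_def
      by (subst Bochner_Integration.integral_diff) (auto simp del: times_complex.simps)
    also have "\<dots> \<le> (\<integral>x. (cmod (g t x))\<^sup>2 \<partial>M)"
    proof (rule integral_mono)
      show "integrable M (\<lambda>x. 2 * s * Re (\<omega> * (g t x * cnj (G t x))) - s\<^sup>2 * (cmod (G t x))\<^sup>2)"
        using G2 gG by (auto simp del: times_complex.simps)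
      fix x
      have "Re (\<omega> * (g t x * cnj (G t x))) \<le> cmod (g t x) * cmod (G t x)"
        using complex_Re_le_cmod[of "\<omega> * (g t x * cnj (G t x))"] \<omega>(1) by (simp add: norm_mult)
      then have "2 * s * Re (\<omega> * (g t x * cnj (G t x))) \<le> 2 * s * (cmod (g t x) * cmod (G t x))"
        using s0 by (intro mult_left_mono) auto
      also have "\<dots> \<le> (cmod (g t x))\<^sup>2 + s\<^sup>2 * (cmod (G t x))\<^sup>2"
        using sum_squares_bound[of "cmod (g t x)" "s * cmod (G t x)"] by (simp add: power_mult_distrib mult_ac)
      finally show "2 * s * Re (\<omega> * (g t x * cnj (G t x))) - s\<^sup>2 * (cmod (G t x))\<^sup>2 \<le> (cmod (g t x))\<^sup>2"
        by simp
    qed (rule g2)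
    finally show ?thesis .
  qed
  have hd: "h t = 2 * s * Re (\<omega> * (indicator {0<..} t *\<^sub>R (of_real (exp (- c * t)) * r t)))
      - s\<^sup>2 * (indicator {0<..} t * exp (- c * t) * n t)" for t
    by (simp add: h_def indicator_def algebra_simps)
  let ?R = "\<lambda>t. \<omega> * (indicator {0<..} t *\<^sub>R (of_real (exp (- c * t)) * r t))"
  have Ri: "integrable lborel ?R" using ri by (rule integrable_mult_right)
  have hi1: "integrable lborel (\<lambda>t. 2 * s * Re (?R t))"
    by (intro integrable_mult_right integrable_bounded_linear[OF bounded_linear_Re Ri])
  have hi2: "integrable lborel (\<lambda>t. s\<^sup>2 * (indicator {0<..} t * exp (- c * t) * n t))"
    by (intro integrable_mult_right ni)
  have hi: "integrable lborel h"
    unfolding hd by (rule Bochner_Integration.integrable_diff[OF hi1 hi2])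
  have "(\<integral>t. Re (?R t) \<partial>lborel) = Re (\<omega> * J)"
    unfolding JF integral_bounded_linear[OF bounded_linear_Re Ri] by (simp only: integral_mult_right_zero)
  then have "(\<integral>t. h t \<partial>lborel) = 2 * s * Re (\<omega> * J) - s\<^sup>2 * (\<integral>t. indicator {0<..} t * exp (- c * t) * n t \<partial>lborel)"
    unfolding hd Bochner_Integration.integral_diff[OF hi1 hi2] by (simp only: integral_mult_right_zero)
  also have "\<dots> \<ge> 2 * s * cmod J - s\<^sup>2 * Q"
    unfolding \<omega>(2) using nQ by (simp add: mult_left_mono)
  also have "2 * s * cmod J - s\<^sup>2 * Q = (cmod J)\<^sup>2 / Q"
    using Q(2) by (simp add: s_def power2_eq_square field_simps)
  finally have "(cmod J)\<^sup>2 / Q \<le> (\<integral>t. h t \<partial>lborel)" .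
  also have "\<dots> \<le> (\<integral>t. max 0 (h t) \<partial>lborel)"
    using hi by (intro integral_mono) auto
  finally have "ennreal ((cmod J)\<^sup>2 / Q) \<le> ennreal (\<integral>t. max 0 (h t) \<partial>lborel)" by (rule ennreal_leI)
  also have "\<dots> = (\<integral>\<^sup>+t. ennreal (max 0 (h t)) \<partial>lborel)"
    using hi by (intro nn_integral_eq_integral[symmetric]) auto
  \<comment> \<open>The positive part of \<open>h\<close> is Borel measurable, so the completion
    does not change its integral. The integrand built from \<open>g\<close> enters afterwards
    through monotonicity only, which asks for no measurability in \<open>t\<close>.\<close>
  also have "\<dots> = (\<integral>\<^sup>+t. ennreal (max 0 (h t)) \<partial>lebesgue)"
    using hi by (intro nn_integral_completion[symmetric])
  also have "\<dots> \<le> (\<integral>\<^sup>+t\<in>{0..}. ennreal (exp (- c * t)) * (\<integral>\<^sup>+x. ennreal ((cmod (g t x))\<^sup>2) \<partial>M) \<partial>lebesgue)"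
  proof (rule nn_integral_mono)
    fix t
    have gn: "(\<integral>\<^sup>+x. ennreal ((cmod (g t x))\<^sup>2) \<partial>M) = ennreal (\<integral>x. (cmod (g t x))\<^sup>2 \<partial>M)"
      by (rule nn_integral_eq_integral[OF g2]) simp
    have "0 \<le> (\<integral>x. (cmod (g t x))\<^sup>2 \<partial>M)" by (intro Bochner_Integration.integral_nonneg) simp
    then have "max 0 (h t) \<le> indicator {0<..} t * exp (- c * t) * (\<integral>x. (cmod (g t x))\<^sup>2 \<partial>M)"
      unfolding h_def using pt[of t] by (auto simp: indicator_def)
    then have "ennreal (max 0 (h t)) \<le> ennreal (indicator {0<..} t * exp (- c * t) * (\<integral>x. (cmod (g t x))\<^sup>2 \<partial>M))"
      by (rule ennreal_leI)
    also have "\<dots> \<le> ennreal (exp (- c * t)) * (\<integral>\<^sup>+x. ennreal ((cmod (g t x))\<^sup>2) \<partial>M) * indicator {0..} t"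
      unfolding gn by (auto simp: indicator_def ennreal_mult')
    finally show "ennreal (max 0 (h t)) \<le> ennreal (exp (- c * t)) * (\<integral>\<^sup>+x. ennreal ((cmod (g t x))\<^sup>2) \<partial>M) * indicator {0..} t" .
  qed
  finally show ?thesis .
qed

section \<open>The transport bound\<close>

lemma schroedinger_eq_continuous_UNIV:
  assumes "solution V z u u'"
  shows "continuous_on UNIV u" "continuous_on UNIV u'"
proof -
  have "isCont h x" if "\<And>a b. continuous_on {a..b} h" for h :: "real \<Rightarrow> complex" and x
    using continuous_on_interior[OF that[of "x - 1" "x + 1"], of x] by simp
  then show "continuous_on UNIV u" "continuous_on UNIV u'"
    using schroedinger_eq_continuous[OF assms] by (auto simp: continuous_on_eq_continuous_at)
qed

text \<open>The ramp is differentiable except at its two corners, a finite set that the fundamental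
  theorem of calculus tolerates.\<close>

lemma has_ac_derivative_on_ramp:
  fixes a b :: real
  assumes "a < b"
  shows "has_ac_derivative_on (\<lambda>x. complex_of_real (max 0 (min 1 ((x - a) / (b - a)))))
    (\<lambda>x. complex_of_real (indicator {a..b} x / (b - a))) I"
  unfolding has_ac_derivative_on_def
proof (intro ballI impI)
  fix c d :: real assume "c \<le> d"
  let ?f = "\<lambda>x. complex_of_real (max 0 (min 1 ((x - a) / (b - a))))"
  let ?g = "\<lambda>x. complex_of_real (indicator {a..b} x / (b - a))"
  have "(?g has_integral ?f d - ?f c) {c..d}"
  proof (rule fundamental_theorem_of_calculus_interior_strong[of "{a, b}"])
    show "continuous_on {c..d} ?f" using assms by (intro continuous_intros) auto
    fix x assume x: "x \<in> {c<..<d} - {a, b}"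
    consider "x < a" | "a < x" "x < b" | "b < x" using x by fastforce
    then show "(?f has_vector_derivative ?g x) (at x)"
    proof cases
      case 1
      have "((\<lambda>x. 0) has_vector_derivative ?g x) (at x)" using 1 by simp
      then show ?thesis
        by (rule has_vector_derivative_transform_within_open[of _ _ _ "{..<a}"])
          (use 1 assms in \<open>auto simp: field_simps max_def min_def\<close>)
    next
      case 2
      have "((\<lambda>x. complex_of_real ((x - a) / (b - a))) has_vector_derivative ?g x) (at x)"
        using 2 assms by (auto intro!: derivative_eq_intros has_vector_derivative_of_real
            simp: has_real_derivative_iff_has_vector_derivative[symmetric] divide_inverse)
      then show ?thesis
        by (rule has_vector_derivative_transform_within_open[of _ _ _ "{a<..<b}"])
          (use 2 assms in \<open>auto simp: field_simps max_def min_def\<close>)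
    next
      case 3
      have "((\<lambda>x. 1) has_vector_derivative ?g x) (at x)" using 3 by simp
      then show ?thesis
        by (rule has_vector_derivative_transform_within_open[of _ _ _ "{b<..}"])
          (use 3 assms in \<open>auto simp: field_simps max_def min_def\<close>)
    qed
  qed (use \<open>c \<le> d\<close> in auto)
  moreover have "((\<lambda>x. norm (?g x)) integrable_on {c..d})"
  proof -
    have "(\<lambda>x. 1 / (b - a)) integrable_on ({a..b} \<inter> {c..d})"
      unfolding Int_atLeastAtMost by (intro integrable_continuous_real) auto
    then have "(\<lambda>x. if x \<in> {a..b} then 1 / (b - a) else 0) integrable_on {c..d}"
      by (simp only: integrable_restrict_Int Int_commute)
    moreover have "(\<lambda>x. norm (?g x)) = (\<lambda>x. if x \<in> {a..b} then 1 / (b - a) else 0)"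
      using assms by (auto simp: fun_eq_iff indicator_def norm_divide simp flip: of_real_diff)
    ultimately show ?thesis by simp
  qed
  ultimately show "?g absolutely_integrable_on {c..d} \<and> ?f d - ?f c = integral {c..d} ?g"
    unfolding absolutely_integrable_on_def using has_integral_integrable integral_unique by metis
qed

text \<open>The cutoff is 1 - 3 s^2 + 2 s^3 for the linear ramp \<open>s\<close> on [N/2, N]. Its
  derivative is - 6 s (1 - s) s'; as s (1 - s) vanishes off the ramp, s' may be replaced by the
  constant 2 / N, so the derivative is 12 / N times s^2 - s and is again absolutely continuous,
  which is the regularity that the domain of the operator demands. The bounds 3 / N and 24 / N^2
  come from s (1 - s) \<le> 1/4 and from |2 s - 1| \<le> 1 with slope 2 / N; the bound 6 is the
  crude sum of the coefficients.\<close>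

lemma smooth_cutoff:
  fixes N :: real
  assumes N: "N > 0"
  obtains \<theta> \<theta>' \<theta>'' :: "real \<Rightarrow> complex"
  where "\<And>I. is_interval I \<Longrightarrow> has_ac_derivative_on \<theta> \<theta>' I" "\<And>I. is_interval I \<Longrightarrow> has_ac_derivative_on \<theta>' \<theta>'' I"
    and "\<And>x. x \<le> N / 2 \<Longrightarrow> \<theta> x = 1" "\<And>x. N \<le> x \<Longrightarrow> \<theta> x = 0"
    and "\<And>x. x \<notin> {N/2..N} \<Longrightarrow> \<theta>' x = 0 \<and> \<theta>'' x = 0"
    and "\<And>x. cmod (\<theta>' x) \<le> 3 / N" "\<And>x. cmod (\<theta>'' x) \<le> 24 / N\<^sup>2"
    and "\<theta> \<in> borel_measurable borel" "\<theta>' \<in> borel_measurable borel" "\<theta>'' \<in> borel_measurable borel"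
    and "\<And>x. cnj (\<theta> x) = \<theta> x" "\<And>x. cmod (\<theta> x) \<le> 6"
proof -
  define r where "r x = max 0 (min 1 ((x - N / 2) / (N - N / 2)))" for x
  define s where "s x = complex_of_real (r x)" for x
  define d where "d x = complex_of_real (indicator {N/2..N} x / (N - N / 2))" for x
  have sd: "has_ac_derivative_on s d I" for I
    unfolding s_def r_def d_def by (rule has_ac_derivative_on_ramp) (use N in auto)
  have r01: "0 \<le> r x" "r x \<le> 1" for x by (auto simp: r_def)
  have r0: "r x = 0" if "x \<le> N / 2" for x using that N divide_nonpos_pos[of "x - N / 2" "N - N / 2"] by (auto simp: r_def)
  have r1: "r x = 1" if "N \<le> x" for x using that N by (auto simp: r_def max_def min_def field_simps)
  define \<theta> where "\<theta> x = 1 - 3 * (s x * s x) + 2 * (s x * (s x * s x))" for x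
  define \<theta>' where "\<theta>' x = of_real (12 / N) * (s x * s x) + of_real (- 12 / N) * s x" for x
  define \<theta>'' where "\<theta>'' x = of_real (12 / N) * (d x * s x + s x * d x) + of_real (- 12 / N) * d x" for x
  have out: "s x * s x = s x" "d x = 0" if "x \<notin> {N/2..N}" for x
    using that r0[of x] r1[of x] by (auto simp: s_def d_def)
  have ss: "has_ac_derivative_on (\<lambda>x. s x * s x) (\<lambda>x. d x * s x + s x * d x) I" if "is_interval I" for I
    using has_ac_derivative_on_mult[OF sd sd that] .
  have sss: "has_ac_derivative_on (\<lambda>x. s x * (s x * s x)) (\<lambda>x. d x * (s x * s x) + s x * (d x * s x + s x * d x)) I" if "is_interval I" for I
    using has_ac_derivative_on_mult[OF sd ss[OF that] that] .
  show ?thesis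
  proof (rule that)
    fix I :: "real set" assume I: "is_interval I"
    have const: "has_ac_derivative_on (\<lambda>_. 1) (\<lambda>_. 0) I"
      by (auto simp: has_ac_derivative_on_def)
    note l = has_ac_derivative_on_linear[OF const has_ac_derivative_on_linear[OF ss[OF I] sss[OF I], of "-3" 2], of 1 1]
    have "(1 * 0 + 1 * (- 3 * (d x * s x + s x * d x) + 2 * (d x * (s x * s x) + s x * (d x * s x + s x * d x)))) = \<theta>' x" for x
    proof (cases "x \<in> {N/2..N}")
      case True
      then have "d x = of_real (2 / N)" using N by (simp add: d_def field_simps)
      then show ?thesis by (simp add: \<theta>'_def algebra_simps)
    next
      case False
      then show ?thesis using out[OF False] by (simp add: \<theta>'_def)
    qed
    then show "has_ac_derivative_on \<theta> \<theta>' I" using l by (simp add: \<theta>_def[abs_def] algebra_simps)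
    show "has_ac_derivative_on \<theta>' \<theta>'' I"
      unfolding \<theta>'_def[abs_def] \<theta>''_def[abs_def] by (rule has_ac_derivative_on_linear[OF ss[OF I] sd])
  next
    show "\<theta> x = 1" if "x \<le> N / 2" for x using r0[OF that] by (simp add: \<theta>_def s_def)
    show "\<theta> x = 0" if "N \<le> x" for x using r1[OF that] by (simp add: \<theta>_def s_def)
    show "\<theta>' x = 0 \<and> \<theta>'' x = 0" if "x \<notin> {N/2..N}" for x
      using out[OF that] by (simp add: \<theta>'_def \<theta>''_def)
    show "cmod (\<theta>' x) \<le> 3 / N" for x
    proof -
      have "\<theta>' x = of_real (12 / N * (r x * r x - r x))" by (simp add: \<theta>'_def s_def algebra_simps)
      then have "cmod (\<theta>' x) = 12 / N * \<bar>r x * r x - r x\<bar>" using N by (simp only: norm_of_real abs_mult) simp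
      also have "\<bar>r x * r x - r x\<bar> \<le> 1 / 4"
      proof -
        have "r x * r x \<le> r x" using r01[of x] by (simp add: mult_left_le)
        moreover have "0 \<le> (r x - 1 / 2) * (r x - 1 / 2)" by simp
        ultimately show ?thesis by (simp add: algebra_simps)
      qed
      finally show ?thesis using N by (simp add: field_simps)
    qed
    show "cmod (\<theta>'' x) \<le> 24 / N\<^sup>2" for x
    proof -
      have "\<theta>'' x = of_real (12 / N * (2 * r x - 1) * (indicator {N/2..N} x / (N - N / 2)))"
        by (simp add: \<theta>''_def s_def d_def algebra_simps)
      then have "cmod (\<theta>'' x) = 12 / N * \<bar>2 * r x - 1\<bar> * (indicator {N/2..N} x / (N - N / 2))"
        using N by (simp only: norm_of_real abs_mult) (simp add: indicator_def)
      also have "\<dots> \<le> 12 / N * 1 * (1 / (N - N / 2))"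
        using N r01[of x] by (intro mult_mono divide_right_mono) (auto simp: indicator_def)
      finally show ?thesis using N by (simp add: power2_eq_square)
    qed
    have [measurable]: "s \<in> borel_measurable borel" "d \<in> borel_measurable borel"
      unfolding s_def[abs_def] d_def[abs_def] r_def by measurable
    show "\<theta> \<in> borel_measurable borel" unfolding \<theta>_def[abs_def] by measurable
    show "\<theta>' \<in> borel_measurable borel" unfolding \<theta>'_def[abs_def] by measurable
    show "\<theta>'' \<in> borel_measurable borel" unfolding \<theta>''_def[abs_def] by measurable
    show "cnj (\<theta> x) = \<theta> x" for x by (simp add: \<theta>_def s_def)
    show "cmod (\<theta> x) \<le> 6" for x
    proof -
      have "r x * r x \<le> 1" "r x * (r x * r x) \<le> 1" using r01[of x] by (auto intro!: mult_le_one)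
      moreover have "0 \<le> r x * r x" "0 \<le> r x * (r x * r x)" using r01[of x] by auto
      moreover have "\<theta> x = of_real (1 - 3 * (r x * r x) + 2 * (r x * (r x * r x)))" by (simp add: \<theta>_def s_def)
      ultimately show ?thesis by (simp only: norm_of_real)
    qed
  qed
qed

lemma borel_measurable_half_line: "f \<in> borel_measurable borel \<Longrightarrow> f \<in> borel_measurable half_line"
  by (intro measurable_restrict_space1 measurable_completion) simp

lemma L2_of_bounded:
  fixes f :: "real \<Rightarrow> complex"
  assumes f: "f \<in> borel_measurable borel" and bd: "\<And>x. x \<in> {0..N} \<Longrightarrow> cmod (f x) \<le> K"
    and supp: "\<And>x. x > N \<Longrightarrow> f x = 0"
  shows "f \<in> L2"
proof -
  have fm: "f \<in> borel_measurable half_line" using f by (rule borel_measurable_half_line)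
  have "integrable half_line (\<lambda>x. (cmod (f x))\<^sup>2)"
  proof (rule Bochner_Integration.integrable_bound)
    show "integrable half_line (\<lambda>x. K\<^sup>2 * indicator {0..N} x)"
    proof -
      have "integrable lebesgue (\<lambda>x. K\<^sup>2 * indicator {0..N} x)"
        by (intro integrable_mult_right integrable_real_indicator) (auto simp: emeasure_lborel_Icc_eq)
      from integrable_mult_indicator[OF _ this, of "{0<..}"] show ?thesis
        by (subst integrable_restrict_space) auto
    qed
    show "AE x in half_line. norm ((cmod (f x))\<^sup>2) \<le> norm (K\<^sup>2 * indicator {0..N} x)"
    proof (rule AE_I2)
      fix x assume "x \<in> space half_line"
      then have "0 < x" by (simp add: space_restrict_space)
      then show "norm ((cmod (f x))\<^sup>2) \<le> norm (K\<^sup>2 * indicator {0..N} x)"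
        using bd[of x] supp[of x] by (cases "x \<le> N") (auto intro: power_mono)
    qed
  qed (use fm in measurable)
  then show ?thesis using fm by (simp add: L2_def)
qed

lemma integral_lebesgue_on_Icc:
  fixes h :: "real \<Rightarrow> complex"
  assumes "0 < a" and supp: "\<And>x. x \<notin> {a..b} \<Longrightarrow> h x = 0"
  shows "(\<integral>x. h x \<partial>lebesgue_on {a..b}) = (\<integral>x. h x \<partial>half_line)"
proof -
  have "(\<integral>x. h x \<partial>lebesgue_on {a..b}) = (\<integral>x. indicator {a..b} x *\<^sub>R h x \<partial>lebesgue)"
    by (rule integral_restrict_space) auto
  also have "\<dots> = (\<integral>x. indicator {0<..} x *\<^sub>R h x \<partial>lebesgue)"
    using assms by (intro Bochner_Integration.integral_cong) (auto simp: indicator_def)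
  also have "\<dots> = (\<integral>x. h x \<partial>half_line)"
    by (rule integral_restrict_space[symmetric]) auto
  finally show ?thesis .
qed

text \<open>The conjugate is there because \<open>pairing\<close> is conjugate linear on the right:
  pairing \<open>f\<close> with the cut-off vector then gives an integral against the Dirichlet
  solution itself. The cutoff places the vector in \<open>L2\<close>, where the solution need not
  be, and preserves the boundary value at 0. One cutoff serves all \<open>z\<close>, so the test
  vectors depend on the energy only through the solution, which makes joint measurability
  accessible.\<close>

lemma cutoff_solution:
  assumes V: "locally_integrable V" and N: "N > 0"
  obtains \<theta> \<theta>' \<theta>'' :: "real \<Rightarrow> complex"
  where "\<And>x. x \<le> N / 2 \<Longrightarrow> \<theta> x = 1" "\<And>x. cnj (\<theta> x) = \<theta> x"
    and "\<And>x. x \<notin> {N/2..N} \<Longrightarrow> \<theta>' x = 0 \<and> \<theta>'' x = 0"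
    and "\<And>x. cmod (\<theta>' x) \<le> 3 / N" "\<And>x. cmod (\<theta>'' x) \<le> 24 / N\<^sup>2"
    and "\<theta>' \<in> borel_measurable borel" "\<theta>'' \<in> borel_measurable borel"
    and "\<And>z. (\<lambda>x. \<theta> x * cnj (dirichlet_solution V z x)) \<in> L2"
    and "\<And>z. (\<lambda>x. - \<theta>'' x * cnj (dirichlet_solution V z x) - 2 * \<theta>' x * cnj (dirichlet_solution_deriv V z x)) \<in> L2"
    and "\<And>z. dirichlet_operator V (\<lambda>x. \<theta> x * cnj (dirichlet_solution V z x))
      (\<lambda>x. (- \<theta>'' x * cnj (dirichlet_solution V z x) - 2 * \<theta>' x * cnj (dirichlet_solution_deriv V z x))
        + cnj z * (\<theta> x * cnj (dirichlet_solution V z x)))"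
proof -
  obtain \<theta> \<theta>' \<theta>'' :: "real \<Rightarrow> complex" where
    ac: "\<And>I. is_interval I \<Longrightarrow> has_ac_derivative_on \<theta> \<theta>' I" "\<And>I. is_interval I \<Longrightarrow> has_ac_derivative_on \<theta>' \<theta>'' I"
    and one: "\<And>x. x \<le> N / 2 \<Longrightarrow> \<theta> x = 1" and zero: "\<And>x. N \<le> x \<Longrightarrow> \<theta> x = 0"
    and supp: "\<And>x. x \<notin> {N/2..N} \<Longrightarrow> \<theta>' x = 0 \<and> \<theta>'' x = 0"
    and bd: "\<And>x. cmod (\<theta>' x) \<le> 3 / N" "\<And>x. cmod (\<theta>'' x) \<le> 24 / N\<^sup>2"
    and [measurable]: "\<theta> \<in> borel_measurable borel" "\<theta>' \<in> borel_measurable borel" "\<theta>'' \<in> borel_measurable borel"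
    and real: "\<And>x. cnj (\<theta> x) = \<theta> x" and bd0: "\<And>x. cmod (\<theta> x) \<le> 6"
    by (rule smooth_cutoff[OF N]) (rule that)
  show ?thesis
  proof (rule that[of \<theta> \<theta>' \<theta>''])
    fix z
    define u u' where "u = dirichlet_solution V z" and "u' = dirichlet_solution_deriv V z"
    have sol: "solution V z u u'" "u 0 = 0"
      using dirichlet_solution[OF V] by (auto simp: u_def u'_def)
    have [measurable]: "u \<in> borel_measurable borel" "u' \<in> borel_measurable borel"
      using schroedinger_eq_continuous_UNIV[OF sol(1)] by (auto intro: borel_measurable_continuous_onI)
    obtain L where "L > 0" and lip: "\<And>z' w x. \<lbrakk>norm z' \<le> cmod z; norm w \<le> cmod z; x \<in> {0..N}\<rbrakk> \<Longrightarrow>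
        norm (dirichlet_solution V z' x - dirichlet_solution V w x) \<le> L * norm (z' - w) \<and>
        norm (dirichlet_solution_deriv V z' x - dirichlet_solution_deriv V w x) \<le> L * norm (z' - w) \<and>
        norm (dirichlet_solution V z' x) \<le> L \<and> norm (dirichlet_solution_deriv V z' x) \<le> L"
      by (rule dirichlet_solution_lipschitz[OF V less_imp_le[OF N] norm_ge_zero[of z]]) (rule that)
    from lip[of z z] have L: "\<And>x. x \<in> {0..N} \<Longrightarrow> cmod (u x) \<le> L \<and> cmod (u' x) \<le> L"
      by (simp add: u_def u'_def)
    define \<eta> where "\<eta> x = \<theta> x * cnj (u x)" for x
    define k where "k x = - \<theta>'' x * cnj (u x) - 2 * \<theta>' x * cnj (u' x)" for x
    have \<eta>L: "\<eta> \<in> L2"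
    proof (rule L2_of_bounded[of _ N "6 * L"])
      show "\<eta> \<in> borel_measurable borel" unfolding \<eta>_def[abs_def] by measurable
      show "cmod (\<eta> x) \<le> 6 * L" if "x \<in> {0..N}" for x
        using mult_mono[OF bd0[of x], of "cmod (u x)" L] L[OF that] by (simp add: \<eta>_def norm_mult)
      show "\<eta> x = 0" if "x > N" for x using zero[of x] that by (simp add: \<eta>_def)
    qed
    have kL: "k \<in> L2"
    proof (rule L2_of_bounded[of _ N "24 / N\<^sup>2 * L + 2 * (3 / N) * L"])
      show "k \<in> borel_measurable borel" unfolding k_def[abs_def] by measurable
      show "cmod (k x) \<le> 24 / N\<^sup>2 * L + 2 * (3 / N) * L" if "x \<in> {0..N}" for x
      proof -
        have "cmod (k x) \<le> cmod (\<theta>'' x) * cmod (u x) + 2 * cmod (\<theta>' x) * cmod (u' x)"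
          unfolding k_def by (rule order_trans[OF norm_triangle_ineq4]) (simp add: norm_mult)
        also have "\<dots> \<le> 24 / N\<^sup>2 * L + 2 * (3 / N) * L"
          using bd[of x] L[OF that] N by (intro add_mono mult_mono) auto
        finally show ?thesis .
      qed
      show "k x = 0" if "x > N" for x using supp[of x] that N by (simp add: k_def)
    qed
    show "(\<lambda>x. \<theta> x * cnj (dirichlet_solution V z x)) \<in> L2"
      using \<eta>L by (simp add: \<eta>_def[abs_def] u_def)
    show "(\<lambda>x. - \<theta>'' x * cnj (dirichlet_solution V z x) - 2 * \<theta>' x * cnj (dirichlet_solution_deriv V z x)) \<in> L2"
      using kL by (simp add: k_def[abs_def] u_def u'_def)
    have "schroedinger_eq V 0 (\<lambda>x. k x + cnj z * \<eta> x) {0..} \<eta> (\<lambda>x. \<theta>' x * cnj (u x) + \<theta> x * cnj (u' x))"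
    proof -
      have I: "is_interval {0::real..}" by (simp add: is_interval_1)
      note sol' = sol(1)[unfolded schroedinger_eq_def]
      note uac = has_ac_derivative_on_cnj[OF has_ac_derivative_on_subset[OF sol'[THEN conjunct1] subset_UNIV]]
        has_ac_derivative_on_cnj[OF has_ac_derivative_on_subset[OF sol'[THEN conjunct2] subset_UNIV]]
      note l = has_ac_derivative_on_linear[OF has_ac_derivative_on_mult[OF ac(2)[OF I] uac(1) I]
          has_ac_derivative_on_mult[OF ac(1)[OF I] uac(2) I], of 1 1]
      have eq: "1 * (\<theta>'' x * cnj (u x) + \<theta>' x * cnj (u' x)) + 1 * (\<theta>' x * cnj (u' x)
          + \<theta> x * cnj ((complex_of_real (V x) - z) * u x - 0)) = (complex_of_real (V x) - 0) * \<eta> x - (k x + cnj z * \<eta> x)" for x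
        by (simp add: \<eta>_def k_def algebra_simps)
      show ?thesis
        unfolding schroedinger_eq_def
        using has_ac_derivative_on_mult[OF ac(1)[OF I] uac(1) I] l[unfolded eq]
        by (simp add: \<eta>_def[abs_def])
    qed
    moreover have "(\<lambda>x. k x + cnj z * \<eta> x) \<in> L2" using L2_linear[OF kL \<eta>L, of 1 "cnj z"] by simp
    moreover have "\<eta> 0 = 0" using sol(2) by (simp add: \<eta>_def)
    ultimately have "dirichlet_operator V \<eta> (\<lambda>x. k x + cnj z * \<eta> x)"
      using \<eta>L unfolding dirichlet_operator_def by (metis (mono_tags, lifting) AE_I2)
    then show "dirichlet_operator V (\<lambda>x. \<theta> x * cnj (dirichlet_solution V z x))
      (\<lambda>x. (- \<theta>'' x * cnj (dirichlet_solution V z x) - 2 * \<theta>' x * cnj (dirichlet_solution_deriv V z x))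
        + cnj z * (\<theta> x * cnj (dirichlet_solution V z x)))"
      by (simp add: \<eta>_def[abs_def] k_def[abs_def] u_def u'_def)
  qed (use one real supp bd in auto)
qed

section \<open>Mass in the window [N/2, N]\<close>

text \<open>On the bounded support of \<open>f\<close> the solutions are Lipschitz in the energy,
  and \<open>f\<close> is integrable there because |f| \<le> 1 + |f|^2. The lemma keeps the
  transform near its nonzero value at \<open>E\<^sub>0\<close> and makes it measurable in the
  energy.\<close>

lemma dirichlet_transform_lipschitz:
  assumes V: "locally_integrable V" and f: "f \<in> L2" and R: "0 \<le> R"
    and supp: "AE x in half_line. R < x \<longrightarrow> f x = 0" and B: "0 \<le> B"
  obtains L where "L > 0" and "\<And>z w. \<lbrakk>cmod z \<le> B; cmod w \<le> B\<rbrakk> \<Longrightarrow>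
    cmod ((\<integral>x. f x * dirichlet_solution V z x \<partial>half_line) - (\<integral>x. f x * dirichlet_solution V w x \<partial>half_line))
      \<le> L * cmod (z - w)"
proof -
  obtain L where L: "L > 0" and lip: "\<And>(z :: complex) (w :: complex) x. \<lbrakk>norm z \<le> B; norm w \<le> B; x \<in> {0..R}\<rbrakk> \<Longrightarrow>
      norm (dirichlet_solution V z x - dirichlet_solution V w x) \<le> L * norm (z - w) \<and>
      norm (dirichlet_solution_deriv V z x - dirichlet_solution_deriv V w x) \<le> L * norm (z - w) \<and>
      norm (dirichlet_solution V z x) \<le> L \<and> norm (dirichlet_solution_deriv V z x) \<le> L"
    by (rule dirichlet_solution_lipschitz[OF V R B]) (rule that)
  have fm[measurable]: "f \<in> borel_measurable half_line" using L2D[OF f] by simp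
  have um[measurable]: "dirichlet_solution V z \<in> borel_measurable half_line" for z
    using schroedinger_eq_continuous_UNIV(1)[OF dirichlet_solution(1)[OF V]]
    by (intro borel_measurable_half_line borel_measurable_continuous_onI)
  have fi: "integrable half_line f"
  proof (rule Bochner_Integration.integrable_bound)
    show "integrable half_line (\<lambda>x. indicator {0..R} x + (cmod (f x))\<^sup>2)"
    proof (rule Bochner_Integration.integrable_add)
      have "integrable lebesgue (\<lambda>x. indicator {0..R} x :: real)"
        by (intro integrable_real_indicator) (auto simp: emeasure_lborel_Icc_eq)
      from integrable_mult_indicator[OF _ this, of "{0<..}"]
      show "integrable half_line (\<lambda>x. indicator {0..R} x :: real)"
        by (subst integrable_restrict_space) auto
    qed (rule L2D(2)[OF f])
    from AE_half_line_pos show "AE x in half_line. norm (f x) \<le> norm (indicator {0..R} x + (cmod (f x))\<^sup>2)"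
      using supp
    proof eventually_elim
      case (elim x)
      show ?case using elim le_one_plus_square[of "cmod (f x)"] by (cases "x \<le> R") auto
    qed
  qed (rule fm)
  have pt: "AE x in half_line. cmod (f x * dirichlet_solution V z x - f x * dirichlet_solution V w x)
      \<le> L * cmod (z - w) * cmod (f x)" if "cmod z \<le> B" "cmod w \<le> B" for z w
  proof -
    from AE_half_line_pos show ?thesis using supp
    proof eventually_elim
      case (elim x)
      show ?case
      proof (cases "x \<le> R")
        case True
        then have "cmod (dirichlet_solution V z x - dirichlet_solution V w x) \<le> L * cmod (z - w)"
          using lip[OF that, of x] elim by simp
        from mult_right_mono[OF this, of "cmod (f x)"] show ?thesis
          unfolding right_diff_distrib[symmetric] norm_mult by (simp add: mult.commute)
      next
        case False
        then show ?thesis using elim by simp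
      qed
    qed
  qed
  have ui: "integrable half_line (\<lambda>x. f x * dirichlet_solution V z x)" if "cmod z \<le> B" for z
  proof (rule Bochner_Integration.integrable_bound)
    show "integrable half_line (\<lambda>x. L * cmod (f x))" using fi by auto
    from AE_half_line_pos show "AE x in half_line. norm (f x * dirichlet_solution V z x) \<le> norm (L * cmod (f x))"
      using supp
    proof eventually_elim
      case (elim x)
      show ?case
      proof (cases "x \<le> R")
        case True
        then have "cmod (dirichlet_solution V z x) \<le> L" using lip[OF that that, of x] elim by simp
        from mult_right_mono[OF this, of "cmod (f x)"] show ?thesis
          using L by (simp add: norm_mult mult.commute)
      next
        case False
        then show ?thesis using elim by simp
      qed
    qed
  qed measurable
  define L' where "L' = L * (\<integral>x. cmod (f x) \<partial>half_line) + 1"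
  show ?thesis
  proof (rule that[of L'])
    have "0 \<le> (\<integral>x. cmod (f x) \<partial>half_line)" by (intro Bochner_Integration.integral_nonneg) simp
    then show "L' > 0" using L by (simp add: L'_def add_nonneg_pos)
    fix z w assume zw: "cmod z \<le> B" "cmod w \<le> B"
    have "cmod ((\<integral>x. f x * dirichlet_solution V z x \<partial>half_line) - (\<integral>x. f x * dirichlet_solution V w x \<partial>half_line))
        = cmod (\<integral>x. f x * dirichlet_solution V z x - f x * dirichlet_solution V w x \<partial>half_line)"
      using ui zw by simp
    also have "\<dots> \<le> (\<integral>x. cmod (f x * dirichlet_solution V z x - f x * dirichlet_solution V w x) \<partial>half_line)"
      by (rule integral_norm_bound)
    also have "\<dots> \<le> (\<integral>x. L * cmod (z - w) * cmod (f x) \<partial>half_line)"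
      using fi ui zw by (intro integral_mono_AE pt zw) auto
    also have "\<dots> = L * (\<integral>x. cmod (f x) \<partial>half_line) * cmod (z - w)" by simp
    also have "\<dots> \<le> L' * cmod (z - w)" by (intro mult_right_mono) (auto simp: L'_def)
    finally show "cmod ((\<integral>x. f x * dirichlet_solution V z x \<partial>half_line) - (\<integral>x. f x * dirichlet_solution V w x \<partial>half_line))
      \<le> L' * cmod (z - w)" .
  qed
qed

text \<open>In the application \<open>\<tau>\<close> is 2 / T, \<open>D\<close> is of order N powr
  \<alpha>, and \<open>c0\<close> is the transform of \<open>f\<close> at \<open>E\<^sub>0\<close>.
  The test vectors are bounded by 30 D / N, namely 24 / N^2 \<le> 24 / N from the second derivative
  of the cutoff and 2 * 3 / N from the first. On a window of length N / 2 this gives the Plancherel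
  constant Q = 900 \<pi> D^2 |B| / N, while |J| \<ge> |B| |c0| / 2; the claim is J^2 / Q.\<close>

lemma tail_lower_bound:
  assumes V: "locally_integrable V" and U: "evolution_of (dirichlet_operator V) U"
    and f: "f \<in> L2" and supp: "AE x in half_line. R < x \<longrightarrow> f x = 0"
    and N: "1 \<le> N" "2 * R \<le> N" and \<tau>: "0 < \<tau>"
    and B: "B \<in> sets borel" "emeasure lborel B < \<infinity>" "bounded B"
    and D: "\<And>E x. \<lbrakk>E \<in> B; x \<in> {0..N}\<rbrakk> \<Longrightarrow> cmod (dirichlet_solution V (Complex E \<tau>) x) \<le> D \<and>
      cmod (dirichlet_solution_deriv V (Complex E \<tau>) x) \<le> D" and D0: "D > 0"
    and c0: "\<And>E. E \<in> B \<Longrightarrow> cmod ((\<integral>x. f x * dirichlet_solution V (Complex E \<tau>) x \<partial>half_line) - c0) \<le> cmod c0 / 2"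
  shows "ennreal ((cmod c0)\<^sup>2 * N * measure lborel B / (3600 * pi * D\<^sup>2))
    \<le> (\<integral>\<^sup>+t\<in>{0..}. ennreal (exp (- \<tau> * t)) * (\<integral>\<^sup>+x. ennreal ((cmod (U t f x))\<^sup>2) \<partial>lebesgue_on {N/2..N}) \<partial>lebesgue)"
\<comment> \<open>The constant \<open>Q\<close> below has to be positive, so the trivial case of
  measure 0 is split off.\<close>
proof (cases "measure lborel B = 0")
  case True
  then show ?thesis by simp
next
  case False
  then have mB: "0 < measure lborel B" by (simp add: zero_less_measure_iff)
  have N0: "0 < N" using N by simp
  have ug: "unitary_group U" using U by (simp add: evolution_of_def)
  define M where "M = lebesgue_on {N/2..N}"
  interpret finite_measure M unfolding M_def by (rule finite_measure_lebesgue_on) simp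
  have spM: "space M = {N/2..N}" by (simp add: M_def space_restrict_space)
  have measM: "measure M (space M) = N / 2"
    using N0 by (simp add: M_def measure_restrict_space space_restrict_space)
  obtain \<theta> \<theta>' \<theta>'' :: "real \<Rightarrow> complex"
    where one: "\<And>x. x \<le> N / 2 \<Longrightarrow> \<theta> x = 1" and real: "\<And>x. cnj (\<theta> x) = \<theta> x"
    and out: "\<And>x. x \<notin> {N/2..N} \<Longrightarrow> \<theta>' x = 0 \<and> \<theta>'' x = 0"
    and bd: "\<And>x. cmod (\<theta>' x) \<le> 3 / N" "\<And>x. cmod (\<theta>'' x) \<le> 24 / N\<^sup>2"
    and [measurable]: "\<theta>' \<in> borel_measurable borel" "\<theta>'' \<in> borel_measurable borel"
    and \<eta>L: "\<And>z. (\<lambda>x. \<theta> x * cnj (dirichlet_solution V z x)) \<in> L2"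
    and kL: "\<And>z. (\<lambda>x. - \<theta>'' x * cnj (dirichlet_solution V z x) - 2 * \<theta>' x * cnj (dirichlet_solution_deriv V z x)) \<in> L2"
    and H: "\<And>z. dirichlet_operator V (\<lambda>x. \<theta> x * cnj (dirichlet_solution V z x))
      (\<lambda>x. (- \<theta>'' x * cnj (dirichlet_solution V z x) - 2 * \<theta>' x * cnj (dirichlet_solution_deriv V z x))
        + cnj z * (\<theta> x * cnj (dirichlet_solution V z x)))"
    by (rule cutoff_solution[OF V N0]) (rule that)
  define u where "u E = dirichlet_solution V (Complex E \<tau>)" for E
  define u' where "u' E = dirichlet_solution_deriv V (Complex E \<tau>)" for E
  define \<eta> where "\<eta> E x = \<theta> x * cnj (u E x)" for E x
  define k0 where "k0 E x = - \<theta>'' x * cnj (u E x) - 2 * \<theta>' x * cnj (u' E x)" for E x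
  define k where "k E x = indicator B E * k0 E x" for E x
  define c where "c E = (\<integral>x. f x * u E x \<partial>half_line)" for E
  have \<eta>L: "\<eta> E \<in> L2" and k0L: "k0 E \<in> L2" for E
    using \<eta>L[of "Complex E \<tau>"] kL[of "Complex E \<tau>"] by (simp_all add: \<eta>_def[abs_def] k0_def[abs_def] u_def u'_def)
  have kL: "k E \<in> L2" for E
    unfolding k_def using L2_linear[OF k0L[of E] k0L[of E], of "indicator B E" 0] by simp
  have \<psi>L: "(\<lambda>x. k0 E x + cnj (Complex E \<tau>) * \<eta> E x) \<in> L2" for E
    using L2_linear[OF k0L \<eta>L, of 1 E "cnj (Complex E \<tau>)" E] by simp
  have H: "dirichlet_operator V (\<eta> E) (\<lambda>x. k0 E x + cnj (Complex E \<tau>) * \<eta> E x)" for E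
    using H[of "Complex E \<tau>"] by (simp add: \<eta>_def[abs_def] k0_def[abs_def] u_def u'_def)
  have cm: "Complex E \<tau> - Complex E' \<tau> = of_real (E - E')" for E E' by (simp add: complex_eq_iff)
  have near: "\<forall>\<^sub>F F in at E. \<bar>F - E\<bar> < 1" for E :: real
    using eventually_at_ball[of 1 E UNIV] by (auto elim!: eventually_mono simp: dist_real_def abs_minus_commute)
  have nb: "cmod (Complex F \<tau>) \<le> \<bar>E\<bar> + 1 + \<tau>" if "\<bar>F - E\<bar> < 1" for E F
    using cmod_le[of "Complex F \<tau>"] that \<tau> by auto
  have contE: "continuous_on UNIV (\<lambda>E. u E x) \<and> continuous_on UNIV (\<lambda>E. u' E x)" if x0: "0 \<le> x" for x
  proof -
    have "isCont (\<lambda>E. u E x) E \<and> isCont (\<lambda>E. u' E x) E" for E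
    proof -
      obtain L where "L > 0" and lip: "\<And>(z :: complex) (w :: complex) y. \<lbrakk>norm z \<le> \<bar>E\<bar> + 1 + \<tau>; norm w \<le> \<bar>E\<bar> + 1 + \<tau>; y \<in> {0..x}\<rbrakk> \<Longrightarrow>
        norm (dirichlet_solution V z y - dirichlet_solution V w y) \<le> L * norm (z - w) \<and>
        norm (dirichlet_solution_deriv V z y - dirichlet_solution_deriv V w y) \<le> L * norm (z - w) \<and>
        norm (dirichlet_solution V z y) \<le> L \<and> norm (dirichlet_solution_deriv V z y) \<le> L"
        by (rule dirichlet_solution_lipschitz[OF V x0, of "\<bar>E\<bar> + 1 + \<tau>"]) (use \<tau> in simp, rule that)
      note ev = near[of E]
      have le: "norm (u F x - u E x) \<le> L * \<bar>F - E\<bar>" "norm (u' F x - u' E x) \<le> L * \<bar>F - E\<bar>" if "\<bar>F - E\<bar> < 1" for F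
        using lip[OF nb[OF that] nb[of E], of x] x0 unfolding cm norm_of_real u_def u'_def by auto
      have z: "((\<lambda>F. L * \<bar>F - E\<bar>) \<longlongrightarrow> 0) (at E)"
        by (auto intro!: tendsto_eq_intros)
      have "((\<lambda>F. u F x) \<longlongrightarrow> u E x) (at E)"
        by (rule LIM_zero_cancel, rule Lim_null_comparison[OF _ z]) (rule eventually_mono[OF ev], rule le(1))
      moreover have "((\<lambda>F. u' F x) \<longlongrightarrow> u' E x) (at E)"
        by (rule LIM_zero_cancel, rule Lim_null_comparison[OF _ z]) (rule eventually_mono[OF ev], rule le(2))
      ultimately show ?thesis by (simp add: isCont_def)
    qed
    then show ?thesis by (simp add: continuous_on_eq_continuous_at)
  qed
  have borM: "h \<in> borel_measurable M" if "h \<in> borel_measurable borel" for h :: "real \<Rightarrow> complex"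
    unfolding M_def by (intro measurable_restrict_space1 measurable_completion) (use that in simp)
  have um: "u E \<in> borel_measurable borel" "u' E \<in> borel_measurable borel" for E
    using schroedinger_eq_continuous_UNIV[OF dirichlet_solution(1)[OF V]]
    by (auto simp: u_def u'_def intro: borel_measurable_continuous_onI)
  have [measurable]: "(\<lambda>q. u (fst q) (snd q)) \<in> borel_measurable (borel \<Otimes>\<^sub>M M)"
    "(\<lambda>q. u' (fst q) (snd q)) \<in> borel_measurable (borel \<Otimes>\<^sub>M M)"
  proof -
    show "(\<lambda>q. u (fst q) (snd q)) \<in> borel_measurable (borel \<Otimes>\<^sub>M M)"
      by (rule caratheodory_measurable[OF borM[OF um(1)]]) (use contE N0 in \<open>simp add: spM\<close>)
    show "(\<lambda>q. u' (fst q) (snd q)) \<in> borel_measurable (borel \<Otimes>\<^sub>M M)"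
      by (rule caratheodory_measurable[OF borM[OF um(2)]]) (use contE N0 in \<open>simp add: spM\<close>)
  qed
  have [measurable]: "\<theta>' \<in> borel_measurable M" "\<theta>'' \<in> borel_measurable M" by (auto intro: borM)
  have [measurable]: "B \<in> sets borel" by (fact B)
  have km: "(\<lambda>q. k (fst q) (snd q)) \<in> borel_measurable (borel \<Otimes>\<^sub>M M)"
    unfolding k_def k0_def by measurable
  have kb: "cmod (k E x) \<le> 30 * D / N * indicator B E" if "x \<in> space M" for E x
  proof (cases "E \<in> B")
    case True
    have x: "x \<in> {0..N}" using that N0 by (auto simp: spM)
    have uD: "cmod (u E x) \<le> D" "cmod (u' E x) \<le> D" using D[OF True x] by (auto simp: u_def u'_def)
    have "cmod (k E x) \<le> cmod (\<theta>'' x) * cmod (u E x) + 2 * cmod (\<theta>' x) * cmod (u' E x)"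
      unfolding k_def k0_def using True by (simp, intro order_trans[OF norm_triangle_ineq4]) (simp add: norm_mult)
    also have "\<dots> \<le> 24 / N\<^sup>2 * D + 2 * (3 / N) * D"
      using bd[of x] uD N0 by (intro add_mono mult_mono) auto
    also have "24 / N\<^sup>2 \<le> 24 / N" using N by (simp add: power2_eq_square field_simps)
    finally show ?thesis using True D0 by (simp add: field_simps)
  qed (simp add: k_def)
  have Uf: "U t f \<in> L2" for t using unitary_L2[OF ug f] .
  have rest: "h \<in> borel_measurable M" if "h \<in> borel_measurable half_line" for h :: "real \<Rightarrow> complex"
  proof -
    have "h \<in> borel_measurable (restrict_space half_line {N/2..N})" using that by (rule measurable_restrict_space1)
    moreover have "restrict_space half_line {N/2..N} = M"
      using N0 by (subst restrict_restrict_space) (auto simp: M_def intro!: arg_cong[where f = "restrict_space lebesgue"])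
    ultimately show ?thesis by simp
  qed
  have gm: "U t f \<in> borel_measurable M" for t using rest L2D(1)[OF Uf] .
  have nnle: "(\<integral>\<^sup>+x. h x \<partial>M) \<le> (\<integral>\<^sup>+x. h x \<partial>half_line)" for h
    using N0 by (auto simp: M_def nn_integral_restrict_space indicator_def intro!: nn_integral_mono)
  have gnn: "(\<integral>\<^sup>+x. ennreal ((cmod (U t f x))\<^sup>2) \<partial>M) \<le> ennreal ((L2_norm f)\<^sup>2)" for t
  proof -
    have "(\<integral>\<^sup>+x. ennreal ((cmod (U t f x))\<^sup>2) \<partial>half_line) = ennreal (\<integral>x. (cmod (U t f x))\<^sup>2 \<partial>half_line)"
      using L2D(2)[OF Uf] by (intro nn_integral_eq_integral) auto
    also have "(\<integral>x. (cmod (U t f x))\<^sup>2 \<partial>half_line) = (L2_norm (U t f))\<^sup>2"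
      unfolding L2_norm_def by (subst real_sqrt_pow2) (auto intro: Bochner_Integration.integral_nonneg)
    finally show ?thesis using nnle[of "\<lambda>x. ennreal ((cmod (U t f x))\<^sup>2)"] unitary_norm[OF ug f] by simp
  qed
  have g2: "integrable M (\<lambda>x. (cmod (U t f x))\<^sup>2)" for t
  proof (rule integrableI_nonneg)
    show "(\<integral>\<^sup>+x. ennreal ((cmod (U t f x))\<^sup>2) \<partial>M) < \<infinity>"
      using le_less_trans[OF gnn[of t] ennreal_less_top] by simp
    note [measurable] = gm[of t]
    show "(\<lambda>x. (cmod (U t f x))\<^sup>2) \<in> borel_measurable M" by measurable
  qed simp
  have gb: "(\<integral>x. (cmod (U t f x))\<^sup>2 \<partial>M) \<le> (L2_norm f)\<^sup>2" for t
    using gnn[of t] nn_integral_eq_integral[OF g2[of t]] by (simp add: ennreal_le_iff)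
  have pk: "(\<integral>x. U t f x * cnj (k E x) \<partial>M) = pairing (U t f) (k E)" for E t
    unfolding pairing_def M_def by (rule integral_lebesgue_on_Icc) (use N0 out in \<open>auto simp: k_def k0_def\<close>)
  have cont: "continuous_on UNIV (\<lambda>t. \<integral>x. U t f x * cnj (k E x) \<partial>M)" for E
    unfolding pk by (rule pairing_unitary_continuous[OF ug f kL])
  \<comment> \<open>The hypothesis \<open>2 * R \<le> N\<close> places the support of
    \<open>f\<close> where the cutoff equals 1.\<close>
  have f\<eta>: "pairing f (\<eta> E) = c E" for E
  proof -
    have [measurable]: "f \<in> borel_measurable half_line" "\<eta> E \<in> borel_measurable half_line" "u E \<in> borel_measurable half_line"
      using L2D(1)[OF f] L2D(1)[OF \<eta>L] um borel_measurable_half_line by auto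
    show ?thesis
      unfolding pairing_def c_def
    proof (rule integral_cong_AE)
      show "AE x in half_line. f x * cnj (\<eta> E x) = f x * u E x"
        using supp
      proof eventually_elim
        case (elim x)
        then show ?case using one[of x] N by (cases "x \<le> R") (auto simp: \<eta>_def)
      qed
    qed measurable
  qed
  have lap: "(\<integral>t. indicator {0<..} t *\<^sub>R (of_real (exp (- \<tau> * t)) * cis (E * t) * (\<integral>x. U t f x * cnj (k E x) \<partial>M)) \<partial>lborel)
      = indicator B E * (- \<i> * c E)" for E
  proof (cases "E \<in> B")
    case True
    have gen: "((\<lambda>t. L2_norm (\<lambda>x. (U t (\<eta> E) x - \<eta> E x) / complex_of_real t - (- \<i> * (k0 E x + cnj (Complex E \<tau>) * \<eta> E x)))) \<longlongrightarrow> 0) (at 0)"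
      by (rule iffD1[OF bspec[OF bspec[OF U[unfolded evolution_of_def, THEN conjunct2] \<eta>L[of E]] \<psi>L[of E]] H[of E]])
    have "(LINT t:{0<..}|lborel. exp (\<i> * Complex E \<tau> * of_real t) * pairing (U t f) (\<lambda>x. k0 E x + cnj (Complex E \<tau>) * \<eta> E x - cnj (Complex E \<tau>) * \<eta> E x)) = - \<i> * pairing f (\<eta> E)"
      by (rule laplace_transform_pairing[OF ug f \<eta>L \<psi>L gen]) (simp add: \<tau>)
    moreover have "exp (\<i> * Complex E \<tau> * of_real t) = of_real (exp (- \<tau> * t)) * cis (E * t)" for t
      by (simp add: exp_eq_polar)
    moreover have "k E = (\<lambda>x. k0 E x)" using True by (simp add: k_def fun_eq_iff)
    ultimately show ?thesis using True unfolding pk f\<eta> set_lebesgue_integral_def by simp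
  next
    case False
    then show ?thesis by (simp add: k_def)
  qed
  define Q where "Q = 900 * pi * D\<^sup>2 * measure lborel B / N"
  have Q0: "0 < Q" using mB D0 N0 by (simp add: Q_def)
  have Qle: "2 * pi * (30 * D / N)\<^sup>2 * measure lborel B * measure M (space M) \<le> Q"
    unfolding measM Q_def using N0 by (simp add: power2_eq_square field_simps)
  have \<kappa>0: "0 \<le> 30 * D / N" using D0 N0 by simp
  note main = frequency_dependent_lower_bound[OF \<tau> B(1,2) \<kappa>0 km kb gm g2 gb cont Qle Q0, unfolded lap]
  have ci: "integrable lborel (\<lambda>E. indicator B E *\<^sub>R (c E - c0))"
  proof (rule Bochner_Integration.integrable_bound)
    show "integrable lborel (\<lambda>E. cmod c0 / 2 * indicator B E)"
      using B by (auto intro!: integrable_mult_right integrable_real_indicator)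
    show "AE E in lborel. norm (indicator B E *\<^sub>R (c E - c0)) \<le> norm (cmod c0 / 2 * indicator B E)"
      using c0 by (auto simp: indicator_def c_def u_def)
    have "isCont c E" for E
    proof -
      have supp': "AE x in half_line. max R 0 < x \<longrightarrow> f x = 0" using supp by auto
      obtain L where "L > 0" and lip: "\<And>z w. \<lbrakk>cmod z \<le> \<bar>E\<bar> + 1 + \<tau>; cmod w \<le> \<bar>E\<bar> + 1 + \<tau>\<rbrakk> \<Longrightarrow>
          cmod ((\<integral>x. f x * dirichlet_solution V z x \<partial>half_line) - (\<integral>x. f x * dirichlet_solution V w x \<partial>half_line))
            \<le> L * cmod (z - w)"
        by (rule dirichlet_transform_lipschitz[OF V f _ supp', of "\<bar>E\<bar> + 1 + \<tau>"])
          (use \<tau> in simp, use \<tau> in simp, rule that)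
      have "((\<lambda>F. c F) \<longlongrightarrow> c E) (at E)"
      proof (rule LIM_zero_cancel, rule Lim_null_comparison)
        show "\<forall>\<^sub>F F in at E. norm (c F - c E) \<le> L * \<bar>F - E\<bar>"
          using near[of E]
        proof eventually_elim
          case (elim F)
          show ?case
            using lip[OF nb[OF elim] nb[of E]] unfolding cm norm_of_real c_def u_def by simp
        qed
        show "((\<lambda>F. L * \<bar>F - E\<bar>) \<longlongrightarrow> 0) (at E)" by (auto intro!: tendsto_eq_intros)
      qed
      then show ?thesis by (simp add: isCont_def)
    qed
    then have "continuous_on UNIV c" by (simp add: continuous_on_eq_continuous_at)
    then have [measurable]: "c \<in> borel_measurable borel" by (rule borel_measurable_continuous_onI)
    show "(\<lambda>E. indicator B E *\<^sub>R (c E - c0)) \<in> borel_measurable lborel" by measurable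
  qed
  have Bi: "integrable lborel (\<lambda>E. indicator B E *\<^sub>R c0)"
    using B by (intro integrable_scaleR_left integrable_real_indicator) auto
  \<comment> \<open>On \<open>B\<close> the transform \<open>c E\<close> stays within half of |c0|
    from the fixed number \<open>c0\<close>; hence nothing cancels in the integral over
    \<open>B\<close>, and at least half of |B| |c0| remains.\<close>
  have "(\<integral>E. indicator B E * (- \<i> * c E) \<partial>lborel) = (\<integral>E. - \<i> * (indicator B E *\<^sub>R c0 + indicator B E *\<^sub>R (c E - c0)) \<partial>lborel)"
    by (intro Bochner_Integration.integral_cong) (auto simp: indicator_def)
  also have "\<dots> = - \<i> * ((\<integral>E. indicator B E *\<^sub>R c0 \<partial>lborel) + (\<integral>E. indicator B E *\<^sub>R (c E - c0) \<partial>lborel))"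
    using Bochner_Integration.integral_add[OF Bi ci] by (simp only: integral_mult_right_zero)
  also have "(\<integral>E. indicator B E *\<^sub>R c0 \<partial>lborel) = measure lborel B *\<^sub>R c0"
    using B by (subst integral_scaleR_left) (auto intro!: integrable_real_indicator)
  finally have J: "cmod (\<integral>E. indicator B E * (- \<i> * c E) \<partial>lborel)
      = cmod (measure lborel B *\<^sub>R c0 + (\<integral>E. indicator B E *\<^sub>R (c E - c0) \<partial>lborel))"
    by (simp add: norm_mult)
  have "cmod (\<integral>E. indicator B E *\<^sub>R (c E - c0) \<partial>lborel) \<le> (\<integral>E. cmod c0 / 2 * indicator B E \<partial>lborel)"
  proof (rule norm_integral_le[OF ci])
    show "integrable lborel (\<lambda>E. cmod c0 / 2 * indicator B E)"
      using B by (auto intro!: integrable_mult_right integrable_real_indicator)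
  qed (use c0 in \<open>auto simp: indicator_def c_def u_def\<close>)
  also have "\<dots> = cmod c0 / 2 * measure lborel B" using B by simp
  finally have "measure lborel B * cmod c0 / 2 \<le> cmod (\<integral>E. indicator B E * (- \<i> * c E) \<partial>lborel)"
    unfolding J using norm_diff_ineq[of "measure lborel B *\<^sub>R c0" "\<integral>E. indicator B E *\<^sub>R (c E - c0) \<partial>lborel"] mB by (simp add: mult.commute)
  then have "(measure lborel B * cmod c0 / 2)\<^sup>2 / Q \<le> (cmod (\<integral>E. indicator B E * (- \<i> * c E) \<partial>lborel))\<^sup>2 / Q"
    using Q0 mB by (intro divide_right_mono power_mono) auto
  also have "(measure lborel B * cmod c0 / 2)\<^sup>2 / Q = (cmod c0)\<^sup>2 * N * measure lborel B / (3600 * pi * D\<^sup>2)"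
    using mB N0 D0 by (simp add: Q_def power2_eq_square field_simps)
  finally show ?thesis using main unfolding M_def by (meson ennreal_leI order_trans)
qed

section \<open>From mass to moments\<close>

text \<open>For measurable \<open>g\<close> this is an equality. The inequality covers integrands
  whose measurability, in \<open>t\<close> or in \<open>x\<close>, has not been established:
  multiplying a simple function below \<open>g\<close> by \<open>c\<close> leaves it a simple
  function below \<open>c * g\<close>.\<close>

lemma nn_integral_cmult_ge:
  fixes c :: ennreal
  shows "c * (\<integral>\<^sup>+x. g x \<partial>M) \<le> (\<integral>\<^sup>+x. c * g x \<partial>M)"
proof -
  have "c * (\<integral>\<^sup>+x. g x \<partial>M) = (SUP s\<in>{s. simple_function M s \<and> s \<le> g}. c * integral\<^sup>S M s)"
    unfolding nn_integral_def by (rule SUP_mult_left_ennreal)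
  also have "\<dots> \<le> (\<integral>\<^sup>+x. c * g x \<partial>M)"
  proof (rule SUP_least)
    fix s assume "s \<in> {s. simple_function M s \<and> s \<le> g}"
    then have s: "simple_function M s" "s \<le> g" by auto
    have "c * integral\<^sup>S M s = (\<integral>\<^sup>+x. c * s x \<partial>M)"
      using s(1) by (simp add: nn_integral_eq_simple_integral[symmetric] nn_integral_cmult borel_measurable_simple_function)
    also have "\<dots> \<le> (\<integral>\<^sup>+x. c * g x \<partial>M)"
      using s(2) by (intro nn_integral_mono mult_left_mono) (auto simp: le_fun_def)
    finally show "c * integral\<^sup>S M s \<le> (\<integral>\<^sup>+x. c * g x \<partial>M)" .
  qed
  finally show ?thesis .
qed

lemma position_norm2_ge:
  assumes a: "0 < a" and p: "0 < p"
  shows "ennreal (a powr p) * (\<integral>\<^sup>+x. ennreal ((cmod (\<phi> x))\<^sup>2) \<partial>lebesgue_on {a..b}) \<le> position_norm2 (p / 2) \<phi>"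
proof -
  have "ennreal (a powr p) * (\<integral>\<^sup>+x. ennreal ((cmod (\<phi> x))\<^sup>2) \<partial>lebesgue_on {a..b})
      \<le> (\<integral>\<^sup>+x. ennreal (a powr p) * ennreal ((cmod (\<phi> x))\<^sup>2) \<partial>lebesgue_on {a..b})"
    by (rule nn_integral_cmult_ge)
  also have "\<dots> = (\<integral>\<^sup>+x. ennreal (a powr p) * ennreal ((cmod (\<phi> x))\<^sup>2) * indicator {a..b} x \<partial>lebesgue)"
    by (subst nn_integral_restrict_space) auto
  also have "\<dots> \<le> (\<integral>\<^sup>+x. ennreal ((cmod (complex_of_real (\<bar>x\<bar> powr (p / 2)) * \<phi> x))\<^sup>2) * indicator {0<..} x \<partial>lebesgue)"
  proof (rule nn_integral_mono)
    fix x
    show "ennreal (a powr p) * ennreal ((cmod (\<phi> x))\<^sup>2) * indicator {a..b} x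
        \<le> ennreal ((cmod (complex_of_real (\<bar>x\<bar> powr (p / 2)) * \<phi> x))\<^sup>2) * indicator {0<..} x"
    proof (cases "x \<in> {a..b}")
      case True
      then have x: "a \<le> x" "0 < x" using a by auto
      have "a powr p \<le> x powr p" using x a p by (intro powr_mono2) auto
      also have "x powr p = (x powr (p / 2))\<^sup>2" using x by (simp add: power2_eq_square powr_add[symmetric])
      finally have "a powr p * (cmod (\<phi> x))\<^sup>2 \<le> (x powr (p / 2))\<^sup>2 * (cmod (\<phi> x))\<^sup>2"
        by (rule mult_right_mono) simp
      then show ?thesis
        using True x by (simp add: ennreal_mult[symmetric] norm_mult power_mult_distrib ennreal_leI)
    qed simp
  qed
  also have "\<dots> = position_norm2 (p / 2) \<phi>"
    unfolding position_norm2_def by (subst nn_integral_restrict_space) auto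
  finally show ?thesis .
qed

text \<open>The sets \<open>A N\<close> are arbitrary; openness is what makes their neighborhoods
  Borel sets.\<close>

lemma neighborhood_open: "open (neighborhood r S)"
proof -
  have "neighborhood r S = (\<Union>a\<in>S. ball a r)" by (auto simp: neighborhood_def ball_def dist_commute)
  then show ?thesis by (simp only:) (intro open_UN ballI open_ball)
qed

theorem theorem1:
  fixes V :: "real \<Rightarrow> real"
    and U :: "real \<Rightarrow> (real \<Rightarrow> complex) \<Rightarrow> (real \<Rightarrow> complex)"
    and E\<^sub>0 \<alpha> C p :: real
    and A :: "real \<Rightarrow> real set"
    and f :: "real \<Rightarrow> complex"
  assumes "unif_loc_L1 V"
    and "evolution_of (dirichlet_operator V) U"
    and "C > 0" and "\<alpha> > 0"
    and "\<forall>\<^sub>F N in at_top. E\<^sub>0 \<in> power_bounded_energies V \<alpha> C N"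
    and "\<forall>\<^sub>F N in at_top. A N \<subseteq> power_bounded_energies V \<alpha> C N \<and> E\<^sub>0 \<in> A N"
    and "\<forall>\<^sub>F N in at_top. bounded (A N)"
    and "((\<lambda>N. diameter (A N)) \<longlongrightarrow> 0) at_top"
    and "p > 0"
    and "f \<in> L2" and "compactly_supported f"
    and "pairing (dirichlet_solution V (complex_of_real E\<^sub>0)) f \<noteq> 0"
  shows "\<exists>C'>0. \<forall>\<^sub>F T in at_top.
    averaged_moment U f T p \<ge>
      ennreal C' * emeasure lebesgue (neighborhood (1 / T) (A (T powr (1 / (1 + \<alpha>)))))
        * ennreal (T powr ((p - 3 * \<alpha>) / (1 + \<alpha>)))"
proof -
  have V: "locally_integrable V" using assms(1) by (rule unif_loc_L1_imp_locally_integrable)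
  obtain R where supp: "AE x in half_line. R < x \<longrightarrow> f x = 0"
    using assms(11) unfolding compactly_supported_def by blast
  have supp': "AE x in half_line. max R 0 < x \<longrightarrow> f x = 0" using supp by auto
  define c where "c z = (\<integral>x. f x * dirichlet_solution V z x \<partial>half_line)" for z
  define c0 where "c0 = c (complex_of_real E\<^sub>0)"
  have "pairing f (dirichlet_solution V (complex_of_real E\<^sub>0)) = c0"
    unfolding pairing_def c0_def c_def by (simp add: dirichlet_solution_real[OF V])
  then have c0: "c0 \<noteq> 0" using assms(12) pairing_cnj[of "dirichlet_solution V (complex_of_real E\<^sub>0)" f] by auto
  obtain L where L: "L > 0" and lip: "\<And>z w. \<lbrakk>cmod z \<le> \<bar>E\<^sub>0\<bar> + 2; cmod w \<le> \<bar>E\<^sub>0\<bar> + 2\<rbrakk> \<Longrightarrow> cmod (c z - c w) \<le> L * cmod (z - w)"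
    by (rule dirichlet_transform_lipschitz[OF V assms(10) _ supp', of "\<bar>E\<^sub>0\<bar> + 2", folded c_def])
      (simp, simp, rule that)
  \<comment> \<open>An energy used below differs from \<open>E\<^sub>0\<close> by at most
    \<open>2 * \<delta>\<close>: one \<open>\<delta>\<close> for the diameter of \<open>A N\<close>,
    one for 3 / T. The second entry of the minimum keeps the transform within half of |c0|; the
    entry 1 keeps the energies in the disc of radius \<open>\<bar>E\<^sub>0\<bar> + 2\<close> on
    which \<open>L\<close> is valid.\<close>
  define \<delta> where "\<delta> = min 1 (cmod c0 / (4 * L))"
  have \<delta>: "0 < \<delta>" "\<delta> \<le> 1" "L * (2 * \<delta>) \<le> cmod c0 / 2"
  proof -
    show "0 < \<delta>" "\<delta> \<le> 1" using c0 L by (auto simp: \<delta>_def)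
    have "L * (2 * \<delta>) \<le> L * (2 * (cmod c0 / (4 * L)))" using L by (intro mult_left_mono) (auto simp: \<delta>_def)
    then show "L * (2 * \<delta>) \<le> cmod c0 / 2" using L by simp
  qed
  \<comment> \<open>The factor from \<open>dirichlet_solution_perturbation\<close> at distance 3 / T
    from \<open>A N\<close>, where its exponent is \<open>3 * C\<close> by the choice of
    \<open>N\<close>; the remaining \<open>N powr \<alpha>\<close> is kept separate.\<close>
  define D where "D = C * (1 + 3 * C) * exp (3 * C)"
  have D: "0 < D" using assms(3) by (simp add: D_def add_pos_pos)
  \<comment> \<open>The factor 2 comes from the prefactor 2 / T, \<open>2 powr (- p)\<close> from
    |x| \<ge> N / 2, and the rest from \<open>tail_lower_bound\<close>.\<close>
  define C' where "C' = 2 * 2 powr (- p) * (cmod c0)\<^sup>2 / (3600 * pi * D\<^sup>2)"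
  have C': "0 < C'" using c0 D by (simp add: C'_def)
  have core: "averaged_moment U f T p \<ge>
      ennreal C' * emeasure lebesgue (neighborhood (1 / T) (A N)) * ennreal (N powr (p - 3 * \<alpha>))"
    if N: "1 \<le> N" "2 * R \<le> N" "A N \<subseteq> power_bounded_energies V \<alpha> C N" "E\<^sub>0 \<in> A N" "bounded (A N)"
      "diameter (A N) < \<delta>" and T: "3 / \<delta> < T" "T = N powr (1 + \<alpha>)" for N T
  proof -
    define B where "B = neighborhood (1 / T) (A N)"
    have N0: "0 < N" using N by simp
    have T0: "0 < T" using N0 T(2) by simp
    have T3: "3 / T < \<delta>" using T(1) T0 \<delta>(1) by (simp add: field_simps)
    have mem: "\<exists>a\<in>A N. \<bar>E - a\<bar> < 1 / T \<and> \<bar>E - E\<^sub>0\<bar> \<le> \<delta> + 1 / T" if "E \<in> B" for E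
    proof -
      obtain a where a: "a \<in> A N" "\<bar>E - a\<bar> < 1 / T" using \<open>E \<in> B\<close> unfolding B_def neighborhood_def dist_real_def by blast
      \<comment> \<open>\<open>diameter\<close> is a real supremum and bounds distances only within
        a bounded set; this is where boundedness of \<open>A N\<close> enters.\<close>
      have "dist a E\<^sub>0 \<le> diameter (A N)" by (rule diameter_bounded_bound[OF N(5) a(1) N(4)])
      then have "\<bar>E - E\<^sub>0\<bar> \<le> \<delta> + 1 / T" using a N(6) unfolding dist_real_def by linarith
      then show ?thesis using a by blast
    qed
    have bB: "bounded B"
    proof (rule bounded_subset[OF bounded_cball])
      show "B \<subseteq> cball E\<^sub>0 (\<delta> + 1 / T)" using mem by (auto simp: dist_real_def abs_minus_commute)
    qed
    have oB: "open B" unfolding B_def by (rule neighborhood_open)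
    have B: "B \<in> sets borel" "emeasure lborel B < \<infinity>"
      using oB emeasure_bounded_finite[OF bB] by auto
    have eB: "emeasure lebesgue B = ennreal (measure lborel B)"
      using B emeasure_eq_ennreal_measure[of lborel B] by simp
    have BdN: "C * N powr \<alpha> * (3 / T) * N = 3 * C"
      using N0 unfolding T(2) by (simp add: powr_add field_simps)
    have pert: "cmod (dirichlet_solution V (Complex E (2 / T)) x) \<le> D * N powr \<alpha> \<and>
        cmod (dirichlet_solution_deriv V (Complex E (2 / T)) x) \<le> D * N powr \<alpha>" if "E \<in> B" "x \<in> {0..N}" for E x
    proof -
      obtain a where a: "a \<in> A N" "\<bar>E - a\<bar> < 1 / T" using mem[OF \<open>E \<in> B\<close>] by blast
      have "cmod (Complex E (2 / T) - complex_of_real a) \<le> \<bar>E - a\<bar> + \<bar>2 / T\<bar>"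
        using cmod_le[of "Complex E (2 / T) - complex_of_real a"] by simp
      also have "\<dots> \<le> 1 / T + 2 / T" using a(2) T0 by (intro add_mono) auto
      also have "\<dots> = 3 / T" by (simp add: add_divide_distrib[symmetric])
      finally have z: "cmod (Complex E (2 / T) - complex_of_real a) \<le> 3 / T" .
      have aP: "a \<in> power_bounded_energies V \<alpha> C N" using a N(3) by blast
      show ?thesis
        using dirichlet_solution_perturbation[OF V aP _ _ z \<open>x \<in> {0..N}\<close>] assms(3) N0
        unfolding BdN by (simp add: D_def mult_ac)
    qed
    have cl: "cmod ((\<integral>x. f x * dirichlet_solution V (Complex E (2 / T)) x \<partial>half_line) - c0) \<le> cmod c0 / 2" if "E \<in> B" for E
    proof -
      have E: "\<bar>E - E\<^sub>0\<bar> \<le> \<delta> + 1 / T" using mem[OF that] by blast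
      have "cmod (Complex E (2 / T) - complex_of_real E\<^sub>0) \<le> \<bar>E - E\<^sub>0\<bar> + \<bar>2 / T\<bar>"
        using cmod_le[of "Complex E (2 / T) - complex_of_real E\<^sub>0"] by simp
      also have "\<dots> \<le> (\<delta> + 1 / T) + 2 / T" using E T0 by (intro add_mono) auto
      also have "\<dots> = \<delta> + 3 / T" by (simp add: add_divide_distrib[symmetric])
      also have "\<dots> \<le> 2 * \<delta>" using T3 by simp
      finally have d: "cmod (Complex E (2 / T) - complex_of_real E\<^sub>0) \<le> 2 * \<delta>" .
      have "cmod (Complex E (2 / T)) \<le> cmod (complex_of_real E\<^sub>0) + cmod (Complex E (2 / T) - complex_of_real E\<^sub>0)"
        by (metis norm_triangle_sub)
      also have "\<dots> \<le> \<bar>E\<^sub>0\<bar> + 2" using d \<delta>(2) by simp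
      finally have "cmod (c (Complex E (2 / T)) - c (complex_of_real E\<^sub>0)) \<le> L * cmod (Complex E (2 / T) - complex_of_real E\<^sub>0)"
        by (intro lip) auto
      also have "\<dots> \<le> L * (2 * \<delta>)" using d L by (intro mult_left_mono) auto
      finally show ?thesis using \<delta>(3) by (simp add: c_def c0_def)
    qed
    have DN: "0 < D * N powr \<alpha>" using D N0 by simp
    have \<tau>: "0 < 2 / T" using T0 by simp
    note tail = tail_lower_bound[OF V assms(2) assms(10) supp N(1,2) \<tau> B bB pert DN cl]
    have "ennreal (2 / T) * (ennreal ((N / 2) powr p) * ennreal ((cmod c0)\<^sup>2 * N * measure lborel B / (3600 * pi * (D * N powr \<alpha>)\<^sup>2)))
        \<le> ennreal (2 / T) * (ennreal ((N / 2) powr p) * (\<integral>\<^sup>+t\<in>{0..}. ennreal (exp (- (2 / T) * t)) * (\<integral>\<^sup>+x. ennreal ((cmod (U t f x))\<^sup>2) \<partial>lebesgue_on {N/2..N}) \<partial>lebesgue))"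
      by (intro mult_left_mono tail) auto
    also have "\<dots> \<le> ennreal (2 / T) * (\<integral>\<^sup>+t. ennreal ((N / 2) powr p) * (ennreal (exp (- (2 / T) * t)) * (\<integral>\<^sup>+x. ennreal ((cmod (U t f x))\<^sup>2) \<partial>lebesgue_on {N/2..N}) * indicator {0..} t) \<partial>lebesgue)"
      by (intro mult_left_mono nn_integral_cmult_ge) auto
    also have "\<dots> \<le> averaged_moment U f T p"
      unfolding averaged_moment_def
    proof (intro mult_left_mono nn_integral_mono)
      fix t
      have "ennreal (exp (- (2 / T) * t)) * (ennreal ((N / 2) powr p) * (\<integral>\<^sup>+x. ennreal ((cmod (U t f x))\<^sup>2) \<partial>lebesgue_on {N/2..N})) * indicator {0..} t
          \<le> ennreal (exp (- 2 * t / T)) * position_norm2 (p / 2) (U t f) * indicator {0..} t"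
        using N0 assms(9) by (intro mult_mono position_norm2_ge) auto
      then show "ennreal ((N / 2) powr p) * (ennreal (exp (- (2 / T) * t)) * (\<integral>\<^sup>+x. ennreal ((cmod (U t f x))\<^sup>2) \<partial>lebesgue_on {N/2..N}) * indicator {0..} t)
          \<le> ennreal (exp (- 2 * t / T)) * position_norm2 (p / 2) (U t f) * indicator {0..} t"
        by (simp only: mult_ac)
    qed simp
    also have "ennreal (2 / T) * (ennreal ((N / 2) powr p) * ennreal ((cmod c0)\<^sup>2 * N * measure lborel B / (3600 * pi * (D * N powr \<alpha>)\<^sup>2)))
        = ennreal (2 / T * ((N / 2) powr p * ((cmod c0)\<^sup>2 * N * measure lborel B / (3600 * pi * (D * N powr \<alpha>)\<^sup>2))))"
      using T0 N0 by (simp only: ennreal_mult[symmetric] divide_nonneg_nonneg mult_nonneg_nonneg zero_le_power2 measure_nonneg powr_ge_zero pi_ge_zero less_imp_le zero_le_numeral)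
    also have "2 / T * ((N / 2) powr p * ((cmod c0)\<^sup>2 * N * measure lborel B / (3600 * pi * (D * N powr \<alpha>)\<^sup>2)))
        = C' * measure lborel B * N powr (p - 3 * \<alpha>)"
    proof -
      have h: "(N / 2) powr p = N powr p * 2 powr (- p)" using N0 by (simp add: powr_divide powr_minus_divide)
      \<comment> \<open>This is the exponent count: N powr p is the position weight, the extra
        \<open>N\<close> comes from the mass bound, \<open>T\<close> from the prefactor, and the
        square of N powr \<alpha> from the bound on the solutions.\<close>
      have "N powr p * N = N powr (p - 3 * \<alpha>) * (T * (N powr \<alpha>)\<^sup>2)"
      proof -
        have "N powr (p - 3 * \<alpha>) * (T * (N powr \<alpha>)\<^sup>2) = N powr ((p - 3 * \<alpha>) + ((1 + \<alpha>) + (\<alpha> + \<alpha>)))"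
          unfolding T(2) by (simp only: powr_add power2_eq_square)
        also have "(p - 3 * \<alpha>) + ((1 + \<alpha>) + (\<alpha> + \<alpha>)) = p + 1" by simp
        finally show ?thesis using N0 by (simp add: powr_add)
      qed
      moreover have "2 / T * ((N / 2) powr p * ((cmod c0)\<^sup>2 * N * measure lborel B / (3600 * pi * (D * N powr \<alpha>)\<^sup>2)))
          = C' * measure lborel B * (N powr p * N / (T * (N powr \<alpha>)\<^sup>2))"
        unfolding h C'_def using T0 N0 D by (simp add: field_simps power_mult_distrib)
      ultimately show ?thesis using T0 N0 by simp
    qed
    also have "ennreal (C' * measure lborel B * N powr (p - 3 * \<alpha>)) = ennreal C' * emeasure lebesgue B * ennreal (N powr (p - 3 * \<alpha>))"
      unfolding eB using C' by (simp add: ennreal_mult)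
    finally show ?thesis by (simp add: B_def)
  qed
  have Ninf: "filterlim (\<lambda>T. T powr (1 / (1 + \<alpha>))) at_top at_top"
    unfolding filterlim_at_top
  proof
    fix Z :: real
    show "\<forall>\<^sub>F T in at_top. Z \<le> T powr (1 / (1 + \<alpha>))"
      using eventually_ge_at_top[of "max Z 1 powr (1 + \<alpha>)"]
    proof eventually_elim
      case (elim T)
      have "Z \<le> (max Z 1 powr (1 + \<alpha>)) powr (1 / (1 + \<alpha>))"
        using assms(4) by (simp add: powr_powr)
      also have "\<dots> \<le> T powr (1 / (1 + \<alpha>))"
        using elim assms(4) by (intro powr_mono2) auto
      finally show ?case .
    qed
  qed
  have "\<forall>\<^sub>F N in at_top. 1 \<le> N \<and> 2 * R \<le> N \<and> (A N \<subseteq> power_bounded_energies V \<alpha> C N \<and> E\<^sub>0 \<in> A N)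
      \<and> bounded (A N) \<and> diameter (A N) < \<delta>"
    using eventually_ge_at_top[of 1] eventually_ge_at_top[of "2 * R"] assms(6,7) order_tendstoD(2)[OF assms(8) \<delta>(1)]
    by eventually_elim blast
  from eventually_compose_filterlim[OF this Ninf]
  have ev: "\<forall>\<^sub>F T in at_top. averaged_moment U f T p \<ge>
      ennreal C' * emeasure lebesgue (neighborhood (1 / T) (A (T powr (1 / (1 + \<alpha>)))))
        * ennreal (T powr ((p - 3 * \<alpha>) / (1 + \<alpha>)))"
    using eventually_gt_at_top[of "3 / \<delta>"] eventually_gt_at_top[of 0]
  proof eventually_elim
    case (elim T)
    have "T = (T powr (1 / (1 + \<alpha>))) powr (1 + \<alpha>)" using elim assms(4) by (simp add: powr_powr)
    moreover have "(T powr (1 / (1 + \<alpha>))) powr (p - 3 * \<alpha>) = T powr ((p - 3 * \<alpha>) / (1 + \<alpha>))"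
      by (simp add: powr_powr)
    ultimately show ?case using core[of "T powr (1 / (1 + \<alpha>))" T] elim by simp
  qed
  then show ?thesis using C' by blast
qed

end
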